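(* Let $G$ be a discrete Abelian group, and let $k$ be a positive integer. (i) If $r_0(G)$ is finite, then spectral synthesis holds in $C(G,\mathbb{C}^k)$. (ii) If $r_0(G)<\kappa$, then local spectral synthesis holds in $C(G,\mathbb{C}^k)$.
   Context: $r_0(G)$ denotes the torsion free rank of $G$, that is, the cardinality of a maximal independent system of elements of infinite order. For a finite dimensional complex Banach space $E$ and $G$ discrete, $C(G,E)=E^G$ is the space of all functions $f\colon G\to E$ with the topology of uniform convergence on compact (i.e. finite) subsets of $G$. Put $T_g f(x)=f(x+g)$, $\Delta_g f(x)=f(x+g)-f(x)$, and let $L_f$ be the complex linear span of the translates $T_g f$. A variety in $C(G,E)$ is a translation invariant closed linear subspace. A function $f\colon G\to E$ is a generalized polynomial if there is an $n\ge 0$ with $\Delta_{h_1}\cdots\Delta_{h_{n+1}}f=0$ for all $h_1,\ldots,h_{n+1}\in G$; it is a polynomial if it is a generalized polynomial and $\dim L_f<\infty$; it is a local polynomial if its restriction to any finitely generated subsemigroup of $G$ is a polynomial (on that subsemigroup). An exponential is a function $m\colon G\to\mathbb{C}$, $m\ne 0$, with $m(x+y)=m(x)m(y)$ for all $x,y\in G$. An exponential polynomial is a function $f\colon G\to E$ with $\dim L_f<\infty$. A local exponential polynomial is a function of the form $\sum_{i=1}^n m_i\cdot p_i$, where each $m_i$ is an exponential and each $p_i\colon G\to E$ is a local polynomial. Spectral synthesis (resp. local spectral synthesis) holds in $C(G,E)$ if every variety $V$ in $C(G,E)$ is the closed linear hull of the set of exponential polynomials (resp. local exponential polynomials) contained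 in $V$. $\kappa$ denotes the uncountable cardinal with the property that, for every discrete Abelian group $G$, local spectral synthesis holds in $C(G,\mathbb{C})$ if and only if $r_0(G)<\kappa$ (the existence of such a cardinal is a known theorem: M. Laczkovich, Local spectral synthesis on Abelian groups, Acta Math. Hungar. 142 (2014), Theorem 3). *)

theory Defs
  imports
    "HOL-Analysis.Analysis"
    "HOL-Algebra.Multiplicative_Group"
    "HOL-Library.Function_Algebras"
begin

unbundle cardinal_syntax

text \<open>
  Abelian groups are \<open>comm_group\<close> records, written multiplicatively. The complex vector
  space \<open>E\<close> is a type together with its scalar multiplication \<open>s\<close>; the instances used are
  \<open>(*)\<close> on \<open>complex\<close> and \<open>(*s)\<close> on \<open>complex ^ 'n\<close>.

  A function on \<open>carrier G\<close> is represented by its extension by \<open>0\<close>. This embeds \<open>C(G,E)\<close> as a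
  closed linear subspace of \<open>'a \<Rightarrow> 'e\<close>, whose library topology is the product topology;
  \<open>closure_funs_on_iff\<close> below identifies it with uniform convergence on finite subsets of \<open>G\<close>.
  The notions below that make sense on a semigroup only refer to the carrier and the
  multiplication, so that they can be applied to \<open>G\<lparr>carrier := S\<rparr>\<close> for a subsemigroup \<open>S\<close>.
\<close>

definition funs_on :: "('a, 'm) monoid_scheme \<Rightarrow> ('a \<Rightarrow> 'e::real_normed_vector) set" where
  "funs_on G = {f. \<forall>x. x \<notin> carrier G \<longrightarrow> f x = 0}"

definition restr :: "'a set \<Rightarrow> ('a \<Rightarrow> 'e::real_normed_vector) \<Rightarrow> 'a \<Rightarrow> 'e" where
  "restr S f = (\<lambda>x. if x \<in> S then f x else 0)"

definition pointwise_scale ::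
    "(complex \<Rightarrow> 'e \<Rightarrow> 'e) \<Rightarrow> complex \<Rightarrow> ('a \<Rightarrow> 'e) \<Rightarrow> 'a \<Rightarrow> 'e" where
  "pointwise_scale s c f = (\<lambda>x. s c (f x))"

definition translate ::
    "('a, 'm) monoid_scheme \<Rightarrow> 'a \<Rightarrow> ('a \<Rightarrow> 'e::real_normed_vector) \<Rightarrow> 'a \<Rightarrow> 'e" where
  "translate G g f = restr (carrier G) (\<lambda>x. f (x \<otimes>\<^bsub>G\<^esub> g))"

definition difference ::
    "('a, 'm) monoid_scheme \<Rightarrow> 'a \<Rightarrow> ('a \<Rightarrow> 'e::real_normed_vector) \<Rightarrow> 'a \<Rightarrow> 'e" where
  "difference G h f = restr (carrier G) (\<lambda>x. f (x \<otimes>\<^bsub>G\<^esub> h) - f x)"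

definition translate_span ::
    "(complex \<Rightarrow> 'e \<Rightarrow> 'e) \<Rightarrow> ('a, 'm) monoid_scheme \<Rightarrow> ('a \<Rightarrow> 'e::real_normed_vector)
      \<Rightarrow> ('a \<Rightarrow> 'e) set" where
  "translate_span s G f =
     Modules.module.span (pointwise_scale s) ((\<lambda>g. translate G g f) ` carrier G)"

text \<open>Finite dimension is not expressed by \<open>dim\<close>, which is \<open>0\<close> on infinite-dimensional spaces.\<close>

definition finite_dim ::
    "(complex \<Rightarrow> 'e \<Rightarrow> 'e) \<Rightarrow> ('a \<Rightarrow> 'e::real_normed_vector) set \<Rightarrow> bool" where
  "finite_dim s L \<longleftrightarrow> (\<exists>B. finite B \<and> L \<subseteq> Modules.module.span (pointwise_scale s) B)"

definition variety ::
    "(complex \<Rightarrow> 'e \<Rightarrow> 'e) \<Rightarrow> ('a, 'm) monoid_scheme \<Rightarrow> ('a \<Rightarrow> 'e::real_normed_vector) set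
      \<Rightarrow> bool" where
  "variety s G V \<longleftrightarrow>
     V \<subseteq> funs_on G \<and> Modules.module.subspace (pointwise_scale s) V \<and> closed V \<and>
     (\<forall>g\<in>carrier G. \<forall>f\<in>V. translate G g f \<in> V)"

definition generalized_polynomial ::
    "('a, 'm) monoid_scheme \<Rightarrow> ('a \<Rightarrow> 'e::real_normed_vector) \<Rightarrow> bool" where
  "generalized_polynomial G f \<longleftrightarrow> f \<in> funs_on G \<and>
     (\<exists>n. \<forall>hs. set hs \<subseteq> carrier G \<and> length hs = Suc n \<longrightarrow> foldr (difference G) hs f = (\<lambda>_. 0))"

definition polynomial_on ::
    "(complex \<Rightarrow> 'e \<Rightarrow> 'e) \<Rightarrow> ('a, 'm) monoid_scheme \<Rightarrow> ('a \<Rightarrow> 'e::real_normed_vector) \<Rightarrow> bool"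
  where
  "polynomial_on s G f \<longleftrightarrow> generalized_polynomial G f \<and> finite_dim s (translate_span s G f)"

inductive_set subsemigroup_generated ::
    "('a, 'm) monoid_scheme \<Rightarrow> 'a set \<Rightarrow> 'a set"
  for G :: "('a, 'm) monoid_scheme" and F :: "'a set" where
  base: "x \<in> F \<Longrightarrow> x \<in> subsemigroup_generated G F"
| mult: "x \<in> subsemigroup_generated G F \<Longrightarrow> y \<in> subsemigroup_generated G F
          \<Longrightarrow> x \<otimes>\<^bsub>G\<^esub> y \<in> subsemigroup_generated G F"

definition local_polynomial ::
    "(complex \<Rightarrow> 'e \<Rightarrow> 'e) \<Rightarrow> ('a, 'm) monoid_scheme \<Rightarrow> ('a \<Rightarrow> 'e::real_normed_vector) \<Rightarrow> bool"
  where
  "local_polynomial s G f \<longleftrightarrow> f \<in> funs_on G \<and>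
     (\<forall>F. finite F \<and> F \<subseteq> carrier G \<longrightarrow>
        (let S = subsemigroup_generated G F in polynomial_on s (G\<lparr>carrier := S\<rparr>) (restr S f)))"

definition exponential :: "('a, 'm) monoid_scheme \<Rightarrow> ('a \<Rightarrow> complex) \<Rightarrow> bool" where
  "exponential G m \<longleftrightarrow> m \<in> funs_on G \<and> m \<noteq> (\<lambda>_. 0) \<and>
     (\<forall>x\<in>carrier G. \<forall>y\<in>carrier G. m (x \<otimes>\<^bsub>G\<^esub> y) = m x * m y)"

definition exponential_polynomial ::
    "(complex \<Rightarrow> 'e \<Rightarrow> 'e) \<Rightarrow> ('a, 'm) monoid_scheme \<Rightarrow> ('a \<Rightarrow> 'e::real_normed_vector) \<Rightarrow> bool"
  where
  "exponential_polynomial s G f \<longleftrightarrow> f \<in> funs_on G \<and> finite_dim s (translate_span s G f)"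

definition local_exponential_polynomial ::
    "(complex \<Rightarrow> 'e \<Rightarrow> 'e) \<Rightarrow> ('a, 'm) monoid_scheme \<Rightarrow> ('a \<Rightarrow> 'e::real_normed_vector) \<Rightarrow> bool"
  where
  "local_exponential_polynomial s G f \<longleftrightarrow>
     (\<exists>(n::nat) m p. (\<forall>i<n. exponential G (m i) \<and> local_polynomial s G (p i)) \<and>
        f = (\<lambda>x. \<Sum>i<n. s (m i x) (p i x)))"

definition spectral_synthesis ::
    "(complex \<Rightarrow> 'e \<Rightarrow> 'e::real_normed_vector) \<Rightarrow> ('a, 'm) monoid_scheme \<Rightarrow> bool" where
  "spectral_synthesis s G \<longleftrightarrow> (\<forall>V. variety s G V \<longrightarrow>
     V = closure (Modules.module.span (pointwise_scale s) {f \<in> V. exponential_polynomial s G f}))"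

definition local_spectral_synthesis ::
    "(complex \<Rightarrow> 'e \<Rightarrow> 'e::real_normed_vector) \<Rightarrow> ('a, 'm) monoid_scheme \<Rightarrow> bool" where
  "local_spectral_synthesis s G \<longleftrightarrow> (\<forall>V. variety s G V \<longrightarrow>
     V = closure (Modules.module.span (pointwise_scale s)
           {f \<in> V. local_exponential_polynomial s G f}))"

text \<open>An element has infinite order iff \<open>ord\<close> is \<open>0\<close>.\<close>

definition independent_system :: "('a, 'm) monoid_scheme \<Rightarrow> 'a set \<Rightarrow> bool" where
  "independent_system G B \<longleftrightarrow>
     B \<subseteq> carrier G \<and> (\<forall>b\<in>B. group.ord G b = 0) \<and>
     (\<forall>F (c :: 'a \<Rightarrow> int). finite F \<and> F \<subseteq> B \<and> (\<Otimes>\<^bsub>G\<^esub>b\<in>F. b [^]\<^bsub>G\<^esub> c b) = \<one>\<^bsub>G\<^esub>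
        \<longrightarrow> (\<forall>b\<in>F. c b = 0))"

definition maximal_independent_system :: "('a, 'm) monoid_scheme \<Rightarrow> 'a set \<Rightarrow> bool" where
  "maximal_independent_system G B \<longleftrightarrow> independent_system G B \<and>
     (\<forall>B'. independent_system G B' \<and> B \<subseteq> B' \<longrightarrow> B' = B)"

text \<open>
  The cardinality does not depend on the maximal independent system that is chosen, and one
  exists by \<open>ex_maximal_independent_system\<close> below.
\<close>

definition torsion_free_rank :: "('a, 'm) monoid_scheme \<Rightarrow> 'a rel" where
  "torsion_free_rank G = |SOME B. maximal_independent_system G B|"

text \<open>
  The defining property of \<open>\<kappa>\<close>, for groups whose carrier is contained in the type \<open>'u\<close>.
  If \<open>'u\<close> has at least the cardinality of the continuum, this is equivalent to the property for
  all Abelian groups: every cardinal up to the continuum is the torsion free rank of a group on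
  \<open>'u\<close>, and local spectral synthesis fails for rank continuum, so the groups on \<open>'u\<close> already
  determine \<open>\<kappa>\<close>.
\<close>

definition local_synthesis_cardinal :: "'u itself \<Rightarrow> 'c rel \<Rightarrow> bool" where
  "local_synthesis_cardinal (_ :: 'u itself) \<kappa> \<longleftrightarrow>
     Card_order \<kappa> \<and> natLeq <o \<kappa> \<and>
     (\<forall>H :: 'u monoid. comm_group H \<longrightarrow>
        (local_spectral_synthesis ((*) :: complex \<Rightarrow> complex \<Rightarrow> complex) H
           \<longleftrightarrow> torsion_free_rank H <o \<kappa>))"

lemma closure_funs_on_iff:
  fixes f :: "'a \<Rightarrow> 'e::real_normed_vector"
  assumes "f \<in> funs_on G" "V \<subseteq> funs_on G"
  shows "f \<in> closure V \<longleftrightarrow>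
    (\<forall>K e. finite K \<and> K \<subseteq> carrier G \<and> e > 0 \<longrightarrow> (\<exists>g\<in>V. \<forall>x\<in>K. norm (g x - f x) < e))"
    (is "?L \<longleftrightarrow> ?R")
proof
  assume L: ?L
  show ?R
  proof (intro allI impI, elim conjE)
    fix K and e :: real assume K: "finite K" "K \<subseteq> carrier G" "e > 0"
    define U where "U = Pi\<^sub>E UNIV (\<lambda>x. if x \<in> K then ball (f x) e else UNIV)"
    have "open U" unfolding U_def
      by (rule open_PiE) (use K in \<open>auto simp: if_distrib cong: if_cong\<close>)
    moreover have "f \<in> U" using K by (auto simp: U_def)
    ultimately obtain g where g: "g \<in> V" "g \<in> U"
      using L by (auto simp: closure_iff_nhds_not_empty)
    have "norm (g x - f x) < e" if "x \<in> K" for x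
    proof -
      have "g x \<in> (if x \<in> K then ball (f x) e else UNIV)"
        using g(2) unfolding U_def by (rule PiE_mem) simp
      with that show ?thesis by (simp add: dist_norm norm_minus_commute)
    qed
    then show "\<exists>g\<in>V. \<forall>x\<in>K. norm (g x - f x) < e" using g by blast
  qed
next
  assume R: ?R
  have "\<exists>g\<in>V. g \<in> W" if W: "open W" "f \<in> W" for W
  proof -
    obtain X where X: "f \<in> Pi\<^sub>E UNIV X" "\<And>i. open (X i)" "finite {i. X i \<noteq> UNIV}" "Pi\<^sub>E UNIV X \<subseteq> W"
      using product_topology_open_contains_basis[of "\<lambda>_. euclidean" UNIV W f] W
      by (auto simp: open_fun_def)
    define K where "K = {i \<in> carrier G. X i \<noteq> UNIV}"
    have fK: "finite K" using X(3) by (rule finite_subset[rotated]) (auto simp: K_def)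
    have "\<forall>i. \<exists>d>0. ball (f i) d \<subseteq> X i"
      using X(1,2) by (meson PiE_mem UNIV_I open_contains_ball)
    then obtain d where d: "\<And>i. d i > 0" "\<And>i. ball (f i) (d i) \<subseteq> X i" by metis
    define e where "e = Min (insert 1 (d ` K))"
    have e: "e > 0" "\<And>i. i \<in> K \<Longrightarrow> e \<le> d i" using fK d by (auto simp: e_def)
    obtain g where g: "g \<in> V" "\<forall>x\<in>K. norm (g x - f x) < e"
      using R fK e(1) by (force simp: K_def)
    have "g i \<in> X i" for i
    proof (cases "i \<in> K")
      case True
      then have "g i \<in> ball (f i) (d i)"
        using g(2) e(2)[OF True] by (force simp: dist_norm norm_minus_commute)
      then show ?thesis using d by blast
    next
      case False
      show ?thesis
      proof (cases "i \<in> carrier G")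
        case True
        with False show ?thesis by (auto simp: K_def)
      next
        case False
        then have "g i = f i" using g(1) assms by (auto simp: funs_on_def)
        then show ?thesis using X(1) by (auto simp: PiE_iff)
      qed
    qed
    then have "g \<in> Pi\<^sub>E UNIV X" by (simp add: PiE_iff)
    then show ?thesis using X(4) g(1) by blast
  qed
  then show ?L by (auto simp: closure_iff_nhds_not_empty)
qed

lemma ex_maximal_independent_system: "\<exists>B. maximal_independent_system G B"
proof -
  have "\<exists>M\<in>Collect (independent_system G).
          \<forall>X\<in>Collect (independent_system G). M \<subseteq> X \<longrightarrow> X = M"
  proof (rule subset_Zorn')
    fix C assume C: "subset.chain (Collect (independent_system G)) C"
    have "\<exists>B\<in>C. F \<subseteq> B" if "finite F" "F \<subseteq> \<Union>C" "F \<noteq> {}" for F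
      using finite_subset_Union_chain[OF that(1,2) _ C] that by auto
    moreover have "B \<in> C \<Longrightarrow> independent_system G B" for B
      using C by (auto simp: subset.chain_def)
    ultimately show "\<Union>C \<in> Collect (independent_system G)"
      unfolding independent_system_def mem_Collect_eq
      by (smt (verit, ccfv_threshold) Union_iff empty_iff subset_iff)
  qed
  then show ?thesis by (auto simp: maximal_independent_system_def)
qed

end

theory Submission
  imports Defs "HOL-Computational_Algebra.Fundamental_Theorem_Algebra"
begin

text \<open>
  The proof of (i) is by duality. The continuous linear functionals on \<open>C(G,E)\<close> are the linear
  combinations of evaluations; they form a module \<open>W\<close> over the group ring, generated by the
  finitely many coordinate evaluations at the identity. Closed subspaces are annihilators, so a
  variety is the annihilator of a submodule \<open>K0\<close> of \<open>W\<close>, and the annihilator of a submodule of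
  finite codimension is finite dimensional and hence consists of exponential polynomials.
  Spectral synthesis therefore follows once every submodule of \<open>W\<close> is an intersection of
  submodules of finite codimension (\<open>finite_codimension_submodule\<close>).

  Let \<open>x\<close> lie outside \<open>K0\<close>, and let \<open>K\<close> be maximal among the submodules that contain \<open>K0\<close> and
  avoid \<open>x\<close>. Then \<open>W / K\<close> has a least nonzero submodule, generated by \<open>x\<close>, and the claim is that
  \<open>W / K\<close> is finite dimensional. Some power of every group element lies in the monoid
  generated by one finite set \<open>B\<close>, and this makes the simple submodule spanned by a countable set.
  As \<open>\<complex>\<close> is uncountable and algebraically closed, every \<open>g\<close> acts on it by a
  scalar \<open>m g\<close> (\<open>eigenvalue_exists\<close>). Put \<open>t g = g - m g\<close>, and filter \<open>W\<close> by the powers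
  of the ideal that the operators \<open>t g\<close> generate. Because of \<open>B\<close>, each layer of this filtration is spanned by
  products of finitely many \<open>t b\<close> and is finite dimensional (\<open>filt_subset_homog_mod\<close>). By the
  maximality of \<open>K\<close> it remains to see that \<open>x\<close> is not in \<open>K + F N\<close> for some member \<open>F N\<close> of the
  filtration.

  For a finitely generated submonoid this is Krull's intersection theorem
  (\<open>x_not_in_all_K_mod\<close>), but the group ring of \<open>G\<close> itself need not be Noetherian. The passage
  to finitely generated submonoids uses initial forms. The initial forms of the elements of \<open>K\<close> that
  are visible over a finite set \<open>S\<close> form a submodule of a finitely generated graded module over the
  polynomial ring in the variables \<open>b \<in> B\<close>. These submodules increase with \<open>S\<close>, so they
  become constant from some \<open>S0\<close> on, and then the membership of \<open>x\<close> in every \<open>K + F N\<close> descends to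
  \<open>S0\<close> (\<open>filtration_descends\<close>), where it contradicts Krull's theorem. The chain conditions come
  from Hilbert's basis theorem for modules with commuting operators (\<open>noetherian_finite\<close>).

  The proof of (ii) is Nagata's idealization, read on the side of functions. A variety \<open>V\<close> in
  \<open>C(G, \<complex>^k)\<close> gives rise to the scalar variety on \<open>G \<times> \<int>^k\<close> of all functions
  \<open>f0 g + z1 * f1 g + \<dots> + zk * fk g\<close> with \<open>f \<in> V\<close> and an arbitrary function \<open>f0\<close> on \<open>G\<close>.
  Taking slopes in the directions of the \<open>z\<close> variables maps it continuously onto \<open>V\<close> and maps local
  exponential polynomials to local exponential polynomials, so local synthesis on \<open>G \<times> \<int>^k\<close>
  implies local synthesis for vector valued functions on \<open>G\<close> (\<open>local_spectral_synthesis_descends\<close>).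
  The torsion free rank of \<open>G \<times> \<int>^k\<close> stays below the uncountable cardinal \<open>\<kappa>\<close>
  (\<open>torsion_free_rank_extension\<close>).
\<close>

section \<open>Chain conditions for commuting operators\<close>

text \<open>
  A vector space with a family of commuting operators is a module over the polynomial ring in these
  operators, possibly in infinitely many variables. Stable subspaces are its submodules.
\<close>

locale commuting_operators = vector_space scale
  for scale :: "'f::field \<Rightarrow> 'w::ab_group_add \<Rightarrow> 'w" (infixr \<open>\<cdot>\<close> 75) +
  fixes T :: "'i \<Rightarrow> 'w \<Rightarrow> 'w" and I :: "'i set"
  assumes T_add: "i \<in> I \<Longrightarrow> T i (v + w) = T i v + T i w"
    and T_scale: "i \<in> I \<Longrightarrow> T i (c \<cdot> v) = c \<cdot> T i v"
    and T_comm: "i \<in> I \<Longrightarrow> j \<in> I \<Longrightarrow> T i (T j v) = T j (T i v)"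
begin

definition stable :: "'i set \<Rightarrow> 'w set \<Rightarrow> bool" where
  "stable J L \<longleftrightarrow> subspace L \<and> (\<forall>i\<in>J. \<forall>w\<in>L. T i w \<in> L)"

definition generated :: "'i set \<Rightarrow> 'w set \<Rightarrow> 'w set" where
  "generated J X = \<Inter>{L. stable J L \<and> X \<subseteq> L}"

lemma stableI: "subspace L \<Longrightarrow> (\<And>i w. i \<in> J \<Longrightarrow> w \<in> L \<Longrightarrow> T i w \<in> L) \<Longrightarrow> stable J L"
  by (auto simp: stable_def)

lemma stable_subspace: "stable J L \<Longrightarrow> subspace L"
  by (auto simp: stable_def)

lemma stable_T: "stable J L \<Longrightarrow> i \<in> J \<Longrightarrow> w \<in> L \<Longrightarrow> T i w \<in> L"
  by (auto simp: stable_def)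

lemma stable_mono: "stable J L \<Longrightarrow> J' \<subseteq> J \<Longrightarrow> stable J' L"
  by (auto simp: stable_def)

lemma stable_generated: "stable J (generated J X)"
  unfolding generated_def stable_def
  by (auto intro!: subspaceI intro: subspace_0 subspace_add subspace_scale)

lemmas subspace_generated = stable_subspace[OF stable_generated]

lemma generated_base: "x \<in> X \<Longrightarrow> x \<in> generated J X"
  by (auto simp: generated_def)

lemma generated_least: "stable J L \<Longrightarrow> X \<subseteq> L \<Longrightarrow> generated J X \<subseteq> L"
  by (auto simp: generated_def)

lemma generated_mono: "J \<subseteq> J' \<Longrightarrow> X \<subseteq> X' \<Longrightarrow> generated J X \<subseteq> generated J' X'"
  by (intro generated_least stable_mono[OF stable_generated]) (auto intro: generated_base)

lemma T_0: "i \<in> I \<Longrightarrow> T i 0 = 0"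
  using T_scale[of i 0 0] by simp

lemma T_minus: "i \<in> I \<Longrightarrow> T i (- v) = - T i v"
  using T_add[of i v "- v"] T_0[of i] by (simp add: eq_neg_iff_add_eq_0 add.commute)

lemma T_diff: "i \<in> I \<Longrightarrow> T i (v - w) = T i v - T i w"
  using T_add[of i v "- w"] by (simp add: T_minus)

lemma pow_add: "i \<in> I \<Longrightarrow> (T i ^^ n) (v + w) = (T i ^^ n) v + (T i ^^ n) w"
  by (induction n) (auto simp: T_add)

lemma pow_scale: "i \<in> I \<Longrightarrow> (T i ^^ n) (c \<cdot> v) = c \<cdot> (T i ^^ n) v"
  by (induction n) (auto simp: T_scale)

lemma pow_comm: "i \<in> I \<Longrightarrow> j \<in> I \<Longrightarrow> T j ((T i ^^ n) v) = (T i ^^ n) (T j v)"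
  by (induction n) (auto simp: T_comm)

lemma span_generated: "X \<subseteq> generated J Y \<Longrightarrow> span X \<subseteq> generated J Y"
  by (rule span_minimal[OF _ subspace_generated])

lemma stable_sums:
  assumes "J \<subseteq> I" "stable J A" "stable J B"
  shows "stable J {a + b | a b. a \<in> A \<and> b \<in> B}"
proof (rule stableI)
  show "subspace {a + b | a b. a \<in> A \<and> b \<in> B}"
    using assms by (intro subspace_sums) (auto simp: stable_def)
next
  fix i w assume i: "i \<in> J" and "w \<in> {a + b | a b. a \<in> A \<and> b \<in> B}"
  then obtain a b where "w = a + b" "a \<in> A" "b \<in> B" by blast
  moreover from this i assms have "T i w = T i a + T i b" "T i a \<in> A" "T i b \<in> B"
    by (auto simp: T_add subset_eq stable_def)
  ultimately show "T i w \<in> {a + b | a b. a \<in> A \<and> b \<in> B}" by blast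
qed

text \<open>
  The chain condition is asked of the submodule generated by \<open>X\<close>, over the operators in \<open>J\<close> alone.
\<close>

definition noetherian :: "'i set \<Rightarrow> 'w set \<Rightarrow> bool" where
  "noetherian J X \<longleftrightarrow> (\<forall>L :: nat \<Rightarrow> 'w set.
     (\<forall>n. stable J (L n) \<and> L n \<subseteq> generated J X \<and> L n \<subseteq> L (Suc n)) \<longrightarrow>
     (\<exists>N. \<forall>n\<ge>N. L n = L N))"

lemma noetherianD:
  assumes "noetherian J X" "\<And>n. stable J (L n)" "\<And>n. L n \<subseteq> generated J X" "\<And>n. L n \<subseteq> L (Suc n)"
  shows "\<exists>N. \<forall>n\<ge>N. L n = L N"
  using assms unfolding noetherian_def by blast

lemma eventually_constant_bool:
  assumes "\<And>n. P n \<Longrightarrow> P (Suc n)"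
  shows "\<exists>N. \<forall>n\<ge>N. P n = P (N::nat)"
proof (cases "\<exists>N. P N")
  case True
  then obtain N where N: "P N" by blast
  have "P n" if "n \<ge> N" for n using that by (induction rule: dec_induct) (auto simp: N assms)
  then show ?thesis using N by blast
qed auto

text \<open>
  A subspace \<open>L\<close> of the span of \<open>insert a X\<close> is determined, among the larger ones, by its intersection
  with the span of \<open>X\<close> and by whether it meets the coset of \<open>a\<close>. Along a chain both become constant.
\<close>

lemma noetherian_no_operators:
  assumes "finite X"
  shows "noetherian {} X"
proof -
  have span: "generated {} Y = span Y" for Y
    unfolding generated_def stable_def span_def hull_def by simp
  show ?thesis using assms
  proof (induction X)
    case empty
    show ?case
      unfolding noetherian_def span
    proof (intro allI impI)
      fix L :: "nat \<Rightarrow> 'w set"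
      assume "\<forall>n. stable {} (L n) \<and> L n \<subseteq> span {} \<and> L n \<subseteq> L (Suc n)"
      then have "L n = {0}" for n by (auto simp: stable_def dest: subspace_0)
      then show "\<exists>N. \<forall>n\<ge>N. L n = L N" by simp
    qed
  next
    case (insert a X)
    show ?case unfolding noetherian_def span
    proof (intro allI impI)
      fix L :: "nat \<Rightarrow> 'w set"
      assume L: "\<forall>n. stable {} (L n) \<and> L n \<subseteq> span (insert a X) \<and> L n \<subseteq> L (Suc n)"
      then have sub: "subspace (L n)" for n by (auto simp: stable_def)
      have inc: "L m \<subseteq> L n" if "m \<le> n" for m n
        using L by (intro lift_Suc_mono_le[OF _ that]) blast
      have "\<exists>N. \<forall>n\<ge>N. L n \<inter> span X = L N \<inter> span X"
        using L by (intro noetherianD[OF insert.IH])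
          (auto simp: stable_def span intro: subspace_inter)
      then obtain N1 where N1: "\<And>n. n \<ge> N1 \<Longrightarrow> L n \<inter> span X = L N1 \<inter> span X" by blast
      define P where "P n \<longleftrightarrow> (\<exists>w\<in>span X. a + w \<in> L n)" for n
      have "\<exists>N. \<forall>n\<ge>N. P n = P N"
        by (rule eventually_constant_bool) (use L in \<open>auto simp: P_def\<close>)
      then obtain N2 where N2: "\<And>n. n \<ge> N2 \<Longrightarrow> P n = P N2" by blast
      let ?N = "max N1 N2"
      have "L n \<subseteq> L ?N" if n: "n \<ge> ?N" for n
      proof
        fix v assume v: "v \<in> L n"
        then obtain c where c: "v - c \<cdot> a \<in> span X"
          using L by (blast dest: span_breakdown_eq[THEN iffD1])
        show "v \<in> L ?N"
        proof (cases "c = 0")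
          case True
          then show ?thesis using N1[of n] N1[of ?N] v c n by auto
        next
          case False
          have eq: "inverse c \<cdot> v = a + inverse c \<cdot> (v - c \<cdot> a)"
            using False by (simp add: scale_right_diff_distrib)
          have "inverse c \<cdot> v \<in> L n" by (intro subspace_scale sub v)
          then have "P n" using eq c unfolding P_def by (metis span_scale)
          then have "P ?N" using N2[of n] N2[of ?N] n by auto
          then obtain w where w: "w \<in> span X" "a + w \<in> L ?N" by (auto simp: P_def)
          have "v - c \<cdot> (a + w) \<in> L n"
            using w(2) inc[OF n] by (intro subspace_diff sub v subspace_scale) auto
          moreover have "v - c \<cdot> (a + w) \<in> span X"
            using span_diff[OF c span_scale[OF w(1), of c]] by (simp add: scale_right_distrib algebra_simps)
          ultimately have "v - c \<cdot> (a + w) \<in> L ?N"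
            using N1[of n] N1[of ?N] n by auto
          then have "(v - c \<cdot> (a + w)) + c \<cdot> (a + w) \<in> L ?N"
            by (intro subspace_add sub subspace_scale w)
          then show ?thesis by simp
        qed
      qed
      then show "\<exists>N. \<forall>n\<ge>N. L n = L N" using inc by blast
    qed
  qed
qed

text \<open>
  The elements of the module \<open>U[T i]\<close> that have a representation of degree less than \<open>d\<close>. The representation
  need not be unique, since the module is not assumed to be free.
\<close>

primrec deg_less :: "'i \<Rightarrow> 'w set \<Rightarrow> nat \<Rightarrow> 'w set" where
  "deg_less i U 0 = {0}"
| "deg_less i U (Suc d) = {w + (T i ^^ d) u | w u. w \<in> deg_less i U d \<and> u \<in> U}"

text \<open>
  The leading coefficients of the elements of \<open>L\<close> of degree \<open>d\<close>, as in Hilbert's basis theorem. As the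
  representations are not unique, any representation counts.
\<close>

definition leading :: "'i \<Rightarrow> 'w set \<Rightarrow> 'w set \<Rightarrow> nat \<Rightarrow> 'w set" where
  "leading i U L d = {u \<in> U. \<exists>w\<in>deg_less i U d. w + (T i ^^ d) u \<in> L}"

lemma stable_deg_less:
  assumes "i \<in> I" "J \<subseteq> I" "stable J U"
  shows "stable J (deg_less i U d)"
proof (induction d)
  case 0
  show ?case using assms by (auto simp: stable_def T_0 subspace_single_0)
next
  case (Suc d)
  have "stable J {(T i ^^ d) u | u. u \<in> U}"
  proof (rule stableI)
    have sub: "subspace U" using assms(3) by (rule stable_subspace)
    show "subspace {(T i ^^ d) u | u. u \<in> U}"
    proof (rule subspaceI)
      show "0 \<in> {(T i ^^ d) u | u. u \<in> U}"
        using subspace_0[OF sub] pow_scale[OF assms(1), of d 0 0] by force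
    next
      fix x y assume "x \<in> {(T i ^^ d) u | u. u \<in> U}" "y \<in> {(T i ^^ d) u | u. u \<in> U}"
      then obtain u v where "x = (T i ^^ d) u" "y = (T i ^^ d) v" "u \<in> U" "v \<in> U" by blast
      then show "x + y \<in> {(T i ^^ d) u | u. u \<in> U}"
        using pow_add[OF assms(1), of d u v] subspace_add[OF sub, of u v] by force
    next
      fix c x assume "x \<in> {(T i ^^ d) u | u. u \<in> U}"
      then obtain u where "x = (T i ^^ d) u" "u \<in> U" by blast
      then show "c \<cdot> x \<in> {(T i ^^ d) u | u. u \<in> U}"
        using pow_scale[OF assms(1), of d c u] subspace_scale[OF sub, of u c] by force
    qed
  next
    fix j w assume j: "j \<in> J" and "w \<in> {(T i ^^ d) u | u. u \<in> U}"
    then obtain u where u: "w = (T i ^^ d) u" "u \<in> U" by blast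
    have "T j w = (T i ^^ d) (T j u)"
      using assms j u by (auto simp: pow_comm subset_eq)
    then show "T j w \<in> {(T i ^^ d) u | u. u \<in> U}"
      using stable_T[OF assms(3) j u(2)] by blast
  qed
  from stable_sums[OF assms(2) Suc this] show ?case
    by (rule back_subst[of "stable J"]) auto
qed

lemma deg_less_mono: "0 \<in> U \<Longrightarrow> i \<in> I \<Longrightarrow> d \<le> e \<Longrightarrow> deg_less i U d \<subseteq> deg_less i U e"
proof (rule lift_Suc_mono_le[of "deg_less i U"])
  fix n assume "0 \<in> U" "i \<in> I"
  then show "deg_less i U n \<subseteq> deg_less i U (Suc n)"
    using pow_scale[of i n 0 0] by force
qed

lemma T_deg_less:
  assumes "i \<in> I" "0 \<in> U" "w \<in> deg_less i U d"
  shows "T i w \<in> deg_less i U (Suc d)"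
  using assms(3)
proof (induction d arbitrary: w)
  case 0
  then show ?case using assms pow_scale[of i 0 0 0] by (auto simp: T_0)
next
  case (Suc d)
  then obtain v u where w: "w = v + (T i ^^ d) u" "v \<in> deg_less i U d" "u \<in> U" by auto
  then have "T i w = T i v + (T i ^^ Suc d) u" using assms by (simp add: T_add)
  with Suc.IH[OF w(2)] w(3) show ?case by (subst deg_less.simps(2)) blast
qed

lemma stable_leading:
  assumes "i \<in> I" "J \<subseteq> I" "stable J U" "stable J L"
  shows "stable J (leading i U L d)"
proof -
  note D = stable_deg_less[OF assms(1-3), of d]
  note sD = stable_subspace[OF D] and sU = stable_subspace[OF assms(3)]
    and sL = stable_subspace[OF assms(4)]
  show ?thesis
  proof (rule stableI)
    show "subspace (leading i U L d)"
    proof (rule subspaceI)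
      show "0 \<in> leading i U L d"
        using subspace_0[OF sU] subspace_0[OF sD] subspace_0[OF sL] pow_scale[OF assms(1), of d 0 0]
        unfolding leading_def by (auto intro!: bexI[of _ 0])
    next
      fix x y assume "x \<in> leading i U L d" "y \<in> leading i U L d"
      then obtain v w where *: "x \<in> U" "y \<in> U" "v \<in> deg_less i U d" "w \<in> deg_less i U d"
        "v + (T i ^^ d) x \<in> L" "w + (T i ^^ d) y \<in> L"
        unfolding leading_def by blast
      have "(v + w) + (T i ^^ d) (x + y) \<in> L"
        using subspace_add[OF sL *(5,6)] by (simp add: pow_add[OF assms(1)] add_ac)
      then show "x + y \<in> leading i U L d"
        unfolding leading_def using * subspace_add[OF sD] subspace_add[OF sU] by blast
    next
      fix c x assume "x \<in> leading i U L d"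
      then obtain v where *: "x \<in> U" "v \<in> deg_less i U d" "v + (T i ^^ d) x \<in> L"
        unfolding leading_def by blast
      have "c \<cdot> v + (T i ^^ d) (c \<cdot> x) \<in> L"
        using subspace_scale[OF sL *(3), of c]
        by (simp add: pow_scale[OF assms(1)] scale_right_distrib)
      then show "c \<cdot> x \<in> leading i U L d"
        unfolding leading_def using * subspace_scale[OF sD] subspace_scale[OF sU] by blast
    qed
  next
    fix j x assume j: "j \<in> J" and "x \<in> leading i U L d"
    then obtain v where *: "x \<in> U" "v \<in> deg_less i U d" "v + (T i ^^ d) x \<in> L"
      unfolding leading_def by blast
    have "T j v + (T i ^^ d) (T j x) \<in> L"
      using stable_T[OF assms(4) j *(3)] assms j by (auto simp: T_add pow_comm subset_eq)
    then show "T j x \<in> leading i U L d"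
      unfolding leading_def using * stable_T[OF D j] stable_T[OF assms(3) j] by blast
  qed
qed

lemma generated_insert_deg_less:
  assumes "i \<in> I" "J \<subseteq> I"
  shows "generated (insert i J) X \<subseteq> (\<Union>d. deg_less i (generated J X) d)"
proof (rule generated_least)
  let ?D = "deg_less i (generated J X)"
  note 0 = subspace_0[OF subspace_generated[of J X]]
  note D = stable_deg_less[OF assms stable_generated, of X]
  have mono: "?D d \<subseteq> ?D e" if "d \<le> e" for d e
    by (rule deg_less_mono[OF 0 assms(1) that])
  show "X \<subseteq> (\<Union>d. ?D d)"
  proof
    fix x assume "x \<in> X"
    then have "x \<in> ?D (Suc 0)" by (auto intro: generated_base)
    then show "x \<in> (\<Union>d. ?D d)" by blast
  qed
  show "stable (insert i J) (\<Union>d. ?D d)"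
  proof (rule stableI)
    show "subspace (\<Union>d. ?D d)"
    proof (rule subspaceI)
      show "0 \<in> (\<Union>d. ?D d)" using deg_less.simps(1)[of i "generated J X"] by blast
    next
      fix x y assume "x \<in> (\<Union>d. ?D d)" "y \<in> (\<Union>d. ?D d)"
      then obtain d e where "x \<in> ?D d" "y \<in> ?D e" by blast
      then have "x \<in> ?D (max d e)" "y \<in> ?D (max d e)"
        using mono[of d "max d e"] mono[of e "max d e"] by auto
      then show "x + y \<in> (\<Union>d. ?D d)" using subspace_add[OF stable_subspace[OF D]] by blast
    next
      fix c x assume "x \<in> (\<Union>d. ?D d)"
      then show "c \<cdot> x \<in> (\<Union>d. ?D d)" using subspace_scale[OF stable_subspace[OF D]] by blast
    qed
  next
    fix j w assume j: "j \<in> insert i J" and "w \<in> (\<Union>d. ?D d)"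
    then obtain d where w: "w \<in> ?D d" by blast
    show "T j w \<in> (\<Union>d. ?D d)"
    proof (cases "j = i")
      case True
      then show ?thesis using T_deg_less[OF assms(1) 0 w] by blast
    next
      case False
      then show ?thesis using stable_T[OF D _ w] j by blast
    qed
  qed
qed

text \<open>
  Subtracting an element of \<open>L\<close> with the same leading coefficient lowers the degree of an element of \<open>L'\<close>.
\<close>

lemma leading_determines:
  assumes "i \<in> I" "J \<subseteq> I" "stable (insert i J) L" "L \<subseteq> L'"
    and "stable (insert i J) L'" "L' \<subseteq> generated (insert i J) X"
    and eq: "\<And>d. leading i (generated J X) L' d \<subseteq> leading i (generated J X) L d"
  shows "L' = L"
proof -
  let ?D = "deg_less i (generated J X)"
  note sL = stable_subspace[OF assms(3)] and sL' = stable_subspace[OF assms(5)]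
  note sD = stable_subspace[OF stable_deg_less[OF assms(1,2) stable_generated, of X]]
  have "L' \<inter> ?D d \<subseteq> L" for d
  proof (induction d)
    case 0
    then show ?case using subspace_0[OF sL] by auto
  next
    case (Suc d)
    show ?case
    proof
      fix v assume "v \<in> L' \<inter> ?D (Suc d)"
      then obtain w u where v: "v = w + (T i ^^ d) u" "w \<in> ?D d" "u \<in> generated J X" "v \<in> L'" by auto
      then have "u \<in> leading i (generated J X) L' d" by (auto simp: leading_def)
      then obtain w' where w': "w' \<in> ?D d" "w' + (T i ^^ d) u \<in> L"
        using eq[of d] by (auto simp: leading_def)
      have "v - (w' + (T i ^^ d) u) \<in> L'" using v(4) w'(2) assms(4) by (intro subspace_diff[OF sL']) auto
      then have "w - w' \<in> L'" using v(1) by simp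
      with Suc.IH subspace_diff[OF sD v(2) w'(1)] have "w - w' \<in> L" by blast
      from subspace_add[OF sL this w'(2)] show "v \<in> L" using v(1) by simp
    qed
  qed
  then show ?thesis using assms(4,6) generated_insert_deg_less[OF assms(1,2), of X] by blast
qed

text \<open>
  Hilbert's basis theorem, by induction on the number of operators. The leading coefficients
  of degree \<open>d\<close> of the \<open>n\<close>-th member of a chain increase both with \<open>n\<close> and with \<open>d\<close>. The diagonal of
  this double chain becomes constant, which leaves finitely many degrees to be treated one by one.
\<close>

theorem noetherian_finite:
  assumes "finite J" "J \<subseteq> I" "finite X"
  shows "noetherian J X"
  using assms(1,2)
proof (induction J)
  case empty
  show ?case by (rule noetherian_no_operators[OF assms(3)])
next
  case (insert i J)
  then have iJ: "i \<in> I" "J \<subseteq> I" and IH: "noetherian J X" by auto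
  show ?case
    unfolding noetherian_def
  proof (intro allI impI)
    fix L :: "nat \<Rightarrow> 'w set"
    assume L: "\<forall>n. stable (insert i J) (L n) \<and> L n \<subseteq> generated (insert i J) X \<and> L n \<subseteq> L (Suc n)"
    then have LJ: "stable J (L n)" for n by (meson stable_mono subset_insertI)
    have inc: "L m \<subseteq> L n" if "m \<le> n" for m n
      using L by (intro lift_Suc_mono_le[OF _ that]) blast
    define A where "A n d = leading i (generated J X) (L n) d" for n d
    have A_stable: "stable J (A n d)" for n d
      unfolding A_def by (rule stable_leading[OF iJ stable_generated LJ])
    have A_sub: "A n d \<subseteq> generated J X" for n d by (auto simp: A_def leading_def)
    have A1: "A m d \<subseteq> A n d" if "m \<le> n" for m n d
      using inc[OF that] unfolding A_def leading_def by blast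
    have A2: "A n d \<subseteq> A n (Suc d)" for n d
    proof
      fix u assume "u \<in> A n d"
      then obtain w where u: "u \<in> generated J X" "w \<in> deg_less i (generated J X) d" "w + (T i ^^ d) u \<in> L n"
        by (auto simp: A_def leading_def)
      have "T i (w + (T i ^^ d) u) \<in> L n" using L u(3) by (auto simp: stable_def)
      then have "T i w + (T i ^^ Suc d) u \<in> L n" using iJ by (simp add: T_add)
      then show "u \<in> A n (Suc d)"
        using u(1) T_deg_less[OF iJ(1) subspace_0[OF subspace_generated] u(2)]
        unfolding A_def leading_def by blast
    qed
    have A2': "A n d \<subseteq> A n e" if "d \<le> e" for n d e
      by (rule lift_Suc_mono_le[of "A n", OF A2 that])
    have "\<exists>N. \<forall>n\<ge>N. A n n = A N N"
    proof (rule noetherianD[OF IH A_stable A_sub])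
      show "A n n \<subseteq> A (Suc n) (Suc n)" for n
        using A1[of n "Suc n" n] A2[of "Suc n" n] by simp
    qed
    then obtain N where N: "\<And>n. n \<ge> N \<Longrightarrow> A n n = A N N" by blast
    have "\<forall>d. \<exists>M. \<forall>n\<ge>M. A n d = A M d"
      by (intro allI noetherianD[OF IH A_stable A_sub] A1) simp
    then obtain M where M: "\<And>d n. n \<ge> M d \<Longrightarrow> A n d = A (M d) d" by metis
    \<comment> \<open>Degrees \<open>d < N\<close> are handled by \<open>M d\<close>, and all others by the diagonal.\<close>
    define K where "K = Max (insert N (M ` {..<N}))"
    have K: "N \<le> K" "\<And>d. d < N \<Longrightarrow> M d \<le> K" by (auto simp: K_def)
    have "A n d \<subseteq> A K d" if n: "n \<ge> K" for n d
    proof (cases "d < N")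
      case True
      then show ?thesis using M[of d n] M[of d K] K n by (metis order_refl order_trans)
    next
      case False
      have "A n d \<subseteq> A (max n d) (max n d)" using A1 A2' by (meson max.cobounded1 max.cobounded2 order_trans)
      also have "\<dots> = A N N" by (rule N) (use False in auto)
      also have "\<dots> \<subseteq> A K d" using A1[OF K(1)] A2'[of N d] False by (meson not_less order_trans)
      finally show ?thesis .
    qed
    then have "L n = L K" if "n \<ge> K" for n
      using L inc[OF that] that by (intro leading_determines[OF iJ]) (auto simp: A_def)
    then show "\<exists>N. \<forall>n\<ge>N. L n = L N" by blast
  qed
qed

corollary maximal_member:
  assumes "finite J" "J \<subseteq> I" "finite X" "F \<noteq> {}"
    and F: "\<And>L. L \<in> F \<Longrightarrow> stable J L \<and> L \<subseteq> generated J X"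
  shows "\<exists>L\<in>F. \<forall>L'\<in>F. L \<subseteq> L' \<longrightarrow> L' = L"
proof (rule ccontr)
  assume "\<not> ?thesis"
  then have "\<forall>L\<in>F. \<exists>L'\<in>F. L \<subset> L'" by blast
  then obtain f where f: "\<And>L. L \<in> F \<Longrightarrow> f L \<in> F" "\<And>L. L \<in> F \<Longrightarrow> L \<subset> f L" by metis
  obtain L0 where "L0 \<in> F" using assms(4) by blast
  define S where "S n = (f ^^ n) L0" for n
  have S: "S n \<in> F" for n by (induction n) (auto simp: S_def f \<open>L0 \<in> F\<close>)
  have S2: "S n \<subset> S (Suc n)" for n using f(2)[OF S[of n]] by (simp add: S_def)
  have "\<exists>N. \<forall>n\<ge>N. S n = S N"
    by (rule noetherianD[OF noetherian_finite[OF assms(1-3)]]) (use F[OF S] S2 in auto)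
  then show False using S2 by (metis le_SucI order_refl psubset_eq)
qed

end

section \<open>Linear dependence and polynomials in an operator\<close>

lemma vector_space_pointwise:
  fixes s :: "'f::field \<Rightarrow> 'w::ab_group_add \<Rightarrow> 'w"
  assumes "vector_space s"
  shows "vector_space (\<lambda>c (q :: 'i \<Rightarrow> 'w) i. s c (q i))"
proof -
  interpret vector_space s by (rule assms)
  show ?thesis
    by unfold_locales (auto simp: fun_eq_iff scale_right_distrib scale_left_distrib)
qed

context vector_space begin

text \<open>
  Infinitely many vectors in a space that is finite dimensional modulo \<open>K\<close> are linearly dependent modulo
  \<open>K\<close>. One generator \<open>q\<close> is removed at a time: a vector \<open>v j\<close> that involves \<open>q\<close> is used to
  eliminate \<open>q\<close> from all the others.
\<close>

lemma dependent_modulo_subspace: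
  assumes "subspace K" "finite Q" "infinite C" "\<And>i. i \<in> C \<Longrightarrow> v i \<in> span (K \<union> Q)"
  shows "\<exists>I a. finite I \<and> I \<subseteq> C \<and> (\<exists>i\<in>I. a i \<noteq> 0) \<and> (\<Sum>i\<in>I. scale (a i) (v i)) \<in> K"
  using assms(2-)
proof (induction Q arbitrary: C v)
  case empty
  then obtain i where i: "i \<in> C" using infinite_imp_nonempty by blast
  have "v i \<in> K" using empty(2)[OF i] assms(1) by (metis span_eq_iff sup_bot_right)
  with i show ?case by (intro exI[of _ "{i}"] exI[of _ "\<lambda>_. 1"]) auto
next
  case (insert q Q)
  have "\<forall>i\<in>C. \<exists>b. v i - scale b q \<in> span (K \<union> Q)"
    using insert.prems(2) span_breakdown_eq[of _ q "K \<union> Q"] by simp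
  then obtain b where b: "\<And>i. i \<in> C \<Longrightarrow> v i - scale (b i) q \<in> span (K \<union> Q)" by metis
  show ?case
  proof (cases "\<forall>i\<in>C. b i = 0")
    case True
    show ?thesis by (rule insert.IH[OF insert.prems(1)]) (use b True in force)
  next
    case False
    then obtain j where j: "j \<in> C" "b j \<noteq> 0" by blast
    define v' where "v' i = v i - scale (b i / b j) (v j)" for i
    have "v' i \<in> span (K \<union> Q)" if "i \<in> C - {j}" for i
    proof -
      have "v' i = (v i - scale (b i) q) - scale (b i / b j) (v j - scale (b j) q)"
        using j(2) by (simp add: v'_def scale_right_diff_distrib)
      also have "\<dots> \<in> span (K \<union> Q)" 
        using that b j(1) by (intro span_diff[OF b span_scale[OF b]]) auto
      finally show ?thesis .
    qed
    moreover have "infinite (C - {j})" using insert.prems(1) by simp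
    ultimately obtain I a where I: "finite I" "I \<subseteq> C - {j}" "\<exists>i\<in>I. a i \<noteq> 0"
      "(\<Sum>i\<in>I. scale (a i) (v' i)) \<in> K" using insert.IH[of "C - {j}" v'] by blast
    define a' where "a' = a(j := - (\<Sum>i\<in>I. a i * (b i / b j)))"
    have jI: "j \<notin> I" using I by auto
    have "(\<Sum>i\<in>insert j I. scale (a' i) (v i)) = scale (a' j) (v j) + (\<Sum>i\<in>I. scale (a i) (v i))"
      using I(1) jI by (auto simp: a'_def intro!: sum.cong)
    also have "\<dots> = (\<Sum>i\<in>I. scale (a i) (v' i))"
      by (simp add: v'_def a'_def scale_right_diff_distrib sum_subtractf scale_sum_left)
    finally have "(\<Sum>i\<in>insert j I. scale (a' i) (v i)) \<in> K" using I(4) by simp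
    moreover have "\<exists>i\<in>insert j I. a' i \<noteq> 0" using I(3) jI by (auto simp: a'_def)
    ultimately show ?thesis using I j by (intro exI[of _ "insert j I"] exI[of _ a']) auto
  qed
qed

lemma span_subspace_Un_finite_support:
  assumes "w \<in> span (K \<union> range (q :: nat \<Rightarrow> 'b))"
  shows "\<exists>n. w \<in> span (K \<union> q ` {..<n})"
  using assms
proof (induction rule: span_induct_alt)
  case base
  show ?case by (auto intro: span_zero)
next
  case (step c a w)
  then obtain n where n: "w \<in> span (K \<union> q ` {..<n})" by blast
  obtain m where m: "a \<in> span (K \<union> q ` {..<m})"
  proof (cases "a \<in> K")
    case True
    then show ?thesis by (intro that[of 0] span_base) auto
  next
    case False
    then obtain k where "a = q k" using step by auto
    then show ?thesis by (intro that[of "Suc k"] span_base) auto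
  qed
  have "a \<in> span (K \<union> q ` {..<max m n})" "w \<in> span (K \<union> q ` {..<max m n})"
    using m n by (auto intro: span_mono[THEN subsetD, rotated])
  then show ?case by (intro exI[of _ "max m n"] span_add span_scale)
qed

end

context commuting_operators begin

lemma stable_span:
  assumes "J \<subseteq> I" "\<And>i x. i \<in> J \<Longrightarrow> x \<in> X \<Longrightarrow> T i x \<in> span X"
  shows "stable J (span X)"
proof (rule stableI[OF subspace_span])
  fix i w assume i: "i \<in> J" "w \<in> span X"
  from i(2) show "T i w \<in> span X"
    by (induction rule: span_induct_alt)
      (use i(1) assms in \<open>auto simp: subset_eq T_0 T_add T_scale intro!: span_zero span_add span_scale\<close>)
qed

text \<open>
  The value at \<open>y\<close> of the polynomial \<open>p\<close> in the operator \<open>T i\<close>, by Horner's scheme.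
\<close>

definition op_poly :: "'i \<Rightarrow> 'f poly \<Rightarrow> 'w \<Rightarrow> 'w" where
  "op_poly i p y = fold_coeffs (\<lambda>a w. a \<cdot> y + T i w) p 0"

lemma op_poly_0 [simp]: "op_poly i 0 y = 0"
  by (simp add: op_poly_def)

lemma op_poly_pCons: "i \<in> I \<Longrightarrow> op_poly i (pCons a p) y = a \<cdot> y + T i (op_poly i p y)"
  by (cases "p = 0"; cases "a = 0") (simp_all add: op_poly_def T_0)

lemma op_poly_1: "i \<in> I \<Longrightarrow> op_poly i 1 y = y"
  unfolding one_pCons by (simp add: op_poly_pCons T_0)

lemma op_poly_linear_factor: "i \<in> I \<Longrightarrow> op_poly i [:-c, 1:] y = T i y - c \<cdot> y"
  by (simp add: op_poly_pCons T_0)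

lemma op_poly_in_stable:
  assumes "i \<in> I" "stable {i} L" "y \<in> L"
  shows "op_poly i p y \<in> L"
  using assms by (induction p)
    (auto simp: op_poly_pCons stable_def intro: subspace_0 subspace_add subspace_scale)

lemma op_poly_add: "i \<in> I \<Longrightarrow> op_poly i (p + q) y = op_poly i p y + op_poly i q y"
proof (induction p arbitrary: q)
  case (pCons a p)
  then show ?case by (cases q) (simp add: op_poly_pCons T_add scale_left_distrib)
qed simp

lemma op_poly_smult: "i \<in> I \<Longrightarrow> op_poly i (Polynomial.smult c p) y = c \<cdot> op_poly i p y"
  by (induction p) (simp_all add: op_poly_pCons T_scale scale_right_distrib)

lemma op_poly_mult: "i \<in> I \<Longrightarrow> op_poly i (p * q) y = op_poly i p (op_poly i q y)"
  by (induction p) (simp_all add: op_poly_pCons op_poly_add op_poly_smult)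

lemma op_poly_arg_add: "i \<in> I \<Longrightarrow> op_poly i p (y + z) = op_poly i p y + op_poly i p z"
  by (induction p) (simp_all add: op_poly_pCons T_add scale_right_distrib)

lemma op_poly_arg_scale: "i \<in> I \<Longrightarrow> op_poly i p (c \<cdot> y) = c \<cdot> op_poly i p y"
  by (induction p) (simp_all add: op_poly_pCons T_scale scale_right_distrib mult.commute)

lemma op_poly_arg_0: "i \<in> I \<Longrightarrow> op_poly i p 0 = 0"
  by (induction p) (simp_all add: op_poly_pCons T_0)

lemma op_poly_arg_sum:
  "i \<in> I \<Longrightarrow> op_poly i p (\<Sum>k\<in>A. y k) = (\<Sum>k\<in>A. op_poly i p (y k))"
  by (induction A rule: infinite_finite_induct) (simp_all add: op_poly_arg_add op_poly_arg_0)

lemma op_poly_sum: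
  "i \<in> I \<Longrightarrow> op_poly i (\<Sum>k\<in>A. p k) y = (\<Sum>k\<in>A. op_poly i (p k) y)"
  by (induction A rule: infinite_finite_induct) (simp_all add: op_poly_add)

lemma op_poly_monom: "i \<in> I \<Longrightarrow> op_poly i (Polynomial.monom 1 d) y = (T i ^^ d) y"
  by (induction d) (simp_all add: monom_0 monom_Suc op_poly_pCons T_0)

end

section \<open>Modules over a group of finite torsion free rank\<close>

text \<open>
  Submonoids rather than subgroups: the finite generating set that matters is closed under inverses, so that it
  generates the same set in both senses, and induction over words in \<open>B\<close> has only one kind of step.
\<close>

inductive_set gen_submonoid :: "('a, 'm) monoid_scheme \<Rightarrow> 'a set \<Rightarrow> 'a set"
  for G :: "('a, 'm) monoid_scheme" and S :: "'a set" where
  one: "\<one>\<^bsub>G\<^esub> \<in> gen_submonoid G S"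
| mult: "g \<in> gen_submonoid G S \<Longrightarrow> s \<in> S \<Longrightarrow> g \<otimes>\<^bsub>G\<^esub> s \<in> gen_submonoid G S"

lemma countable_submonoid:
  assumes "countable S"
  shows "countable (gen_submonoid G S)"
proof -
  have "gen_submonoid G S \<subseteq> (\<lambda>l. foldl (\<otimes>\<^bsub>G\<^esub>) \<one>\<^bsub>G\<^esub> l) ` lists S"
  proof
    fix g assume "g \<in> gen_submonoid G S"
    then show "g \<in> (\<lambda>l. foldl (\<otimes>\<^bsub>G\<^esub>) \<one>\<^bsub>G\<^esub> l) ` lists S"
    proof induction
      case one
      show ?case by (rule image_eqI[of _ _ "[]"]) auto
    next
      case (mult g s)
      then obtain l where "g = foldl (\<otimes>\<^bsub>G\<^esub>) \<one>\<^bsub>G\<^esub> l" "l \<in> lists S" by blast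
      with mult show ?case by (intro image_eqI[of _ _ "l @ [s]"]) auto
    qed
  qed
  then show ?thesis by (rule countable_subset) (use assms in simp)
qed

lemma gen_submonoid_nat_pow: "s \<in> S \<Longrightarrow> s [^]\<^bsub>G\<^esub> (n::nat) \<in> gen_submonoid G S"
  by (induction n) (auto intro: gen_submonoid.intros)

context comm_group begin

lemma gen_submonoid_carrier:
  assumes "S \<subseteq> carrier G" "g \<in> gen_submonoid G S"
  shows "g \<in> carrier G"
  using assms(2) by induction (use assms(1) in auto)

end

text \<open>
  A finitely generated module over the group ring of an abelian group in which every element has a
  power in one finitely generated submonoid. The operators are only required to be a semigroup action on the
  whole space; the identity acts trivially on the generators and therefore on the module \<open>W\<close>.
\<close>

locale group_module = comm_group G + vector_space scale
  for G :: "('a, 'm) monoid_scheme" (structure)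
    and scale :: "complex \<Rightarrow> 'w::ab_group_add \<Rightarrow> 'w" (infixr \<open>\<cdot>\<close> 75) +
  fixes \<tau> :: "'a \<Rightarrow> 'w \<Rightarrow> 'w" and E :: "'w set" and B :: "'a set"
  assumes \<tau>_add: "g \<in> carrier G \<Longrightarrow> \<tau> g (v + w) = \<tau> g v + \<tau> g w"
    and \<tau>_scale: "g \<in> carrier G \<Longrightarrow> \<tau> g (c \<cdot> v) = c \<cdot> \<tau> g v"
    and \<tau>_mult: "g \<in> carrier G \<Longrightarrow> h \<in> carrier G \<Longrightarrow> \<tau> (g \<otimes> h) v = \<tau> g (\<tau> h v)"
    and \<tau>_one_E: "e \<in> E \<Longrightarrow> \<tau> \<one> e = e"
    and finite_E: "finite E"
    and finite_B: "finite B" and B_carrier: "B \<subseteq> carrier G"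
    and power_in_B: "g \<in> carrier G \<Longrightarrow> \<exists>d>0. g [^] (d::nat) \<in> gen_submonoid G B"
begin

sublocale commuting_operators scale \<tau> "carrier G"
proof unfold_locales
  fix g h v assume "g \<in> carrier G" "h \<in> carrier G"
  then show "\<tau> g (\<tau> h v) = \<tau> h (\<tau> g v)" by (metis \<tau>_mult m_comm)
qed (auto simp: \<tau>_add \<tau>_scale)

abbreviation "W \<equiv> generated (carrier G) E"

lemma \<tau>_one: "w \<in> W \<Longrightarrow> \<tau> \<one> w = w"
proof -
  have "stable (carrier G) {w. \<tau> \<one> w = w}"
  proof (rule stableI)
    show "subspace {w. \<tau> \<one> w = w}" by (rule subspaceI) (auto simp: T_0 T_add T_scale)
    fix g w assume "g \<in> carrier G" "w \<in> {w. \<tau> \<one> w = w}"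
    then show "\<tau> g w \<in> {w. \<tau> \<one> w = w}" using T_comm[of \<one> g w] by simp
  qed
  then show "w \<in> W \<Longrightarrow> \<tau> \<one> w = w" using \<tau>_one_E generated_least[of "carrier G" _ E] by blast
qed

lemma \<tau>_pow: "w \<in> W \<Longrightarrow> g \<in> carrier G \<Longrightarrow> (\<tau> g ^^ d) w = \<tau> (g [^] d) w"
  by (induction d) (auto simp: \<tau>_one \<tau>_mult[symmetric] m_comm)

lemma generated_subset_W: "S \<subseteq> carrier G \<Longrightarrow> generated S E \<subseteq> W"
  by (rule generated_mono) auto

text \<open>
  Two elements with the same power differ by a torsion element. The pairs \<open>(d, g^d)\<close> with \<open>g^d\<close> in a countable
  monoid are countably many, so up to torsion the group is countable.
\<close>

lemma countable_representatives:
  obtains R where "countable R" "R \<subseteq> carrier G" "R \<noteq> {}"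
    "\<And>g. g \<in> carrier G \<Longrightarrow> \<exists>h\<in>R. \<exists>d>0. g [^] (d::nat) = h [^] d"
proof -
  obtain d :: "'a \<Rightarrow> nat" where d: "\<And>g. g \<in> carrier G \<Longrightarrow> d g > 0 \<and> g [^] d g \<in> gen_submonoid G B"
    using power_in_B by metis
  define key where "key g = (d g, g [^] d g)" for g
  define R where "R = inv_into (carrier G) key ` key ` carrier G"
  have "key ` carrier G \<subseteq> UNIV \<times> gen_submonoid G B" using d by (auto simp: key_def)
  then have "countable (key ` carrier G)"
    by (rule countable_subset) (auto intro: countable_submonoid countable_finite finite_B)
  then have "countable R" by (simp add: R_def)
  moreover have "R \<subseteq> carrier G" by (auto simp: R_def inv_into_into)
  moreover have "R \<noteq> {}" by (auto simp: R_def)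
  moreover have "\<exists>h\<in>R. \<exists>d>0. g [^] (d::nat) = h [^] d" if g: "g \<in> carrier G" for g
  proof -
    define h where "h = inv_into (carrier G) key (key g)"
    have "h \<in> R" using g by (auto simp: R_def h_def)
    moreover have "key h = key g" using g by (simp add: h_def f_inv_into_f)
    ultimately show ?thesis using d[OF g]
      by (intro bexI[of _ h] exI[of _ "d g"]) (auto simp: key_def)
  qed
  ultimately show ?thesis using that by blast
qed

end

text \<open>
  In \<open>W / K\<close> every nonzero submodule contains the class of \<open>x\<close>. The aim is to show that this quotient is
  finite dimensional.
\<close>

locale critical_submodule = group_module G scale \<tau> E B
  for G :: "('a, 'm) monoid_scheme" (structure)
    and scale :: "complex \<Rightarrow> 'w::ab_group_add \<Rightarrow> 'w" (infixr \<open>\<cdot>\<close> 75)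
    and \<tau> E B +
  fixes K :: "'w set" and x :: 'w
  assumes stable_K: "stable (carrier G) K" and K_W: "K \<subseteq> W" and x_W: "x \<in> W" and x_K: "x \<notin> K"
    and maximal: "stable (carrier G) L \<Longrightarrow> K \<subseteq> L \<Longrightarrow> L \<subseteq> W \<Longrightarrow> x \<notin> L \<Longrightarrow> L = K"
begin

lemmas sK = stable_subspace[OF stable_K]
lemmas sW = subspace_generated[of "carrier G" E]

lemma x_in_sum:
  assumes "stable (carrier G) L" "L \<subseteq> W" "\<not> L \<subseteq> K"
  shows "\<exists>k\<in>K. \<exists>r\<in>L. x = k + r"
proof (rule ccontr)
  assume no: "\<not> ?thesis"
  let ?L = "{k + r | k r. k \<in> K \<and> r \<in> L}"
  have "?L = K"
  proof (rule maximal)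
    show "stable (carrier G) ?L" by (rule stable_sums[OF _ stable_K assms(1)]) simp
    show "K \<subseteq> ?L" using subspace_0[OF stable_subspace[OF assms(1)]] by force
    show "?L \<subseteq> W" using K_W assms(2) by (auto intro: subspace_add[OF sW])
  qed (use no in blast)
  moreover have "L \<subseteq> ?L" using subspace_0[OF sK] by force
  ultimately show False using assms(3) by simp
qed

text \<open>
  In commutative algebra: the annihilator of the simple submodule is a maximal ideal, and an element outside of
  it acts injectively on \<open>W / K\<close>, because its kernel is a submodule that does not contain \<open>x\<close>.
\<close>

lemma nonzero_on_quotient:
  assumes g: "g \<in> carrier G" and y: "y \<in> W" "y \<notin> K" and "\<tau> g x - c \<cdot> x \<notin> K"
  shows "\<tau> g y - c \<cdot> y \<notin> K"
proof
  assume yK: "\<tau> g y - c \<cdot> y \<in> K"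
  let ?N = "{w. \<tau> g w - c \<cdot> w \<in> K}"
  have N: "stable (carrier G) ?N"
  proof (rule stableI)
    show "subspace ?N"
    proof (rule subspaceI)
      fix v w assume "v \<in> ?N" "w \<in> ?N"
      then have "(\<tau> g v - c \<cdot> v) + (\<tau> g w - c \<cdot> w) \<in> K" by (auto intro: subspace_add[OF sK])
      then show "v + w \<in> ?N" using g by (simp add: T_add scale_right_distrib algebra_simps)
    next
      fix a w assume "w \<in> ?N"
      then have "a \<cdot> (\<tau> g w - c \<cdot> w) \<in> K" by (auto intro: subspace_scale[OF sK])
      then show "a \<cdot> w \<in> ?N" using g by (simp add: T_scale scale_right_diff_distrib mult.commute)
    qed (use g sK in \<open>simp add: T_0 subspace_0\<close>)
    fix h w assume h: "h \<in> carrier G" and "w \<in> ?N"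
    then have "\<tau> h (\<tau> g w - c \<cdot> w) \<in> K" using stable_T[OF stable_K] by auto
    then show "\<tau> h w \<in> ?N" using g h by (simp add: T_diff T_scale T_comm[of h g])
  qed
  have "generated (carrier G) {y} \<subseteq> W" by (rule generated_least[OF stable_generated]) (use y in auto)
  moreover have "\<not> generated (carrier G) {y} \<subseteq> K" using y(2) generated_base by blast
  ultimately obtain k r where x: "k \<in> K" "r \<in> generated (carrier G) {y}" "x = k + r"
    using x_in_sum[OF stable_generated] by blast
  have "r \<in> ?N" using x(2) generated_least[OF N, of "{y}"] yK by blast
  moreover have "k \<in> ?N"
    using stable_T[OF stable_K g x(1)] x(1) subspace_diff[OF sK] subspace_scale[OF sK] by blast
  ultimately have "x \<in> ?N" using subspace_add[OF stable_subspace[OF N]] x(3) by blast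
  then show False using assms(4) by blast
qed

text \<open>
  Factor \<open>p\<close> into linear factors. If none of them annihilated \<open>x\<close> modulo \<open>K\<close>, then all of them would act injectively
  on \<open>W / K\<close>, and so would \<open>p\<close>.
\<close>

lemma eigenvalue_from_polynomial:
  assumes "g \<in> carrier G" "p \<noteq> 0" "y \<in> W" "y \<notin> K" "op_poly g p y \<in> K"
  shows "\<exists>c. \<tau> g x - c \<cdot> x \<in> K"
  using assms(2-)
proof (induction "Polynomial.degree p" arbitrary: p)
  case 0
  then obtain c where c: "p = [:c:]" "c \<noteq> 0" by (metis degree_eq_zeroE pCons_0_0)
  then have "c \<cdot> y \<in> K" using 0 assms(1) by (simp add: op_poly_pCons T_0)
  then have "inverse c \<cdot> (c \<cdot> y) \<in> K" by (rule subspace_scale[OF sK])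
  then show ?case using c 0 by simp
next
  case (Suc n)
  then have "\<not> constant (poly p)" by (simp add: constant_degree)
  then obtain z where "poly p z = 0" using fundamental_theorem_of_algebra by blast
  then obtain q where q: "p = [:- z, 1:] * q" by (metis dvdE poly_eq_0_iff_dvd)
  then have "q \<noteq> 0" using Suc by auto
  have "Polynomial.degree p = Suc (Polynomial.degree q)" unfolding q using \<open>q \<noteq> 0\<close> by (subst degree_mult_eq) auto
  then have n: "n = Polynomial.degree q" using Suc by simp
  show ?case
  proof (cases "op_poly g q y \<in> K")
    case True
    then show ?thesis using Suc n \<open>q \<noteq> 0\<close> by blast
  next
    case False
    have "op_poly g q y \<in> W"
      using assms(1) Suc.prems by (intro op_poly_in_stable stable_mono[OF stable_generated]) auto
    moreover have "\<tau> g (op_poly g q y) - z \<cdot> op_poly g q y \<in> K"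
      using Suc.prems q assms(1) by (metis op_poly_linear_factor op_poly_mult)
    ultimately show ?thesis using nonzero_on_quotient[OF assms(1) _ False] by blast
  qed
qed

text \<open>
  The quotient of \<open>g\<close> and \<open>h\<close> is a root of the polynomial \<open>X^d - 1\<close>, so it acts on \<open>x\<close> by a root of unity.
\<close>

lemma equal_powers_proportional:
  assumes "g \<in> carrier G" "h \<in> carrier G" "d > 0" "g [^] (d::nat) = h [^] d"
  shows "\<exists>c. \<tau> g x - c \<cdot> \<tau> h x \<in> K"
proof -
  define t where "t = g \<otimes> inv h"
  have t: "t \<in> carrier G" using assms by (simp add: t_def)
  have "t [^] d = \<one>" using assms by (simp add: t_def nat_pow_distrib nat_pow_inv)
  then have "op_poly t (Polynomial.monom 1 d) x = x"
    using t x_W by (simp add: op_poly_monom \<tau>_pow \<tau>_one)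
  moreover have "op_poly t (Polynomial.monom 1 d + Polynomial.smult (-1) 1) x = op_poly t (Polynomial.monom 1 d) x + (-1) \<cdot> x"
    using t by (simp only: op_poly_add op_poly_smult op_poly_1)
  ultimately have "op_poly t (Polynomial.monom 1 d + Polynomial.smult (-1) 1) x \<in> K"
    using subspace_0[OF sK] by simp
  moreover have "Polynomial.monom 1 d + Polynomial.smult (-1) 1 \<noteq> (0::complex poly)"
  proof
    assume "Polynomial.monom 1 d + Polynomial.smult (-1) 1 = (0::complex poly)"
    then have "poly (Polynomial.monom 1 d + Polynomial.smult (-1) 1) 0 = (0::complex)" by simp
    then show False using assms by (simp add: poly_monom zero_power)
  qed
  ultimately obtain c where "\<tau> t x - c \<cdot> x \<in> K"
    using eigenvalue_from_polynomial[OF t _ x_W x_K] by blast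
  then have "\<tau> h (\<tau> t x - c \<cdot> x) \<in> K" using stable_T[OF stable_K assms(2)] by blast
  moreover have "h \<otimes> t = g" using assms by (simp add: t_def m_lcomm)
  ultimately have "\<tau> g x - c \<cdot> \<tau> h x \<in> K"
    using assms t by (metis T_diff T_scale \<tau>_mult)
  then show ?thesis by blast
qed

lemma countably_spanned:
  obtains q :: "nat \<Rightarrow> 'w" where "generated (carrier G) {x} \<subseteq> span (K \<union> range q)"
proof -
  obtain R where R: "countable R" "R \<subseteq> carrier G" "R \<noteq> {}"
    "\<And>g. g \<in> carrier G \<Longrightarrow> \<exists>h\<in>R. \<exists>d>0. g [^] (d::nat) = h [^] d"
    using countable_representatives by metis
  define q where "q n = \<tau> (from_nat_into R n) x" for n
  have "range q = (\<lambda>h. \<tau> h x) ` range (from_nat_into R)" by (auto simp: q_def)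
  then have q: "range q = (\<lambda>h. \<tau> h x) ` R" using R by (simp add: range_from_nat_into)
  have gx: "\<tau> g x \<in> span (K \<union> range q)" if g: "g \<in> carrier G" for g
  proof -
    obtain h c where "h \<in> R" "\<tau> g x - c \<cdot> \<tau> h x \<in> K"
      using R(4)[OF g] equal_powers_proportional[OF g] R(2) by blast
    then have "(\<tau> g x - c \<cdot> \<tau> h x) + c \<cdot> \<tau> h x \<in> span (K \<union> range q)"
      unfolding q by (intro span_add span_scale) (auto intro: span_base)
    then show ?thesis by simp
  qed
  have "stable (carrier G) (span (K \<union> range q))"
  proof (rule stable_span)
    fix g w assume g: "g \<in> carrier G" and "w \<in> K \<union> range q"
    then consider "w \<in> K" | h where "h \<in> R" "w = \<tau> h x" using q by blast
    then show "\<tau> g w \<in> span (K \<union> range q)"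
    proof cases
      case 1
      then show ?thesis using stable_T[OF stable_K g] by (auto intro: span_base)
    next
      case 2
      then have "\<tau> g w = \<tau> (g \<otimes> h) x" using g R(2) by (auto simp: \<tau>_mult)
      then show ?thesis using gx g 2 R(2) by auto
    qed
  qed simp
  moreover have "x \<in> span (K \<union> range q)" using gx[of \<one>] x_W by (simp add: \<tau>_one)
  ultimately have "generated (carrier G) {x} \<subseteq> span (K \<union> range q)" by (intro generated_least) auto
  then show ?thesis by (rule that)
qed

text \<open>
  Nullstellensatz by counting. If \<open>g - c\<close> were invertible on the simple module for every complex number
  \<open>c\<close>, the uncountably many inverses applied to \<open>x\<close> would lie in a space of countable dimension. A linear
  relation among them, multiplied by the denominators, is a nonzero polynomial in \<open>g\<close> that annihilates
  \<open>x\<close> modulo \<open>K\<close>.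
\<close>

lemma eigenvalue_exists:
  assumes g: "g \<in> carrier G"
  shows "\<exists>c. \<tau> g x - c \<cdot> x \<in> K"
proof (rule ccontr)
  assume no: "\<not> ?thesis"
  have orbx: "generated (carrier G) {x} \<subseteq> W" by (rule generated_least[OF stable_generated]) (use x_W in auto)
  have "\<exists>v\<in>generated (carrier G) {x}. x - (\<tau> g v - c \<cdot> v) \<in> K" for c
  proof -
    let ?y = "\<tau> g x - c \<cdot> x" and ?L = "{\<tau> g v - c \<cdot> v | v. v \<in> generated (carrier G) {x}}"
    have xo: "x \<in> generated (carrier G) {x}" by (auto intro: generated_base)
    have L: "stable (carrier G) ?L"
    proof (rule stableI)
      show "subspace ?L"
      proof (rule subspaceI)
        have "0 = \<tau> g 0 - c \<cdot> 0" using g by (simp add: T_0)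
        then show "0 \<in> ?L" using subspace_0[OF subspace_generated] by blast
      next
        fix a b assume "a \<in> ?L" "b \<in> ?L"
        then obtain v w where v: "a = \<tau> g v - c \<cdot> v" "b = \<tau> g w - c \<cdot> w"
          "v \<in> generated (carrier G) {x}" "w \<in> generated (carrier G) {x}" by blast
        then have "a + b = \<tau> g (v + w) - c \<cdot> (v + w)"
          using g by (simp add: T_add scale_right_distrib)
        then show "a + b \<in> ?L" using subspace_add[OF subspace_generated v(3,4)] by blast
      next
        fix a r assume "a \<in> ?L"
        then obtain v where v: "a = \<tau> g v - c \<cdot> v" "v \<in> generated (carrier G) {x}" by blast
        then have "r \<cdot> a = \<tau> g (r \<cdot> v) - c \<cdot> (r \<cdot> v)"
          using g by (simp add: T_scale scale_right_diff_distrib mult.commute)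
        then show "r \<cdot> a \<in> ?L" using subspace_scale[OF subspace_generated v(2)] by blast
      qed
    next
      fix h a assume h: "h \<in> carrier G" and "a \<in> ?L"
      then obtain v where v: "a = \<tau> g v - c \<cdot> v" "v \<in> generated (carrier G) {x}" by blast
      then have "\<tau> h a = \<tau> g (\<tau> h v) - c \<cdot> \<tau> h v"
        using g h by (simp add: T_diff T_scale T_comm[of h g])
      then show "\<tau> h a \<in> ?L" using stable_T[OF stable_generated h v(2)] by blast
    qed
    have "?L \<subseteq> generated (carrier G) {x}"
    proof
      fix a assume "a \<in> ?L"
      then obtain v where "a = \<tau> g v - c \<cdot> v" "v \<in> generated (carrier G) {x}"
        by (elim CollectE exE conjE)
      then show "a \<in> generated (carrier G) {x}"
        using stable_T[OF stable_generated g] subspace_diff[OF subspace_generated] subspace_scale[OF subspace_generated]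
        by metis
    qed
    then have LW: "?L \<subseteq> W" using orbx by (rule order_trans)
    have "?y \<in> ?L" using xo by (intro CollectI exI[of _ x] conjI refl)
    have "\<not> ?L \<subseteq> K"
    proof
      assume "?L \<subseteq> K"
      from subsetD[OF this \<open>?y \<in> ?L\<close>] show False using no by blast
    qed
    then have "\<exists>k\<in>K. \<exists>r\<in>?L. x = k + r" by (rule x_in_sum[OF L LW])
    then obtain k r where kr: "k \<in> K" "r \<in> ?L" "x = k + r" by (elim bexE)
    then obtain v where v: "r = \<tau> g v - c \<cdot> v" "v \<in> generated (carrier G) {x}"
      by (elim CollectE exE conjE)
    have "x - (\<tau> g v - c \<cdot> v) \<in> K" using kr(1,3) v(1) by simp
    then show ?thesis using v(2) by (rule bexI)
  qed
  then obtain v where v: "\<And>c. v c \<in> generated (carrier G) {x}" "\<And>c. x - (\<tau> g (v c) - c \<cdot> v c) \<in> K"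
    by metis
  obtain q :: "nat \<Rightarrow> 'w" where q: "generated (carrier G) {x} \<subseteq> span (K \<union> range q)"
    by (rule countably_spanned)
  have "\<forall>c. \<exists>n. v c \<in> span (K \<union> q ` {..<n})"
    using v(1) q span_subspace_Un_finite_support by blast
  then obtain n where n: "\<And>c. v c \<in> span (K \<union> q ` {..<n c})" by metis
  have "\<exists>k. infinite {c. n c = k}"
  proof (rule ccontr)
    assume "\<not> ?thesis"
    then have "countable (\<Union>k. {c. n c = k})" by (intro countable_UN) (auto intro: countable_finite)
    moreover have "(\<Union>k. {c. n c = k}) = (UNIV :: complex set)" by auto
    ultimately show False using uncountable_UNIV_complex by simp
  qed
  then obtain k where "infinite {c. n c = k}" by blast
  from dependent_modulo_subspace[OF sK _ this, of "q ` {..<k}" v]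
  obtain I a where I: "finite I" "\<exists>i\<in>I. a i \<noteq> 0" "(\<Sum>i\<in>I. a i \<cdot> v i) \<in> K"
    using n by auto
  \<comment> \<open>Multiplying the relation by \<open>P I\<close> turns each \<open>v c\<close> into \<open>P (I - {c})\<close> applied to \<open>x\<close>.\<close>
  define P where "P J = (\<Prod>c\<in>J. [:-c, 1:])" for J :: "complex set"
  define p where "p = (\<Sum>c\<in>I. Polynomial.smult (a c) (P (I - {c})))"
  have poly_in_K: "w \<in> K \<Longrightarrow> op_poly g r w \<in> K" for r w
    by (rule op_poly_in_stable[OF g stable_mono[OF stable_K]]) (use g in auto)
  have "op_poly g (P I) (v c) - op_poly g (P (I - {c})) x \<in> K" if c: "c \<in> I" for c
  proof -
    have "P I = P (I - {c}) * [:-c, 1:]"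
      unfolding P_def using I(1) c by (subst prod.remove[of I c]) auto
    then have "op_poly g (P I) (v c) = op_poly g (P (I - {c})) (\<tau> g (v c) - c \<cdot> v c)"
      using g by (simp only: op_poly_mult op_poly_linear_factor)
    moreover have "op_poly g (P (I - {c})) x = op_poly g (P (I - {c})) (\<tau> g (v c) - c \<cdot> v c)
        + op_poly g (P (I - {c})) (x - (\<tau> g (v c) - c \<cdot> v c))"
      by (subst op_poly_arg_add[OF g, symmetric]) simp
    ultimately have "op_poly g (P I) (v c) - op_poly g (P (I - {c})) x
        = - op_poly g (P (I - {c})) (x - (\<tau> g (v c) - c \<cdot> v c))" by simp
    then show ?thesis using poly_in_K[OF v(2)] subspace_neg[OF sK] by presburger
  qed
  then have "(\<Sum>c\<in>I. a c \<cdot> (op_poly g (P I) (v c) - op_poly g (P (I - {c})) x)) \<in> K"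
    by (intro subspace_sum[OF sK] subspace_scale[OF sK])
  moreover have "op_poly g (P I) (\<Sum>i\<in>I. a i \<cdot> v i) \<in> K" by (rule poly_in_K[OF I(3)])
  moreover have "op_poly g p x = op_poly g (P I) (\<Sum>i\<in>I. a i \<cdot> v i)
      - (\<Sum>c\<in>I. a c \<cdot> (op_poly g (P I) (v c) - op_poly g (P (I - {c})) x))"
    using g by (simp add: p_def op_poly_sum op_poly_smult op_poly_arg_sum op_poly_arg_scale
        scale_right_diff_distrib sum_subtractf)
  ultimately have "op_poly g p x \<in> K" using subspace_diff[OF sK] by presburger
  moreover have "p \<noteq> 0"
  proof -
    obtain c where c: "c \<in> I" "a c \<noteq> 0" using I by blast
    \<comment> \<open>At \<open>c\<close> only the summand with index \<open>c\<close> survives.\<close>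
    have "poly p c = (\<Sum>i\<in>I. a i * (\<Prod>j\<in>I - {i}. c - j))"
      by (simp add: p_def P_def poly_sum poly_prod)
    also have "\<dots> = a c * (\<Prod>j\<in>I - {c}. c - j) + (\<Sum>i\<in>I - {c}. a i * (\<Prod>j\<in>I - {i}. c - j))"
      by (rule sum.remove[OF I(1) c(1)])
    also have "(\<Sum>i\<in>I - {c}. a i * (\<Prod>j\<in>I - {i}. c - j)) = 0"
      using I(1) c(1) by (intro sum.neutral ballI) (auto simp: prod_zero_iff)
    finally show ?thesis using I(1) c by (auto simp: prod_zero_iff)
  qed
  ultimately show False using eigenvalue_from_polynomial[OF g _ x_W x_K] no by blast
qed

section \<open>The augmentation filtration\<close>

text \<open>
  The scalar by which \<open>g\<close> acts on the simple submodule; it is a homomorphism into the multiplicative group of \<open>\<complex>\<close>.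
\<close>

definition m :: "'a \<Rightarrow> complex" where
  "m g = (SOME c. \<tau> g x - c \<cdot> x \<in> K)"

lemma m_eigenvalue: "g \<in> carrier G \<Longrightarrow> \<tau> g x - m g \<cdot> x \<in> K"
  unfolding m_def by (rule someI_ex[OF eigenvalue_exists])

lemma m_unique:
  assumes "g \<in> carrier G" "\<tau> g x - c \<cdot> x \<in> K"
  shows "m g = c"
proof (rule ccontr)
  assume ne: "m g \<noteq> c"
  have "(\<tau> g x - c \<cdot> x) - (\<tau> g x - m g \<cdot> x) \<in> K"
    by (rule subspace_diff[OF sK assms(2) m_eigenvalue[OF assms(1)]])
  then have "inverse (m g - c) \<cdot> ((m g - c) \<cdot> x) \<in> K"
    by (subst scale_left_diff_distrib) (rule subspace_scale[OF sK], simp)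
  then have "(inverse (m g - c) * (m g - c)) \<cdot> x \<in> K" by (simp only: scale_scale)
  then show False using ne x_K by simp
qed

lemma m_one: "m \<one> = 1"
  by (rule m_unique) (use x_W subspace_0[OF sK] in \<open>auto simp: \<tau>_one\<close>)

lemma m_mult:
  assumes "g \<in> carrier G" "h \<in> carrier G"
  shows "m (g \<otimes> h) = m g * m h"
proof (rule m_unique)
  have "\<tau> g (\<tau> h x - m h \<cdot> x) + m h \<cdot> (\<tau> g x - m g \<cdot> x) \<in> K"
    using assms by (intro subspace_add[OF sK] subspace_scale[OF sK] stable_T[OF stable_K] m_eigenvalue)
  then show "\<tau> (g \<otimes> h) x - (m g * m h) \<cdot> x \<in> K"
    using assms by (simp add: \<tau>_mult T_diff T_scale scale_right_diff_distrib mult.commute)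
qed (use assms in auto)

lemma m_nonzero: "g \<in> carrier G \<Longrightarrow> m g \<noteq> 0"
  using m_mult[of g "inv g"] m_one by auto

lemma m_pow: "g \<in> carrier G \<Longrightarrow> m (g [^] (d::nat)) = m g ^ d"
  by (induction d) (auto simp: m_one m_mult)

definition t :: "'a \<Rightarrow> 'w \<Rightarrow> 'w" where
  "t g w = \<tau> g w - m g \<cdot> w"

sublocale shifted: commuting_operators scale t "carrier G"
proof unfold_locales
  fix g h v w c assume g: "g \<in> carrier G"
  show "t g (v + w) = t g v + t g w" using g by (simp add: t_def T_add scale_right_distrib)
  show "t g (c \<cdot> v) = c \<cdot> t g v"
    using g by (simp add: t_def T_scale scale_right_diff_distrib mult.commute)
  assume h: "h \<in> carrier G"
  have "t g (t h v) = \<tau> g (\<tau> h v) - m h \<cdot> \<tau> g v - (m g \<cdot> \<tau> h v - (m g * m h) \<cdot> v)"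
    using g h by (simp add: t_def T_diff T_scale scale_right_diff_distrib)
  moreover have "t h (t g v) = \<tau> h (\<tau> g v) - m g \<cdot> \<tau> h v - (m h \<cdot> \<tau> g v - (m h * m g) \<cdot> v)"
    using g h by (simp add: t_def T_diff T_scale scale_right_diff_distrib)
  ultimately show "t g (t h v) = t h (t g v)"
    using T_comm[OF g h] by (simp add: mult.commute)
qed

lemma \<tau>_t_comm: "g \<in> carrier G \<Longrightarrow> h \<in> carrier G \<Longrightarrow> \<tau> h (t g w) = t g (\<tau> h w)"
  by (simp add: t_def T_diff T_scale T_comm)

lemma stable_t: "stable J L \<Longrightarrow> g \<in> J \<Longrightarrow> w \<in> L \<Longrightarrow> t g w \<in> L"
  by (auto simp: t_def stable_def intro: subspace_diff subspace_scale)

lemma t_x: "g \<in> carrier G \<Longrightarrow> t g x \<in> K"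
  by (simp add: t_def m_eigenvalue)

lemma t_one: "w \<in> W \<Longrightarrow> t \<one> w = 0"
  by (simp add: t_def \<tau>_one m_one)

lemma t_mult:
  assumes "g \<in> carrier G" "h \<in> carrier G"
  shows "t (g \<otimes> h) w = \<tau> h (t g w) + m g \<cdot> t h w"
proof -
  have "\<tau> (g \<otimes> h) w = \<tau> h (\<tau> g w)" using assms by (metis \<tau>_mult m_comm)
  then show ?thesis
    using assms by (simp add: t_def m_mult T_diff T_scale scale_right_diff_distrib)
qed

text \<open>
  \<open>filt S N\<close> is \<open>I^N W_S\<close>, where \<open>W_S\<close> is the module generated by \<open>E\<close> over the monoid ring of
  \<open>S\<close>, and \<open>I\<close> is the kernel of \<open>m\<close> on this ring, which is generated by the elements \<open>t s\<close>.
\<close>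

primrec filt :: "'a set \<Rightarrow> nat \<Rightarrow> 'w set" where
  "filt S 0 = generated S E"
| "filt S (Suc N) = span {t s w | s w. s \<in> S \<and> w \<in> filt S N}"

declare filt.simps(2) [simp del]

lemma t_filt: "s \<in> S \<Longrightarrow> w \<in> filt S N \<Longrightarrow> t s w \<in> filt S (Suc N)"
  by (auto simp: filt.simps(2) intro: span_base)

lemma stable_filt: "S \<subseteq> carrier G \<Longrightarrow> stable S (filt S N)"
proof (induction N)
  case 0
  show ?case by (simp add: stable_generated)
next
  case (Suc N)
  show ?case unfolding filt.simps
  proof (rule stable_span)
    fix g w assume g: "g \<in> S" and "w \<in> {t s w | s w. s \<in> S \<and> w \<in> filt S N}"
    then obtain s v where v: "w = t s v" "s \<in> S" "v \<in> filt S N" by blast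
    then have "\<tau> g w = t s (\<tau> g v)" using g Suc.prems by (auto simp: \<tau>_t_comm subset_eq)
    then show "\<tau> g w \<in> span {t s w | s w. s \<in> S \<and> w \<in> filt S N}"
      using v stable_T[OF Suc.IH[OF Suc.prems] g v(3)] by (auto intro: span_base)
  qed (use Suc.prems in auto)
qed

lemma subspace_filt: "S \<subseteq> carrier G \<Longrightarrow> subspace (filt S N)"
  using stable_filt stable_subspace by blast

lemma filt_Suc:
  assumes "S \<subseteq> carrier G"
  shows "filt S (Suc N) \<subseteq> filt S N"
proof -
  have "{t s w | s w. s \<in> S \<and> w \<in> filt S N} \<subseteq> filt S N"
    using stable_t[OF stable_filt[OF assms]] by blast
  then show ?thesis
    unfolding filt.simps(2) by (rule span_minimal[OF _ subspace_filt[OF assms]])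
qed

lemma filt_subset_generated:
  assumes "S \<subseteq> carrier G"
  shows "filt S N \<subseteq> generated S E"
proof (induction N)
  case (Suc N)
  with filt_Suc[OF assms, of N] show ?case by (rule order_trans)
qed simp

lemma filt_subset_W: "S \<subseteq> carrier G \<Longrightarrow> filt S N \<subseteq> W"
  using filt_subset_generated generated_subset_W by blast

lemma filt_mono: "S \<subseteq> S' \<Longrightarrow> filt S N \<subseteq> filt S' N"
proof (induction N)
  case (Suc N)
  then show ?case unfolding filt.simps by (intro span_mono) blast
qed (auto simp: generated_mono)

lemma t_submonoid_filt:
  assumes S: "S \<subseteq> carrier G" and "g \<in> gen_submonoid G S" "w \<in> filt S N"
  shows "t g w \<in> filt S (Suc N)"
  using assms(2,3)
proof (induction)
  case one
  then have "w \<in> W" using filt_subset_W[OF S] by blast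
  then show ?case using subspace_0[OF subspace_filt[OF S]] by (simp only: t_one)
next
  case (mult g s)
  then have "g \<in> carrier G" "s \<in> carrier G" using gen_submonoid_carrier[OF S] S by auto
  then have "t (g \<otimes> s) w = \<tau> s (t g w) + m g \<cdot> t s w" by (rule t_mult)
  also have "\<dots> \<in> filt S (Suc N)"
    by (rule subspace_add[OF subspace_filt[OF S]
          stable_T[OF stable_filt[OF S] mult(2) mult.IH[OF mult.prems]]
          subspace_scale[OF subspace_filt[OF S] t_filt[OF mult(2) mult.prems]]])
  finally show ?case .
qed

text \<open>
  The forms of degree \<open>N\<close> in the finitely many operators \<open>t b\<close>, applied to the generators. They
  represent the \<open>N\<close>-th layer of the filtration for every \<open>S\<close> that contains \<open>B\<close>.
\<close>

primrec homog :: "nat \<Rightarrow> 'w set" where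
  "homog 0 = span E"
| "homog (Suc N) = span {t b w | b w. b \<in> B \<and> w \<in> homog N}"

declare homog.simps(2) [simp del]

lemma subspace_homog: "subspace (homog N)"
  by (cases N) (simp_all add: homog.simps(2))

lemma t_homog: "b \<in> B \<Longrightarrow> w \<in> homog N \<Longrightarrow> t b w \<in> homog (Suc N)"
  by (auto simp: homog.simps(2) intro: span_base)

lemma homog_subset_filt: "B \<subseteq> S \<Longrightarrow> S \<subseteq> carrier G \<Longrightarrow> homog N \<subseteq> filt S N"
proof (induction N)
  case 0
  have "E \<subseteq> generated S E" using generated_base by blast
  then show ?case by (simp add: span_generated)
next
  case (Suc N)
  then show ?case unfolding homog.simps filt.simps by (intro span_mono) blast
qed

definition homog_mod :: "'a set \<Rightarrow> nat \<Rightarrow> 'w set" where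
  "homog_mod S N = {u + v | u v. u \<in> homog N \<and> v \<in> filt S (Suc N)}"

lemma subspace_homog_mod: "S \<subseteq> carrier G \<Longrightarrow> subspace (homog_mod S N)"
  unfolding homog_mod_def by (intro subspace_sums subspace_homog subspace_filt)

lemma homog_in_mod: "S \<subseteq> carrier G \<Longrightarrow> u \<in> homog N \<Longrightarrow> u \<in> homog_mod S N"
  unfolding homog_mod_def using subspace_0[OF subspace_filt, of S "Suc N"]
  by (intro CollectI exI[of _ u] exI[of _ 0]) simp

lemma filt_in_mod: "v \<in> filt S (Suc N) \<Longrightarrow> v \<in> homog_mod S N"
  unfolding homog_mod_def using subspace_0[OF subspace_homog, of N]
  by (intro CollectI exI[of _ 0] exI[of _ v]) simp

lemma stable_homog_mod:
  assumes S: "B \<subseteq> S" "S \<subseteq> carrier G"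
  shows "stable S (homog_mod S N)"
proof (rule stableI[OF subspace_homog_mod[OF S(2)]])
  fix g w assume g: "g \<in> S" and "w \<in> homog_mod S N"
  then obtain u v where w: "w = u + v" "u \<in> homog N" "v \<in> filt S (Suc N)"
    by (auto simp: homog_mod_def)
  have "\<tau> g w = m g \<cdot> u + (t g u + \<tau> g v)"
    using g S w by (auto simp: t_def T_add subset_eq)
  moreover have "m g \<cdot> u \<in> homog N" using w by (intro subspace_scale[OF subspace_homog])
  moreover have "t g u + \<tau> g v \<in> filt S (Suc N)"
    by (rule subspace_add[OF subspace_filt[OF S(2)]
          t_filt[OF g subsetD[OF homog_subset_filt[OF S] w(2)]]
          stable_T[OF stable_filt[OF S(2)] g w(3)]])
  ultimately show "\<tau> g w \<in> homog_mod S N" unfolding homog_mod_def by blast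
qed

lemma t_submonoid_homog:
  assumes S: "B \<subseteq> S" "S \<subseteq> carrier G" and "g \<in> gen_submonoid G B" "w \<in> homog N"
  shows "t g w \<in> homog_mod S (Suc N)"
  using assms(3,4)
proof (induction)
  case one
  then have "w \<in> W" using homog_subset_filt[OF S] filt_subset_W[OF S(2)] by blast
  then show ?case using subspace_0[OF subspace_homog_mod[OF S(2)]] by (simp only: t_one)
next
  case (mult g b)
  then have "g \<in> carrier G" "b \<in> carrier G" using gen_submonoid_carrier[OF B_carrier] B_carrier by auto
  then have "t (g \<otimes> b) w = \<tau> b (t g w) + m g \<cdot> t b w" by (rule t_mult)
  also have "\<dots> \<in> homog_mod S (Suc N)"
    by (rule subspace_add[OF subspace_homog_mod[OF S(2)]
          stable_T[OF stable_homog_mod[OF S] subsetD[OF S(1) mult(2)] mult.IH[OF mult.prems]]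
          subspace_scale[OF subspace_homog_mod[OF S(2)]
            homog_in_mod[OF S(2) t_homog[OF mult(2) mult.prems]]]])
  finally show ?case .
qed

text \<open>
  The identity \<open>s^d - a^d = d * a^(d-1) * (s - a)\<close> modulo \<open>(s - a)^2\<close>, with \<open>a = m s\<close>.
\<close>

lemma t_power:
  assumes S: "S \<subseteq> carrier G" and s: "s \<in> S" and w: "w \<in> filt S N"
  shows "t (s [^] (d::nat)) w - (of_nat d * m s ^ (d - 1)) \<cdot> t s w \<in> filt S (Suc (Suc N))"
proof (induction d)
  case 0
  have "w \<in> W" using w filt_subset_W[OF S] by blast
  then show ?case using subspace_0[OF subspace_filt[OF S]] by (simp add: t_one)
next
  case (Suc d)
  let ?F = "filt S (Suc (Suc N))"
  define a where "a = of_nat d * m s ^ (d - 1)"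
  note sF = subspace_filt[OF S, of "Suc (Suc N)"]
  have c: "s \<in> carrier G" using s S by auto
  have "t (s [^] d) w \<in> filt S (Suc N)" by (rule t_submonoid_filt[OF S gen_submonoid_nat_pow[OF s] w])
  then have "t s (t (s [^] d) w) \<in> ?F" by (rule t_filt[OF s])
  moreover have "m s \<cdot> (t (s [^] d) w - a \<cdot> t s w) \<in> ?F"
    by (rule subspace_scale[OF sF Suc.IH[folded a_def]])
  ultimately have F: "t s (t (s [^] d) w) + m s \<cdot> (t (s [^] d) w - a \<cdot> t s w) \<in> ?F"
    by (rule subspace_add[OF sF])
  have a': "of_nat (Suc d) * m s ^ (Suc d - 1) = m s * a + m s ^ d"
    by (cases d) (simp_all add: a_def algebra_simps)
  have "t (s [^] Suc d) w = t s (t (s [^] d) w) + m s \<cdot> t (s [^] d) w + m s ^ d \<cdot> t s w"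
    using c by (simp add: t_mult m_pow) (simp add: t_def)
  then have "t (s [^] Suc d) w - (m s * a + m s ^ d) \<cdot> t s w
      = t s (t (s [^] d) w) + m s \<cdot> (t (s [^] d) w - a \<cdot> t s w)"
    by (simp add: scale_right_diff_distrib scale_left_distrib)
  then show ?case unfolding a' using F by simp
qed

text \<open>
  The ideal of all \<open>t s\<close> is generated by the \<open>t b\<close> modulo its square: some power \<open>s^d\<close> is a word in \<open>B\<close>, so
  \<open>t (s^d)\<close> is a combination of the \<open>t b\<close>, and by \<open>t_power\<close> it is a nonzero multiple of \<open>t s\<close> modulo the
  square. Here it matters that the characteristic is zero.
\<close>

lemma filt_subset_homog_mod:
  assumes S: "B \<subseteq> S" "S \<subseteq> carrier G"
  shows "filt S N \<subseteq> homog_mod S N"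
proof (induction N)
  case 0
  have "E \<subseteq> homog_mod S 0" using homog_in_mod[OF S(2), of _ 0] by (auto intro: span_base)
  then show ?case by (simp add: generated_least[OF stable_homog_mod[OF S]])
next
  case (Suc N)
  have "t s w \<in> homog_mod S (Suc N)" if s: "s \<in> S" and w: "w \<in> filt S N" for s w
  proof -
    note sM = subspace_homog_mod[OF S(2), of "Suc N"]
    have c: "s \<in> carrier G" using s S by auto
    from w Suc obtain u v where uv: "w = u + v" "u \<in> homog N" "v \<in> filt S (Suc N)"
      by (auto simp: homog_mod_def)
    obtain d :: nat where d: "d > 0" "s [^] d \<in> gen_submonoid G B" using power_in_B[OF c] by blast
    define a where "a = of_nat d * m s ^ (d - 1)"
    have a: "a \<noteq> 0" using d m_nonzero[OF c] by (simp add: a_def)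
    have uF: "u \<in> filt S N" using uv homog_subset_filt[OF S] by blast
    have "t (s [^] d) u - (t (s [^] d) u - a \<cdot> t s u) \<in> homog_mod S (Suc N)"
      by (rule subspace_diff[OF sM t_submonoid_homog[OF S d(2) uv(2)]
            filt_in_mod[OF t_power[OF S(2) s uF, of d, folded a_def]]])
    then have "inverse a \<cdot> (a \<cdot> t s u) \<in> homog_mod S (Suc N)"
      by (intro subspace_scale[OF sM, of "a \<cdot> t s u"]) simp
    then have "t s u \<in> homog_mod S (Suc N)" using a by simp
    moreover have "t s v \<in> homog_mod S (Suc N)" by (intro filt_in_mod t_filt s uv)
    moreover have "t s w = t s u + t s v" using uv c by (simp add: shifted.T_add)
    ultimately show ?thesis using subspace_add[OF sM] by simp
  qed
  then have "{t s w | s w. s \<in> S \<and> w \<in> filt S N} \<subseteq> homog_mod S (Suc N)" by blast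
  then show ?case unfolding filt.simps(2) by (rule span_minimal[OF _ subspace_homog_mod[OF S(2)]])
qed

lemma generated_finite_support:
  assumes "w \<in> W"
  shows "\<exists>S. finite S \<and> S \<subseteq> carrier G \<and> w \<in> generated S E"
proof -
  let ?U = "{w. \<exists>S. finite S \<and> S \<subseteq> carrier G \<and> w \<in> generated S E}"
  have "stable (carrier G) ?U"
  proof (rule stableI)
    show "subspace ?U"
    proof (rule subspaceI)
      show "0 \<in> ?U" using subspace_0[OF subspace_generated] by blast
    next
      fix u v assume "u \<in> ?U" "v \<in> ?U"
      then obtain S S' where S: "finite S" "S \<subseteq> carrier G" "u \<in> generated S E"
        "finite S'" "S' \<subseteq> carrier G" "v \<in> generated S' E" by blast
      then have "u \<in> generated (S \<union> S') E" "v \<in> generated (S \<union> S') E"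
        using generated_mono[of S "S \<union> S'" E E] generated_mono[of S' "S \<union> S'" E E] by auto
      then show "u + v \<in> ?U" using S subspace_add[OF subspace_generated] by (metis (mono_tags, lifting) Un_least finite_UnI mem_Collect_eq)
    next
      fix c u assume "u \<in> ?U"
      then show "c \<cdot> u \<in> ?U" using subspace_scale[OF subspace_generated] by blast
    qed
  next
    fix g u assume g: "g \<in> carrier G" and "u \<in> ?U"
    then obtain S where S: "finite S" "S \<subseteq> carrier G" "u \<in> generated S E" by blast
    then have "u \<in> generated (insert g S) E" using generated_mono[of S "insert g S" E E] by auto
    then have "\<tau> g u \<in> generated (insert g S) E" by (intro stable_T[OF stable_generated]) auto
    then show "\<tau> g u \<in> ?U" using S g by (intro CollectI exI[of _ "insert g S"]) auto
  qed
  moreover have "E \<subseteq> ?U" using generated_base[of _ E "{}"] by auto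
  ultimately have "W \<subseteq> ?U" by (rule generated_least)
  then show ?thesis using assms by (rule subsetD[THEN CollectD])
qed

lemma filt_finite_support:
  assumes "w \<in> filt (carrier G) N"
  shows "\<exists>S. finite S \<and> S \<subseteq> carrier G \<and> w \<in> filt S N"
  using assms
proof (induction N arbitrary: w)
  case 0
  then show ?case using generated_finite_support by simp
next
  case (Suc N)
  from Suc.prems show ?case unfolding filt.simps(2)
  proof (induction rule: span_induct_alt)
    case base
    show ?case by (intro exI[of _ "{}"]) (simp add: span_zero)
  next
    case (step c a w)
    then obtain s v where a: "a = t s v" "s \<in> carrier G" "v \<in> filt (carrier G) N" by blast
    obtain S where S: "finite S" "S \<subseteq> carrier G" "v \<in> filt S N" using Suc.IH[OF a(3)] by blast
    obtain S' where S': "finite S'" "S' \<subseteq> carrier G" "w \<in> filt S' (Suc N)"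
      using step by (auto simp: filt.simps(2))
    let ?S = "insert s (S \<union> S')"
    have sub: "?S \<subseteq> carrier G" using a S S' by auto
    have "t s v \<in> filt ?S (Suc N)"
      using S(3) filt_mono[of S ?S N] by (intro t_filt) auto
    moreover have "w \<in> filt ?S (Suc N)" using S'(3) filt_mono[of S' ?S "Suc N"] by blast
    ultimately have "c \<cdot> a + w \<in> filt ?S (Suc N)"
      unfolding a(1) by (intro subspace_add subspace_scale subspace_filt sub)
    then have "finite ?S \<and> ?S \<subseteq> carrier G \<and> c \<cdot> a + w \<in> filt ?S (Suc N)" using S(1) S'(1) sub by simp
    then show ?case unfolding filt.simps(2) by (rule exI[of _ ?S])
  qed
qed

section \<open>Initial forms and descent to a finite set\<close>

definition single :: "nat \<Rightarrow> 'w \<Rightarrow> nat \<Rightarrow> 'w" where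
  "single e w = (\<lambda>n. if n = e then w else 0)"

text \<open>
  On \<open>W[X]\<close>, with sequences as polynomials, \<open>raise b\<close> is multiplication by \<open>t b * X\<close>. The extra variable
  keeps forms of different degrees apart, although their values in \<open>W\<close> may be related.
\<close>

definition raise :: "'a \<Rightarrow> (nat \<Rightarrow> 'w) \<Rightarrow> nat \<Rightarrow> 'w" where
  "raise b q = (\<lambda>n. case n of 0 \<Rightarrow> 0 | Suc k \<Rightarrow> t b (q k))"

sublocale graded: commuting_operators "\<lambda>c q (n::nat). c \<cdot> q n" raise B
proof (intro commuting_operators.intro vector_space_pointwise vector_space_axioms
    commuting_operators_axioms.intro)
  fix b c :: 'a and q r :: "nat \<Rightarrow> 'w" and z
  assume "b \<in> B"
  then have b: "b \<in> carrier G" using B_carrier by auto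
  show "raise b (q + r) = raise b q + raise b r"
    using b by (auto simp: raise_def fun_eq_iff shifted.T_add split: nat.split)
  show "raise b (\<lambda>n. z \<cdot> q n) = (\<lambda>n. z \<cdot> raise b q n)"
    using b by (auto simp: raise_def fun_eq_iff shifted.T_scale split: nat.split)
  assume "c \<in> B"
  then have c: "c \<in> carrier G" using B_carrier by auto
  show "raise b (raise c q) = raise c (raise b q)"
    using b c by (auto simp: raise_def fun_eq_iff shifted.T_comm shifted.T_0 split: nat.split)
qed

abbreviation "graded_module \<equiv> graded.generated B (single 0 ` E)"

lemma subspace_single:
  assumes "graded.subspace M"
  shows "subspace {w. single e w \<in> M}"
proof -
  have "single e 0 = 0" "single e (v + w) = single e v + single e w"
    "single e (c \<cdot> v) = (\<lambda>n. c \<cdot> single e v n)" for v w c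
    by (auto simp: single_def fun_eq_iff)
  then show ?thesis
    using graded.subspace_0[OF assms] graded.subspace_add[OF assms] graded.subspace_scale[OF assms]
    by (intro subspaceI) auto
qed

lemma single_in_graded: "w \<in> homog e \<Longrightarrow> single e w \<in> graded_module"
proof (induction e arbitrary: w)
  case 0
  have "span E \<subseteq> {w. single 0 w \<in> graded_module}"
    by (rule span_minimal) (auto intro: graded.generated_base subspace_single[OF graded.subspace_generated])
  then show ?case using 0 by auto
next
  case (Suc e)
  have "single (Suc e) (t b w) \<in> graded_module" if "b \<in> B" "w \<in> homog e" for b w
  proof -
    have "single (Suc e) (t b w) = raise b (single e w)"
      using that(1) B_carrier
      by (auto simp: single_def raise_def fun_eq_iff shifted.T_0 split: nat.split)
    then show ?thesis using graded.stable_T[OF graded.stable_generated that(1) Suc.IH[OF that(2)]] by simp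
  qed
  then have "homog (Suc e) \<subseteq> {w. single (Suc e) w \<in> graded_module}"
    unfolding homog.simps
    by (intro span_minimal subspace_single[OF graded.subspace_generated]) auto
  then show ?case using Suc.prems by blast
qed

text \<open>
  The elements of \<open>K\<close> that are visible over \<open>S\<close>, up to the \<open>N\<close>-th step of the filtration over \<open>S\<close>.
\<close>

definition K_mod :: "'a set \<Rightarrow> nat \<Rightarrow> 'w set" where
  "K_mod S N = {u + v | u v. u \<in> K \<inter> generated S E \<and> v \<in> filt S N}"

text \<open>
  The initial forms of \<open>K\<close> over \<open>S\<close>: forms of degree \<open>e\<close> that agree with an element of \<open>K\<close> modulo the
  next step of the filtration.
\<close>

definition initial :: "'a set \<Rightarrow> (nat \<Rightarrow> 'w) set" where
  "initial S = {q \<in> graded_module. \<forall>e. q e \<in> K_mod S (Suc e)}"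

lemma subspace_K_mod: "S \<subseteq> carrier G \<Longrightarrow> subspace (K_mod S N)"
  unfolding K_mod_def by (intro subspace_sums subspace_filt subspace_inter sK subspace_generated)

lemma K_mod_mono: "S \<subseteq> S' \<Longrightarrow> K_mod S N \<subseteq> K_mod S' N"
  unfolding K_mod_def using filt_mono[of S S' N] generated_mono[of S S' E E] by blast

lemma initial_mono: "S \<subseteq> S' \<Longrightarrow> initial S \<subseteq> initial S'"
  unfolding initial_def using K_mod_mono by blast

lemma stable_initial:
  assumes S: "B \<subseteq> S" "S \<subseteq> carrier G"
  shows "graded.stable B (initial S)"
proof (rule graded.stableI)
  note sM = subspace_K_mod[OF S(2)]
  show "graded.subspace (initial S)"
    unfolding initial_def
    by (rule graded.subspaceI)
      (simp_all add: subspace_0[OF sM] subspace_add[OF sM] subspace_scale[OF sM]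
        graded.subspace_0[OF graded.subspace_generated] graded.subspace_add[OF graded.subspace_generated]
        graded.subspace_scale[OF graded.subspace_generated])
next
  fix b q assume b: "b \<in> B" and q: "q \<in> initial S"
  have bS: "b \<in> S" "b \<in> carrier G" using b S by auto
  have "raise b q e \<in> K_mod S (Suc e)" for e
  proof (cases e)
    case 0
    then show ?thesis using subspace_0[OF subspace_K_mod[OF S(2)], of 1] by (simp add: raise_def)
  next
    case (Suc k)
    have "q k \<in> K_mod S (Suc k)" using q by (simp add: initial_def)
    then obtain u v where uv: "q k = u + v" "u \<in> K" "u \<in> generated S E" "v \<in> filt S (Suc k)"
      unfolding K_mod_def by blast
    have "t b (q k) = t b u + t b v" using uv(1) bS by (simp add: shifted.T_add)
    moreover have "t b u \<in> K \<inter> generated S E"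
      using stable_t[OF stable_K bS(2) uv(2)] stable_t[OF stable_generated bS(1) uv(3)] by blast
    moreover have "t b v \<in> filt S (Suc (Suc k))" by (rule t_filt[OF bS(1) uv(4)])
    ultimately show ?thesis unfolding K_mod_def Suc raise_def by (simp only: nat.case) blast
  qed
  moreover have "raise b q \<in> graded_module"
    using q graded.stable_T[OF graded.stable_generated b] by (simp add: initial_def)
  ultimately show "raise b q \<in> initial S" by (simp add: initial_def)
qed

text \<open>
  All the submodules \<open>initial S\<close> live in one finitely generated module over finitely many operators,
  whatever the size of \<open>S\<close>, so a maximal one exists; it is the largest because they are directed.
\<close>

lemma initial_stabilizes:
  assumes "finite S" "S \<subseteq> carrier G" "B \<subseteq> S"
  obtains S0 where "finite S0" "S \<subseteq> S0" "S0 \<subseteq> carrier G"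
    "\<And>S'. finite S' \<Longrightarrow> S0 \<subseteq> S' \<Longrightarrow> S' \<subseteq> carrier G \<Longrightarrow> initial S' = initial S0"
proof -
  let ?F = "{initial S' | S'. finite S' \<and> S \<subseteq> S' \<and> S' \<subseteq> carrier G}"
  have "\<exists>L\<in>?F. \<forall>L'\<in>?F. L \<subseteq> L' \<longrightarrow> L' = L"
  proof (rule graded.maximal_member[OF finite_B subset_refl])
    show "finite (single 0 ` E)" using finite_E by simp
    show "?F \<noteq> {}" using assms by blast
    fix L assume "L \<in> ?F"
    then obtain S' where "L = initial S'" "S \<subseteq> S'" "S' \<subseteq> carrier G" by blast
    then show "graded.stable B L \<and> L \<subseteq> graded_module"
      using stable_initial[of S'] assms by (auto simp: initial_def)
  qed
  then obtain S0 where S0: "finite S0" "S \<subseteq> S0" "S0 \<subseteq> carrier G"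
    and max: "\<forall>L'\<in>?F. initial S0 \<subseteq> L' \<longrightarrow> L' = initial S0" by blast
  have "initial S' = initial S0" if "finite S'" "S0 \<subseteq> S'" "S' \<subseteq> carrier G" for S'
    using max that S0 initial_mono[OF that(2)] by blast
  with S0 show ?thesis using that by blast
qed

text \<open>
  Suppose that \<open>x\<close> has been approximated by \<open>K\<close> over \<open>S0\<close> up to degree \<open>N\<close>. The form of degree \<open>N\<close> in the error
  is an initial form of \<open>K\<close> over some larger finite set, hence over \<open>S0\<close> as well, and this
  improves the approximation by one degree.
\<close>

lemma filtration_descends:
  assumes S0: "finite S0" "S0 \<subseteq> carrier G" "B \<subseteq> S0" "x \<in> generated S0 E"
    and stab: "\<And>S'. finite S' \<Longrightarrow> S0 \<subseteq> S' \<Longrightarrow> S' \<subseteq> carrier G \<Longrightarrow> initial S' = initial S0"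
    and x: "\<And>N. x \<in> K_mod (carrier G) N"
  shows "x \<in> K_mod S0 N"
proof (induction N)
  case 0
  have "0 \<in> K \<inter> generated S0 E" using subspace_0[OF sK] subspace_0[OF subspace_generated] by blast
  then show ?case unfolding K_mod_def using S0(4) by force
next
  case (Suc N)
  then obtain l z where lz: "x = l + z" "l \<in> K" "l \<in> generated S0 E" "z \<in> filt S0 N"
    unfolding K_mod_def by blast
  obtain q w where qw: "z = q + w" "q \<in> homog N" "w \<in> filt S0 (Suc N)"
    using filt_subset_homog_mod[OF S0(3,2)] lz(4) unfolding homog_mod_def by blast
  obtain k y where ky: "x = k + y" "k \<in> K" "y \<in> filt (carrier G) (Suc N)"
    using x[of "Suc N"] unfolding K_mod_def by blast
  obtain S1 where S1: "finite S1" "S1 \<subseteq> carrier G" "y \<in> filt S1 (Suc N)"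
    using filt_finite_support[OF ky(3)] by blast
  obtain S2 where S2: "finite S2" "S2 \<subseteq> carrier G" "k \<in> generated S2 E"
    using generated_finite_support K_W ky(2) by blast
  define S where "S = S0 \<union> S1 \<union> S2"
  have S: "finite S" "S0 \<subseteq> S" "S \<subseteq> carrier G" using S0 S1 S2 by (auto simp: S_def)
  note sO = subspace_generated[of S E] and sF = subspace_filt[OF S(3), of "Suc N"]
  have "k \<in> generated S E" "l \<in> generated S E"
    using S2(3) lz(3) generated_mono[of S2 S E E] generated_mono[of S0 S E E] by (auto simp: S_def)
  then have kl: "k - l \<in> K \<inter> generated S E"
    using subspace_diff[OF sK ky(2) lz(2)] subspace_diff[OF sO] by blast
  have "y \<in> filt S (Suc N)" "w \<in> filt S (Suc N)"
    using S1(3) qw(3) filt_mono[of S1 S "Suc N"] filt_mono[of S0 S "Suc N"] unfolding S_def by blast+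
  then have "y - w \<in> filt S (Suc N)" by (rule subspace_diff[OF sF])
  moreover have "q = (k - l) + (y - w)" using lz(1) qw(1) ky(1) by (simp add: algebra_simps)
  ultimately have q: "q \<in> K_mod S (Suc N)" using kl unfolding K_mod_def by blast
  have "single N q \<in> initial S"
    using single_in_graded[OF qw(2)] q subspace_0[OF subspace_K_mod[OF S(3)]]
    by (auto simp: initial_def single_def)
  then have "single N q \<in> initial S0" using stab[OF S] by simp
  then have "single N q N \<in> K_mod S0 (Suc N)" unfolding initial_def by blast
  then obtain a b where ab: "q = a + b" "a \<in> K" "a \<in> generated S0 E" "b \<in> filt S0 (Suc N)"
    unfolding K_mod_def single_def by auto
  have "x = (l + a) + (b + w)" using lz(1) qw(1) ab(1) by simp
  moreover have "l + a \<in> K \<inter> generated S0 E"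
    using subspace_add[OF sK lz(2) ab(2)] subspace_add[OF subspace_generated lz(3) ab(3)] by blast
  moreover have "b + w \<in> filt S0 (Suc N)"
    by (rule subspace_add[OF subspace_filt[OF S0(2)] ab(4) qw(3)])
  ultimately show ?case unfolding K_mod_def by blast
qed

section \<open>Krull intersection over a finite set\<close>

text \<open>
  Here \<open>L0\<close> is maximal among the submodules over \<open>S\<close> that avoid \<open>x\<close>. The submodules
  \<open>{w. (t s)^n w \<in> L0}\<close> increase and become constant at some \<open>n\<close>. If \<open>(t s)^n\<close> did not map into \<open>L0\<close>, then
  \<open>x = l + (t s)^n y\<close> by maximality; as \<open>t s x\<close> is in \<open>L0\<close>, so is \<open>(t s)^(n+1) y\<close>, hence
  \<open>(t s)^n y\<close>, hence \<open>x\<close>.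
\<close>

lemma t_pow_absorbed:
  assumes S: "finite S" "S \<subseteq> carrier G" "x \<in> generated S E"
    and L0: "stable S L0" "L0 \<subseteq> generated S E" "x \<notin> L0" "K \<inter> generated S E \<subseteq> L0"
    and max: "\<And>L. stable S L \<Longrightarrow> L0 \<subseteq> L \<Longrightarrow> L \<subseteq> generated S E \<Longrightarrow> x \<notin> L \<Longrightarrow> L = L0"
    and s: "s \<in> S"
  shows "\<exists>n. \<forall>w\<in>generated S E. (t s ^^ n) w \<in> L0"
proof -
  have c: "s \<in> carrier G" using s S by auto
  define A where "A n = {w \<in> generated S E. (t s ^^ n) w \<in> L0}" for n
  have pow_generated: "w \<in> generated S E \<Longrightarrow> (t s ^^ n) w \<in> generated S E" for w n
    by (induction n) (auto intro: stable_t[OF stable_generated s])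
  have \<tau>_pow_t: "g \<in> S \<Longrightarrow> \<tau> g ((t s ^^ n) w) = (t s ^^ n) (\<tau> g w)" for g n w
    using S c by (induction n) (auto simp: \<tau>_t_comm subset_eq)
  note sL0 = stable_subspace[OF L0(1)]
  have "\<exists>N. \<forall>n\<ge>N. A n = A N"
  proof (rule noetherianD[OF noetherian_finite[OF S(1,2) finite_E]])
    fix n
    show "stable S (A n)"
    proof (rule stableI)
      have "(t s ^^ n) 0 = 0" using shifted.pow_scale[OF c, of n 0 0] by simp
      then show "subspace (A n)"
        unfolding A_def
        by (intro subspaceI)
          (simp_all add: subspace_0[OF subspace_generated] subspace_add[OF subspace_generated]
            subspace_scale[OF subspace_generated] shifted.pow_add[OF c] shifted.pow_scale[OF c]
            subspace_0[OF sL0] subspace_add[OF sL0] subspace_scale[OF sL0])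
    next
      fix g w assume g: "g \<in> S" and "w \<in> A n"
      then have "\<tau> g w \<in> generated S E" "\<tau> g ((t s ^^ n) w) \<in> L0"
        unfolding A_def using stable_T[OF stable_generated g] stable_T[OF L0(1) g] by blast+
      then show "\<tau> g w \<in> A n" unfolding A_def using \<tau>_pow_t[OF g] by simp
    qed
    show "A n \<subseteq> generated S E" by (auto simp: A_def)
    show "A n \<subseteq> A (Suc n)" by (auto simp: A_def intro: stable_t[OF L0(1) s])
  qed
  then obtain n where n: "A (Suc n) = A n" by (metis le_SucI order_refl)
  have "(t s ^^ n) w \<in> L0" if w: "w \<in> generated S E" for w
  proof (rule ccontr)
    assume no: "(t s ^^ n) w \<notin> L0"
    let ?L = "{l + v | l v. l \<in> L0 \<and> v \<in> {(t s ^^ n) y | y. y \<in> generated S E}}"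
    have im: "stable S {(t s ^^ n) y | y. y \<in> generated S E}"
    proof (rule stableI)
      show "subspace {(t s ^^ n) y | y. y \<in> generated S E}"
      proof (rule subspaceI)
        have "0 = (t s ^^ n) 0" using shifted.pow_scale[OF c, of n 0 0] by simp
        then show "0 \<in> {(t s ^^ n) y | y. y \<in> generated S E}" using subspace_0[OF subspace_generated] by blast
      next
        fix u v assume "u \<in> {(t s ^^ n) y | y. y \<in> generated S E}" "v \<in> {(t s ^^ n) y | y. y \<in> generated S E}"
        then obtain y z where "u = (t s ^^ n) y" "v = (t s ^^ n) z" "y \<in> generated S E" "z \<in> generated S E" by blast
        then show "u + v \<in> {(t s ^^ n) y | y. y \<in> generated S E}"
          using subspace_add[OF subspace_generated] shifted.pow_add[OF c, of n y z, symmetric] by blast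
      next
        fix a u assume "u \<in> {(t s ^^ n) y | y. y \<in> generated S E}"
        then obtain y where "u = (t s ^^ n) y" "y \<in> generated S E" by blast
        then show "a \<cdot> u \<in> {(t s ^^ n) y | y. y \<in> generated S E}"
          using subspace_scale[OF subspace_generated] shifted.pow_scale[OF c, of n a y, symmetric] by blast
      qed
    next
      fix g u assume g: "g \<in> S" and "u \<in> {(t s ^^ n) y | y. y \<in> generated S E}"
      then obtain y where "u = (t s ^^ n) y" "y \<in> generated S E" by blast
      then show "\<tau> g u \<in> {(t s ^^ n) y | y. y \<in> generated S E}"
        using \<tau>_pow_t[OF g] stable_T[OF stable_generated g] by blast
    qed
    have "x \<in> ?L"
    proof (rule ccontr)
      assume xL: "x \<notin> ?L"
      have "?L = L0"
      proof (rule max[OF stable_sums[OF S(2) L0(1) im] _ _ xL])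
        show "L0 \<subseteq> ?L"
        proof
          fix l assume "l \<in> L0"
          moreover have "0 \<in> {(t s ^^ n) y | y. y \<in> generated S E}" by (rule subspace_0[OF stable_subspace[OF im]])
          moreover have "l = l + 0" by simp
          ultimately show "l \<in> ?L" by blast
        qed
        show "?L \<subseteq> generated S E"
        proof
          fix u assume "u \<in> ?L"
          then obtain l y where "u = l + (t s ^^ n) y" "l \<in> L0" "y \<in> generated S E"
            by (elim CollectE exE conjE) blast
          then show "u \<in> generated S E" using L0(2) pow_generated subspace_add[OF subspace_generated] by blast
        qed
      qed
      moreover have "(t s ^^ n) w = 0 + (t s ^^ n) w" by simp
      then have "(t s ^^ n) w \<in> ?L" using w subspace_0[OF sL0] by blast
      ultimately show False using no by simp
    qed
    then obtain l y where ly: "x = l + (t s ^^ n) y" "l \<in> L0" "y \<in> generated S E"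
      by (elim CollectE exE conjE) metis
    have "t s x \<in> L0" using t_x[OF c] stable_t[OF stable_generated s S(3)] L0(4) by blast
    moreover have "t s x = t s l + (t s ^^ Suc n) y" 
      using arg_cong[OF ly(1), of "t s"] c by (simp add: shifted.T_add)
    moreover have "t s l \<in> L0" by (rule stable_t[OF L0(1) s ly(2)])
    ultimately have "(t s ^^ Suc n) y \<in> L0"
      using subspace_diff[OF sL0] by (metis add_diff_cancel_left')
    then have "y \<in> A (Suc n)" using ly(3) by (simp add: A_def)
    then have "(t s ^^ n) y \<in> L0" unfolding n by (simp add: A_def)
    then have "l + (t s ^^ n) y \<in> L0" by (rule subspace_add[OF sL0 ly(2)])
    then have "x \<in> L0" by (rule ssubst[OF ly(1)])
    with L0(3) show False by (rule notE)
  qed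
  then show ?thesis by blast
qed

lemma foldr_t_split:
  assumes "set l \<subseteq> carrier G" "s \<in> carrier G"
  shows "foldr t l w = (t s ^^ count_list l s) (foldr t (removeAll s l) w)"
  using assms(1)
proof (induction l)
  case (Cons a l)
  then show ?case
    using shifted.pow_comm[OF assms(2), of a] by (cases "a = s") auto
qed simp

lemma length_removeAll_count: "length l = count_list l s + length (removeAll s l)"
  by (induction l) auto

text \<open>
  A long product of commuting operators contains a high power of one of them.
\<close>

lemma long_products_absorbed:
  assumes "finite P" "P \<subseteq> S" "S \<subseteq> carrier G" and L0: "stable S L0" "L0 \<subseteq> generated S E"
    and pow: "\<And>s. s \<in> S \<Longrightarrow> \<exists>n. \<forall>w\<in>generated S E. (t s ^^ n) w \<in> L0"
  shows "\<exists>N. \<forall>l w. set l \<subseteq> P \<longrightarrow> length l \<ge> N \<longrightarrow> w \<in> generated S E \<longrightarrow> foldr t l w \<in> L0"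
  using assms(1,2)
proof (induction P)
  case empty
  show ?case by (rule exI[of _ 1]) auto
next
  case (insert s P)
  then obtain N where N: "\<And>l w. set l \<subseteq> P \<Longrightarrow> length l \<ge> N \<Longrightarrow> w \<in> generated S E \<Longrightarrow> foldr t l w \<in> L0"
    by auto
  have s: "s \<in> S" "s \<in> carrier G" using insert.prems assms(3) by auto
  obtain n where n: "\<And>w. w \<in> generated S E \<Longrightarrow> (t s ^^ n) w \<in> L0" using pow[OF s(1)] by blast
  have L0_pow: "v \<in> L0 \<Longrightarrow> (t s ^^ k) v \<in> L0" for v k
    by (induction k) (auto intro: stable_t[OF L0(1) s(1)])
  have foldr_generated: "set l \<subseteq> S \<Longrightarrow> w \<in> generated S E \<Longrightarrow> foldr t l w \<in> generated S E" for l w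
    by (induction l) (auto intro: stable_t[OF stable_generated])
  show ?case
  proof (intro exI[of _ "n + N"] allI impI)
    fix l w assume l: "set l \<subseteq> insert s P" "length l \<ge> n + N" and w: "w \<in> generated S E"
    let ?r = "removeAll s l"
    have r: "set ?r \<subseteq> P" "set ?r \<subseteq> S" using l insert.prems by auto
    have eq: "foldr t l w = (t s ^^ count_list l s) (foldr t ?r w)"
      using l(1) insert.prems assms(3) by (intro foldr_t_split s) auto
    show "foldr t l w \<in> L0"
    proof (cases "length ?r \<ge> N")
      case True
      then show ?thesis unfolding eq by (intro L0_pow N r w)
    next
      case False
      then have "count_list l s \<ge> n" using l(2) length_removeAll_count[of l s] by simp
      then obtain k where "count_list l s = k + n" using le_Suc_ex[of n] by (metis add.commute)
      then have "foldr t l w = (t s ^^ k) ((t s ^^ n) (foldr t ?r w))"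
        unfolding eq by (simp add: funpow_add)
      then show ?thesis using L0_pow n foldr_generated[OF r(2) w] by simp
    qed
  qed
qed

lemma filt_subset_products:
  "filt S N \<subseteq> span {foldr t l w | l w. set l \<subseteq> S \<and> length l = N \<and> w \<in> generated S E}"
  if S: "S \<subseteq> carrier G"
proof (induction N)
  case 0
  show ?case by (auto intro!: span_base)
next
  case (Suc N)
  let ?X = "\<lambda>N. {foldr t l w | l w. set l \<subseteq> S \<and> length l = N \<and> w \<in> generated S E}"
  have "t s w \<in> span (?X (Suc N))" if s: "s \<in> S" and w: "w \<in> filt S N" for s w
  proof -
    have c: "s \<in> carrier G" using s S by auto
    have "w \<in> span (?X N)" using w Suc by blast
    then show ?thesis
    proof (induction rule: span_induct_alt)
      case base
      show ?case using c by (simp add: shifted.T_0 span_zero)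
    next
      case (step a v w)
      then obtain l u where "v = foldr t l u" "set l \<subseteq> S" "length l = N" "u \<in> generated S E" by blast
      then have "t s v = foldr t (s # l) u \<and> set (s # l) \<subseteq> S \<and> length (s # l) = Suc N \<and> u \<in> generated S E"
        using s by simp
      then have "t s v \<in> ?X (Suc N)" by blast
      then have "a \<cdot> t s v + t s w \<in> span (?X (Suc N))"
        using step.IH by (intro span_add span_scale) (auto intro: span_base)
      then show ?case using c by (simp add: shifted.T_add shifted.T_scale)
    qed
  qed
  then have "{t s w | s w. s \<in> S \<and> w \<in> filt S N} \<subseteq> span (?X (Suc N))" by blast
  then show ?case unfolding filt.simps(2) by (rule span_minimal[OF _ subspace_span])
qed

text \<open>
  Krull's intersection theorem for the module over \<open>S\<close>: a submodule that is maximal with respect to avoiding \<open>x\<close>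
  contains a whole step of the filtration.
\<close>

lemma x_not_in_all_K_mod:
  assumes S: "finite S" "S \<subseteq> carrier G" "x \<in> generated S E"
  shows "\<exists>N. x \<notin> K_mod S N"
proof -
  let ?F = "{L. stable S L \<and> K \<inter> generated S E \<subseteq> L \<and> L \<subseteq> generated S E \<and> x \<notin> L}"
  have "stable S (K \<inter> generated S E)"
    using stable_mono[OF stable_K S(2)] stable_generated[of S E]
    by (auto simp: stable_def intro: subspace_inter)
  then have "K \<inter> generated S E \<in> ?F" using x_K by blast
  then have "\<exists>L\<in>?F. \<forall>L'\<in>?F. L \<subseteq> L' \<longrightarrow> L' = L"
    by (intro maximal_member[OF S(1,2) finite_E]) blast+
  then obtain L0 where L0F: "L0 \<in> ?F" and max': "\<forall>L\<in>?F. L0 \<subseteq> L \<longrightarrow> L = L0"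
    by (rule bexE)
  from L0F have L0: "stable S L0" "L0 \<subseteq> generated S E" "x \<notin> L0" "K \<inter> generated S E \<subseteq> L0"
    by simp_all
  have max: "L = L0" if "stable S L" "L0 \<subseteq> L" "L \<subseteq> generated S E" "x \<notin> L" for L
    using max' that order_trans[OF L0(4) that(2)] by simp
  note pow = t_pow_absorbed[OF S L0 max]
  obtain N where N: "\<And>l w. set l \<subseteq> S \<Longrightarrow> length l \<ge> N \<Longrightarrow> w \<in> generated S E \<Longrightarrow> foldr t l w \<in> L0"
    using long_products_absorbed[OF S(1) subset_refl S(2) L0(1,2) pow] by blast
  have "{foldr t l w | l w. set l \<subseteq> S \<and> length l = N \<and> w \<in> generated S E} \<subseteq> L0" using N by blast
  then have "filt S N \<subseteq> L0"
    using filt_subset_products[OF S(2), of N] span_minimal[OF _ stable_subspace[OF L0(1)]] by blast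
  then have "K_mod S N \<subseteq> L0"
    unfolding K_mod_def using L0(4) subspace_add[OF stable_subspace[OF L0(1)]] by blast
  then show ?thesis using L0(3) by blast
qed

section \<open>Finite codimension\<close>

text \<open>
  By the maximality of \<open>K\<close> it suffices that \<open>x\<close> is not in \<open>K + filt (carrier G) N\<close> for some \<open>N\<close>. Otherwise these
  memberships descend to a finite set \<open>S0\<close>, where they contradict Krull's theorem.
\<close>

lemma filt_subset_K: "\<exists>N. filt (carrier G) N \<subseteq> K"
proof -
  have "\<exists>N. x \<notin> K_mod (carrier G) N"
  proof (rule ccontr)
    assume "\<not> ?thesis"
    then have x: "x \<in> K_mod (carrier G) N" for N by blast
    obtain S1 where S1: "finite S1" "S1 \<subseteq> carrier G" "x \<in> generated S1 E"
      using generated_finite_support[OF x_W] by blast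
    obtain S0 where S0: "finite S0" "S1 \<union> B \<subseteq> S0" "S0 \<subseteq> carrier G"
      and stab: "\<And>S'. finite S' \<Longrightarrow> S0 \<subseteq> S' \<Longrightarrow> S' \<subseteq> carrier G \<Longrightarrow> initial S' = initial S0"
      using initial_stabilizes[of "S1 \<union> B"] S1 finite_B B_carrier by auto
    have "x \<in> generated S0 E" using S1(3) S0(2) generated_mono[of S1 S0 E E] by auto
    moreover have "x \<in> K_mod S0 N" for N
      using S0 by (intro filtration_descends[OF S0(1,3) _ \<open>x \<in> generated S0 E\<close> stab x]) auto
    ultimately show False using x_not_in_all_K_mod[OF S0(1,3)] by blast
  qed
  then obtain N where N: "x \<notin> K_mod (carrier G) N" by blast
  let ?L = "{k + w | k w. k \<in> K \<and> w \<in> filt (carrier G) N}"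
  have "K \<inter> W = K" using K_W by blast
  then have "x \<notin> ?L" using N by (simp add: K_mod_def)
  have "?L = K"
  proof (rule maximal[OF stable_sums[OF _ stable_K stable_filt] _ _ \<open>x \<notin> ?L\<close>])
    show "K \<subseteq> ?L" using subspace_0[OF subspace_filt[OF subset_refl]] by force
    show "?L \<subseteq> W" using K_W filt_subset_W[OF subset_refl] subspace_add[OF sW] by blast
  qed auto
  moreover have "filt (carrier G) N \<subseteq> ?L" using subspace_0[OF sK] by force
  ultimately show ?thesis by blast
qed

lemma homog_finite_dim: "\<exists>Q. finite Q \<and> Q \<subseteq> homog N \<and> homog N \<subseteq> span Q"
proof (induction N)
  case 0
  show ?case using finite_E by (intro exI[of _ E]) (auto intro: span_base)
next
  case (Suc N)
  then obtain Q where Q: "finite Q" "Q \<subseteq> homog N" "homog N \<subseteq> span Q" by blast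
  let ?Q = "(\<lambda>(b, w). t b w) ` (B \<times> Q)"
  have "t b w \<in> span ?Q" if b: "b \<in> B" and w: "w \<in> homog N" for b w
  proof -
    have c: "b \<in> carrier G" using b B_carrier by auto
    have "w \<in> span Q" using w Q by blast
    then show ?thesis
      by (induction rule: span_induct_alt)
        (use b c in \<open>auto simp: shifted.T_0 shifted.T_add shifted.T_scale
           intro!: span_zero span_add span_scale intro: span_base\<close>)
  qed
  then have "{t b w | b w. b \<in> B \<and> w \<in> homog N} \<subseteq> span ?Q" by blast
  then have "homog (Suc N) \<subseteq> span ?Q"
    unfolding homog.simps by (rule span_minimal[OF _ subspace_span])
  moreover have "?Q \<subseteq> homog (Suc N)" using Q(2) t_homog by auto
  ultimately show ?case using Q(1) finite_B by (intro exI[of _ ?Q]) auto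
qed

theorem finite_codimension: "\<exists>Q. finite Q \<and> Q \<subseteq> W \<and> W \<subseteq> span (Q \<union> K)"
proof -
  have "\<exists>Q. finite Q \<and> Q \<subseteq> W \<and> W \<subseteq> span (Q \<union> filt (carrier G) N)" for N
  proof (induction N)
    case 0
    show ?case by (rule exI[of _ "{}"]) (auto intro: span_base)
  next
    case (Suc N)
    then obtain Q where Q: "finite Q" "Q \<subseteq> W" "W \<subseteq> span (Q \<union> filt (carrier G) N)" by blast
    obtain R where R: "finite R" "R \<subseteq> homog N" "homog N \<subseteq> span R" using homog_finite_dim by blast
    let ?Y = "Q \<union> R \<union> filt (carrier G) (Suc N)"
    have "filt (carrier G) N \<subseteq> span ?Y"
    proof
      fix w assume "w \<in> filt (carrier G) N"
      then obtain u v where uv: "w = u + v" "u \<in> homog N" "v \<in> filt (carrier G) (Suc N)"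
        using filt_subset_homog_mod[OF B_carrier subset_refl] unfolding homog_mod_def by blast
      have "u \<in> span ?Y" using uv(2) R(3) span_mono[of R ?Y] by blast
      moreover have "v \<in> span ?Y" using uv(3) by (intro span_base) blast
      ultimately show "w \<in> span ?Y" unfolding uv(1) by (rule span_add)
    qed
    moreover have "Q \<subseteq> span ?Y" by (auto intro: span_base)
    ultimately have "span (Q \<union> filt (carrier G) N) \<subseteq> span ?Y"
      by (intro span_minimal subspace_span Un_least)
    moreover have "R \<subseteq> W"
      using R(2) homog_subset_filt[OF B_carrier subset_refl] filt_subset_W[OF subset_refl] by blast
    ultimately show ?case using Q R by (intro exI[of _ "Q \<union> R"]) auto
  qed
  then have codim: "\<exists>Q. finite Q \<and> Q \<subseteq> W \<and> W \<subseteq> span (Q \<union> filt (carrier G) N)" for N .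
  obtain N where N: "filt (carrier G) N \<subseteq> K" using filt_subset_K by (elim exE)
  obtain Q where Q: "finite Q" "Q \<subseteq> W" "W \<subseteq> span (Q \<union> filt (carrier G) N)"
    using codim[of N] by (elim exE conjE)
  have "span (Q \<union> filt (carrier G) N) \<subseteq> span (Q \<union> K)" using N by (intro span_mono Un_mono subset_refl)
  with Q(3) have "W \<subseteq> span (Q \<union> K)" by (rule order_trans)
  with Q(1,2) show ?thesis by (intro exI conjI)
qed

end

text \<open>
  A finitely generated module over the group ring is residually finite dimensional.
\<close>

theorem (in group_module) finite_codimension_submodule:
  assumes K0: "stable (carrier G) K0" "K0 \<subseteq> W" and x: "x \<in> W" "x \<notin> K0"
  obtains K Q where "stable (carrier G) K" "K0 \<subseteq> K" "K \<subseteq> W" "x \<notin> K"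
    "finite Q" "Q \<subseteq> W" "W \<subseteq> span (Q \<union> K)"
proof -
  let ?F = "{K. stable (carrier G) K \<and> K0 \<subseteq> K \<and> K \<subseteq> W \<and> x \<notin> K}"
  have "\<exists>K\<in>?F. \<forall>L\<in>?F. K \<subseteq> L \<longrightarrow> L = K"
  proof (rule subset_Zorn_nonempty)
    show "?F \<noteq> {}" using assms by blast
    fix C assume C: "C \<noteq> {}" "subset.chain ?F C"
    then have CF: "L \<in> C \<Longrightarrow> stable (carrier G) L \<and> K0 \<subseteq> L \<and> L \<subseteq> W \<and> x \<notin> L" for L
      by (auto simp: subset.chain_def)
    have chain: "L \<subseteq> L' \<or> L' \<subseteq> L" if "L \<in> C" "L' \<in> C" for L L'
      using C(2) that by (auto simp: subset.chain_def)
    have "stable (carrier G) (\<Union>C)"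
    proof (rule stableI)
      show "subspace (\<Union>C)"
      proof (rule subspaceI)
        show "0 \<in> \<Union>C" using C(1) CF stable_subspace subspace_0 by blast
      next
        fix u v assume "u \<in> \<Union>C" "v \<in> \<Union>C"
        then obtain L L' where L: "L \<in> C" "L' \<in> C" "u \<in> L" "v \<in> L'" by blast
        then obtain M where "M \<in> C" "u \<in> M" "v \<in> M" using chain[OF L(1,2)] by blast
        then show "u + v \<in> \<Union>C" using CF stable_subspace subspace_add by blast
      next
        fix c u assume "u \<in> \<Union>C"
        then show "c \<cdot> u \<in> \<Union>C" using CF stable_subspace subspace_scale by blast
      qed
    qed (use CF stable_T in blast)
    then show "\<Union>C \<in> ?F" using C(1) CF by blast
  qed
  then obtain K where KF: "K \<in> ?F" and max: "\<forall>L\<in>?F. K \<subseteq> L \<longrightarrow> L = K" by (rule bexE)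
  from KF have K: "stable (carrier G) K" "K0 \<subseteq> K" "K \<subseteq> W" "x \<notin> K" by simp_all
  interpret critical_submodule G scale \<tau> E B K x
  proof unfold_locales
    fix L assume "stable (carrier G) L" "K \<subseteq> L" "L \<subseteq> W" "x \<notin> L"
    then show "L = K" using max order_trans[OF K(2)] by simp
  qed (use K x in auto)
  obtain Q where "finite Q" "Q \<subseteq> W" "W \<subseteq> span (Q \<union> K)" using finite_codimension by (elim exE conjE)
  with K show ?thesis by (intro that)
qed

section \<open>Maximal independent systems\<close>

context comm_group begin

lemma gen_submonoid_mult:
  assumes S: "S \<subseteq> carrier G" and g: "g \<in> gen_submonoid G S" and h: "h \<in> gen_submonoid G S"
  shows "g \<otimes> h \<in> gen_submonoid G S"
  using h
proof induction
  case one
  then show ?case using gen_submonoid_carrier[OF S g] g by simp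
next
  case (mult h s)
  then have "g \<otimes> (h \<otimes> s) = (g \<otimes> h) \<otimes> s"
    using gen_submonoid_carrier[OF S] g S by (simp add: m_assoc subset_eq)
  then show ?case using gen_submonoid.mult[OF mult.IH mult(2)] by simp
qed

lemma finprod_in_gen_submonoid:
  assumes S: "S \<subseteq> carrier G" and "\<And>b. b \<in> F \<Longrightarrow> f b \<in> gen_submonoid G S"
  shows "(\<Otimes>b\<in>F. f b) \<in> gen_submonoid G S"
  using assms(2)
proof (induction F rule: infinite_finite_induct)
  case (insert b F)
  then have "f \<in> insert b F \<rightarrow> carrier G" using gen_submonoid_carrier[OF S] by auto
  then show ?case using insert gen_submonoid_mult[OF S] by (simp add: Pi_def)
qed (auto intro: gen_submonoid.one)

lemma independent_systemD:
  "independent_system G B \<Longrightarrow> finite F \<Longrightarrow> F \<subseteq> B \<Longrightarrow> (\<Otimes>b\<in>F. b [^] (c b :: int)) = \<one>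
    \<Longrightarrow> b \<in> F \<Longrightarrow> c b = 0"
  unfolding independent_system_def by blast

text \<open>
  If \<open>g\<close> has infinite order and is not in \<open>B\<close>, then adding it to \<open>B\<close> creates a relation. The exponent of
  \<open>g\<close> in this relation is not zero, as \<open>B\<close> is independent.
\<close>

lemma dependence_on_maximal_system:
  assumes B: "maximal_independent_system G B" and g: "g \<in> carrier G"
  obtains d :: nat and F and c :: "'a \<Rightarrow> int"
  where "d > 0" "finite F" "F \<subseteq> B" "g [^] d = (\<Otimes>b\<in>F. b [^] c b)"
proof -
  have ind: "independent_system G B" and BC: "B \<subseteq> carrier G"
    using B by (auto simp: maximal_independent_system_def independent_system_def)
  consider "ord g \<noteq> 0" | "g \<in> B" | "ord g = 0" "g \<notin> B" by blast
  then show ?thesis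
  proof cases
    case 1
    show ?thesis by (rule that[of "ord g" "{}"]) (use 1 g in auto)
  next
    case 2
    show ?thesis
      by (rule that[of 1 "{g}" "\<lambda>_. 1"]) (use 2 g in auto)
  next
    case 3
    then have "\<not> independent_system G (insert g B)"
      using B by (auto simp: maximal_independent_system_def)
    then obtain F c b where F: "finite F" "F \<subseteq> insert g B"
      "(\<Otimes>b\<in>F. b [^] (c b :: int)) = \<one>" "b \<in> F" "c b \<noteq> 0"
      using ind 3 g unfolding independent_system_def by auto
    define F' where "F' = F - {g}"
    have F': "finite F'" "F' \<subseteq> B" using F by (auto simp: F'_def)
    have gF: "g \<in> F" using independent_systemD[OF ind F(1) _ F(3,4)] F(2,5) by blast
    have pc: "(\<lambda>b. b [^] c b) \<in> F' \<rightarrow> carrier G" using F' BC by auto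
    then have P: "(\<Otimes>b\<in>F'. b [^] c b) \<in> carrier G" by (rule finprod_closed)
    have "F = insert g F'" using gF by (auto simp: F'_def)
    then have eq: "g [^] c g \<otimes> (\<Otimes>b\<in>F'. b [^] c b) = \<one>"
      using F(3) finprod_insert[OF F'(1) _ pc, of g] g by (simp add: F'_def)
    have cg: "c g \<noteq> 0"
    proof
      assume c0: "c g = 0"
      then have "(\<Otimes>b\<in>F'. b [^] c b) = \<one>" using eq P by simp
      then have "b \<in> F' \<Longrightarrow> c b = 0" by (rule independent_systemD[OF ind F'])
      then show False using F(4,5) c0 by (auto simp: F'_def)
    qed
    have gP: "g [^] c g = inv (\<Otimes>b\<in>F'. b [^] c b)"
      using eq P g by (metis int_pow_closed inv_equality)
    show ?thesis
    proof (cases "c g > 0")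
      case True
      have "g [^] nat (c g) = g [^] c g" using True by (metis int_pow_int nat_0_le less_imp_le)
      also have "\<dots> = (\<Otimes>b\<in>F'. b [^] (- c b))"
      proof -
        have nc: "(\<lambda>b. b [^] (- c b)) \<in> F' \<rightarrow> carrier G" using F' BC by auto
        have "(\<Otimes>b\<in>F'. b [^] (- c b)) \<otimes> (\<Otimes>b\<in>F'. b [^] c b)
            = (\<Otimes>b\<in>F'. b [^] (- c b) \<otimes> b [^] c b)"
          by (rule finprod_multf[OF nc pc, symmetric])
        also have "\<dots> = (\<Otimes>b\<in>F'. \<one>)"
          by (rule finprod_cong') (use F' BC in \<open>auto simp: int_pow_neg subset_eq\<close>)
        finally show ?thesis unfolding gP using inv_equality[OF _ P finprod_closed[OF nc]] by simp
      qed
      finally show ?thesis using that[of "nat (c g)" F' "\<lambda>b. - c b"] True F' by simp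
    next
      case False
      have "g [^] nat (- c g) = g [^] (- c g)" using False by (metis int_pow_int nat_0_le neg_0_le_iff_le not_less)
      also have "\<dots> = (\<Otimes>b\<in>F'. b [^] c b)" using g P gP by (simp add: int_pow_neg)
      finally show ?thesis using that[of "nat (- c g)" F' c] False cg F' by simp
    qed
  qed
qed

lemma power_in_gen_submonoid:
  assumes B: "maximal_independent_system G B" and g: "g \<in> carrier G"
  shows "\<exists>d>0. g [^] (d::nat) \<in> gen_submonoid G (B \<union> (\<lambda>b. inv b) ` B)"
proof -
  let ?S = "B \<union> (\<lambda>b. inv b) ` B"
  obtain d :: nat and F and c :: "'a \<Rightarrow> int"
    where d: "d > 0" "finite F" "F \<subseteq> B" "g [^] d = (\<Otimes>b\<in>F. b [^] c b)"
    by (rule dependence_on_maximal_system[OF B g])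
  have BC: "B \<subseteq> carrier G"
    using B by (auto simp: maximal_independent_system_def independent_system_def)
  have SC: "?S \<subseteq> carrier G" using BC by auto
  have "b [^] c b \<in> gen_submonoid G ?S" if "b \<in> F" for b
  proof -
    have b: "b \<in> B" "b \<in> carrier G" using that d BC by auto
    show ?thesis
    proof (cases "c b" rule: int_cases2)
      case (nonneg n)
      then show ?thesis using gen_submonoid_nat_pow[of b ?S G] b by (simp add: int_pow_int)
    next
      case (nonpos n)
      then have "b [^] c b = (inv b) [^] n" using b by (simp add: int_pow_neg_int nat_pow_inv)
      then show ?thesis using gen_submonoid_nat_pow[of "inv b" ?S G n] b by simp
    qed
  qed
  then have "(\<Otimes>b\<in>F. b [^] c b) \<in> gen_submonoid G ?S" by (rule finprod_in_gen_submonoid[OF SC])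
  then show ?thesis using d by metis
qed

end

section \<open>Duality and spectral synthesis\<close>

context vector_space begin

lemma separating_functional:
  assumes "subspace K" "x \<notin> K"
  obtains \<phi> where "\<And>v w. \<phi> (v + w) = \<phi> v + \<phi> w" "\<And>c v. \<phi> (scale c v) = c * \<phi> v"
    "\<And>v. v \<in> K \<Longrightarrow> \<phi> v = 0" "\<phi> x = (1 :: 'a)"
proof -
  interpret p: vector_space_pair scale "(*) :: 'a \<Rightarrow> 'a \<Rightarrow> 'a" by unfold_locales
  obtain D where D: "D \<subseteq> K" "independent D" "K \<subseteq> span D"
    by (rule maximal_independent_subset)
  have "span D \<subseteq> K" by (rule span_minimal[OF D(1) assms(1)])
  then have "independent (insert x D)"
    using D(2) assms(2) by (intro independent_insertI) auto
  from p.linear_independent_extend[OF this, of "\<lambda>b. if b = x then 1 else 0"]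
  obtain \<phi> where \<phi>: "Vector_Spaces.linear scale (*) \<phi>"
    "\<And>b. b \<in> insert x D \<Longrightarrow> \<phi> b = (if b = x then 1 else 0)" by blast
  interpret \<phi>: Vector_Spaces.linear scale "(*)" \<phi> by (rule \<phi>(1))
  have "\<phi> v = 0" if "v \<in> K" for v
  proof -
    have "v \<in> span D" using that D(3) by blast
    then show ?thesis
      by (induction rule: span_induct_alt)
        (use \<phi>(2) D(1) assms(2) in \<open>auto simp: \<phi>.add \<phi>.scale\<close>)
  qed
  then show ?thesis using that[of \<phi>] \<phi>(2)[of x] by (simp add: \<phi>.add \<phi>.scale)
qed

text \<open>
  A subspace on which finitely many functionals separate the points is finite dimensional. This is used for
  annihilators of subspaces of finite codimension.
\<close>

lemma finitely_many_functionals_finite_dim: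
  assumes "finite Q" "subspace U"
    and "\<And>q v w. q \<in> Q \<Longrightarrow> q (v + w) = q v + (q w :: 'a)" "\<And>q c v. q \<in> Q \<Longrightarrow> q (scale c v) = c * q v"
    and "\<And>u. u \<in> U \<Longrightarrow> (\<And>q. q \<in> Q \<Longrightarrow> q u = 0) \<Longrightarrow> u = 0"
  shows "\<exists>D. finite D \<and> U \<subseteq> span D"
  using assms
proof (induction Q arbitrary: U)
  case empty
  then show ?case by (intro exI[of _ "{}"]) auto
next
  case (insert q Q)
  have add: "q (v + w) = q v + q w" and scale: "q (scale c v) = c * q v" for v w c
    using insert.prems(2,3) by auto
  have q0: "q 0 = 0" using scale[of 0 0] by simp
  let ?U = "U \<inter> {u. q u = 0}"
  have "subspace ?U"
    by (intro subspace_inter insert.prems subspaceI) (auto simp: q0 add scale)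
  moreover have "u = 0" if "u \<in> ?U" "\<And>r. r \<in> Q \<Longrightarrow> r u = 0" for u
    using insert.prems(4)[of u] that by auto
  ultimately obtain D where D: "finite D" "?U \<subseteq> span D"
    using insert.IH[of ?U] insert.prems(2,3) by auto
  show ?case
  proof (cases "\<exists>u\<in>U. q u \<noteq> 0")
    case False
    then show ?thesis using D by (intro exI[of _ D]) auto
  next
    case True
    then obtain u where u: "u \<in> U" "q u \<noteq> 0" by blast
    have "U \<subseteq> span (insert u D)"
    proof
      fix v assume v: "v \<in> U"
      have "v + scale (- (q v / q u)) u \<in> U"
        by (intro subspace_add subspace_scale insert.prems(1) u v)
      moreover have "q (v + scale (- (q v / q u)) u) = 0" using u by (simp only: add scale) simp
      ultimately have "v + scale (- (q v / q u)) u \<in> span D" using D(2) by blast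
      then have "v - scale (q v / q u) u \<in> span D" by simp
      then show "v \<in> span (insert u D)" by (auto simp: span_breakdown_eq)
    qed
    then show ?thesis using D(1) by (intro exI[of _ "insert u D"]) auto
  qed
qed

end

lemma sum_fun_apply: "(\<Sum>i\<in>A. f i) x = (\<Sum>i\<in>A. f i x)"
  by (induction A rule: infinite_finite_induct) simp_all

interpretation vfun: vector_space
  "pointwise_scale ((*s) :: complex \<Rightarrow> complex ^ 'n \<Rightarrow> complex ^ 'n) ::
     complex \<Rightarrow> ('a \<Rightarrow> complex ^ 'n) \<Rightarrow> 'a \<Rightarrow> complex ^ 'n"
  unfolding pointwise_scale_def by (rule vector_space_pointwise[OF vec.vector_space_axioms])

type_synonym ('a, 'n) functional = "('a \<Rightarrow> complex ^ 'n) \<Rightarrow> complex"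

definition evaluation :: "'a \<Rightarrow> 'n \<Rightarrow> ('a, 'n::finite) functional" where
  "evaluation g i f = f g $ i"

text \<open>
  The action on functionals that is dual to translation; it sends the evaluation at \<open>h\<close> to the evaluation at \<open>h \<otimes> g\<close>.
\<close>

definition dual_translate :: "('a, 'm) monoid_scheme \<Rightarrow> 'a \<Rightarrow> ('a, 'n::finite) functional \<Rightarrow> ('a, 'n) functional"
  where "dual_translate G g l = (\<lambda>f. l (translate G g f))"

abbreviation functional_scale :: "complex \<Rightarrow> ('a, 'n::finite) functional \<Rightarrow> ('a, 'n) functional" where
  "functional_scale \<equiv> (\<lambda>c q f. c * q f)"

lemma (in comm_group) translate_translate:
  assumes "g \<in> carrier G" "h \<in> carrier G"
  shows "translate G h (translate G g f) = translate G (g \<otimes> h) f"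
  using assms by (auto simp: translate_def restr_def fun_eq_iff m_ac)

lemma translate_funs_on: "translate G g f \<in> funs_on G"
  by (simp add: translate_def restr_def funs_on_def)

lemma group_module_functionals:
  fixes G :: "('a, 'm) monoid_scheme"
  assumes "comm_group G" "maximal_independent_system G B" "finite B"
  shows "group_module G (functional_scale :: complex \<Rightarrow> ('a, 'n::finite) functional \<Rightarrow> _)
    (dual_translate G) (range (evaluation \<one>\<^bsub>G\<^esub>)) (B \<union> (\<lambda>b. inv\<^bsub>G\<^esub> b) ` B)"
proof -
  interpret comm_group G by fact
  have BC: "B \<subseteq> carrier G"
    using assms by (auto simp: maximal_independent_system_def independent_system_def)
  show ?thesis
  proof (intro group_module.intro group_module_axioms.intro assms(1)
      vector_space_pointwise vector_space_over_itself.vector_space_axioms)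
    show "\<exists>d>0. g [^]\<^bsub>G\<^esub> (d::nat) \<in> gen_submonoid G (B \<union> (\<lambda>b. inv\<^bsub>G\<^esub> b) ` B)"
      if "g \<in> carrier G" for g by (rule power_in_gen_submonoid[OF assms(2) that])
    show "dual_translate G (g \<otimes>\<^bsub>G\<^esub> h) l = dual_translate G g (dual_translate G h l)"
      if "g \<in> carrier G" "h \<in> carrier G" for g h and l :: "('a, 'n) functional"
      using that by (simp add: dual_translate_def translate_translate)
  qed (use BC assms(3) in \<open>auto simp: dual_translate_def fun_eq_iff evaluation_def translate_def
         restr_def\<close>)
qed

lemma variety_subspace: "variety (*s) G (V :: ('a \<Rightarrow> complex ^ 'n::finite) set) \<Longrightarrow> vfun.subspace V"
  by (simp add: variety_def)

lemma synthesis_superset: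
  fixes V :: "('a \<Rightarrow> complex ^ 'n::finite) set"
  assumes "variety (*s) G V"
  shows "closure (vfun.span {f \<in> V. P f}) \<subseteq> V"
  using assms by (intro closure_minimal vfun.span_minimal) (auto simp: variety_def)

text \<open>
  The argument \<open>dummy\<close> only carries the type of coordinates of \<open>E\<close>.
\<close>

locale functionals = comm_group G for G :: "('a, 'm) monoid_scheme" (structure) +
  fixes B :: "'a set" and dummy :: "'n::finite itself"
  assumes B: "maximal_independent_system G B" "finite B"
begin

sublocale gm: group_module G "functional_scale :: complex \<Rightarrow> ('a, 'n) functional \<Rightarrow> _"
    "dual_translate G" "range (evaluation \<one>)" "B \<union> (\<lambda>b. inv b) ` B"
  by (rule group_module_functionals[OF comm_group_axioms B])

lemma W_eq: "gm.W = gm.span {evaluation g i | g i. g \<in> carrier G}"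
proof
  have tr: "dual_translate G g (evaluation h i) = evaluation (h \<otimes> g) i"
    if "g \<in> carrier G" "h \<in> carrier G" for g h and i :: 'n
    using that by (auto simp: dual_translate_def evaluation_def translate_def restr_def)
  show "gm.W \<subseteq> gm.span {evaluation g i | g i. g \<in> carrier G}"
  proof (rule gm.generated_least[OF gm.stable_span[OF subset_refl]])
    fix g and l :: "('a, 'n) functional"
    assume g: "g \<in> carrier G" and "l \<in> {evaluation g i | g i. g \<in> carrier G}"
    then obtain h i where "l = evaluation h i" "h \<in> carrier G" by blast
    then show "dual_translate G g l \<in> gm.span {evaluation g i | g i. g \<in> carrier G}"
      using g tr by (auto intro!: gm.span_base)
  qed (auto intro!: gm.span_base)
  show "gm.span {evaluation g i | g i. g \<in> carrier G} \<subseteq> gm.W"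
  proof (rule gm.span_minimal[OF _ gm.subspace_generated])
    show "{evaluation g i | g i. g \<in> carrier G} \<subseteq> gm.W"
    proof
      fix l :: "('a, 'n) functional" assume "l \<in> {evaluation g i | g i. g \<in> carrier G}"
      then obtain g i where l: "l = evaluation g i" "g \<in> carrier G" by blast
      then have "l = dual_translate G g (evaluation \<one> i)" by (simp add: tr)
      then show "l \<in> gm.W"
        using gm.stable_T[OF gm.stable_generated l(2) gm.generated_base[OF rangeI]] by simp
    qed
  qed
qed

lemma functional_linear:
  assumes "l \<in> gm.W"
  shows "l (u + v) = l u + l v" "l (pointwise_scale (*s) c u) = c * l u"
proof -
  have "l \<in> gm.span {evaluation g i | g i. g \<in> carrier G}" using assms W_eq by simp
  then have "(\<forall>u v. l (u + v) = l u + l v) \<and> (\<forall>c u. l (pointwise_scale (*s) c u) = c * l u)"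
    by (induction rule: gm.span_induct_alt)
      (auto simp: evaluation_def pointwise_scale_def algebra_simps)
  then show "l (u + v) = l u + l v" "l (pointwise_scale (*s) c u) = c * l u" by blast+
qed

text \<open>
  Convergence is convergence on finite sets, so a function outside of the closure of \<open>U\<close> differs from every
  member of \<open>U\<close> already in restriction to some finite set \<open>F\<close>. A functional that separates the restrictions
  is a combination of the coordinate evaluations at the points of \<open>F\<close>.
\<close>

lemma closure_separation:
  fixes U :: "('a \<Rightarrow> complex ^ 'n) set"
  assumes U: "vfun.subspace U" "U \<subseteq> funs_on G" and f: "f \<in> funs_on G" "f \<notin> closure U"
  obtains l where "l \<in> gm.W" "\<And>u. u \<in> U \<Longrightarrow> l u = 0" "l f \<noteq> 0"
proof -
  obtain F e where F: "finite F" "F \<subseteq> carrier G" "e > 0"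
    and far: "\<not> (\<exists>u\<in>U. \<forall>x\<in>F. norm (u x - f x) < e)"
    using closure_funs_on_iff[OF f(1) U(2)] f(2) by blast
  define R where "R = restr F ` U"
  have radd: "restr F (u + v) = restr F u + restr F v"
    and rscale: "restr F (pointwise_scale (*s) c u) = pointwise_scale (*s) c (restr F u)"
    for u v :: "'a \<Rightarrow> complex ^ 'n" and c
    by (auto simp: restr_def pointwise_scale_def fun_eq_iff)
  have "vfun.subspace R"
  proof (rule vfun.subspaceI)
    have "restr F 0 = (0 :: 'a \<Rightarrow> complex ^ 'n)" by (auto simp: restr_def fun_eq_iff)
    then show "0 \<in> R" unfolding R_def using vfun.subspace_0[OF U(1)] by (metis imageI)
  next
    fix u v assume "u \<in> R" "v \<in> R"
    then show "u + v \<in> R"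
      unfolding R_def using vfun.subspace_add[OF U(1)] by (auto simp: radd[symmetric])
  next
    fix c u assume "u \<in> R"
    then show "pointwise_scale (*s) c u \<in> R"
      unfolding R_def using vfun.subspace_scale[OF U(1)] by (auto simp: rscale[symmetric])
  qed
  moreover have "restr F f \<notin> R"
  proof
    assume "restr F f \<in> R"
    then obtain u where u: "u \<in> U" "restr F f = restr F u" by (auto simp: R_def)
    have "f x = u x" if "x \<in> F" for x
    proof -
      have "restr F f x = restr F u x" using u(2) by simp
      then show ?thesis using that by (simp add: restr_def)
    qed
    then show False using far u(1) F(3) by force
  qed
  ultimately obtain \<phi> where \<phi>: "\<And>v w. \<phi> (v + w) = \<phi> v + \<phi> w"
    "\<And>c v. \<phi> (pointwise_scale (*s) c v) = c * \<phi> v" "\<And>v. v \<in> R \<Longrightarrow> \<phi> v = 0" "\<phi> (restr F f) = 1"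
    using vfun.separating_functional[of R "restr F f"] by metis
  have \<phi>0: "\<phi> 0 = 0" using \<phi>(1)[of 0 0] by simp
  have \<phi>sum: "\<phi> (\<Sum>x\<in>A. h x) = (\<Sum>x\<in>A. \<phi> (h x))" for A :: "'c set" and h
    by (induction A rule: infinite_finite_induct)
      (simp_all only: sum.infinite sum.empty sum.insert \<phi>0 \<phi>(1) not_False_eq_True)
  define \<delta> where "\<delta> g i = (\<lambda>h. if h = g then axis i 1 else 0 :: complex ^ 'n)" for g :: 'a and i :: 'n
  define l where "l = (\<Sum>g\<in>F. \<Sum>i\<in>UNIV. (\<lambda>u. \<phi> (\<delta> g i) * evaluation g i u))"
  have "l \<in> gm.W"
    unfolding W_eq l_def using F(2)
    by (intro gm.span_sum gm.span_scale[of "evaluation _ _"] gm.span_base) auto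
  moreover have l: "l u = \<phi> (restr F u)" for u
  proof -
    have "restr F u = (\<Sum>g\<in>F. \<Sum>i\<in>UNIV. pointwise_scale (*s) (u g $ i) (\<delta> g i))"
    proof (rule ext)
      fix h
      have "(\<Sum>g\<in>F. \<Sum>i\<in>UNIV. pointwise_scale (*s) (u g $ i) (\<delta> g i)) h
          = (\<Sum>g\<in>F. \<Sum>i\<in>UNIV. (u g $ i) *s \<delta> g i h)"
        by (simp add: sum_fun_apply pointwise_scale_def)
      also have "\<dots> = (\<Sum>g\<in>F. if h = g then u g else 0)"
        by (intro sum.cong refl) (auto simp: \<delta>_def basis_expansion)
      also have "\<dots> = restr F u h" using F(1) by (simp add: restr_def)
      finally show "restr F u h = (\<Sum>g\<in>F. \<Sum>i\<in>UNIV. pointwise_scale (*s) (u g $ i) (\<delta> g i)) h" ..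
    qed
    then show ?thesis
      by (simp add: \<phi>sum \<phi>(2) l_def sum_fun_apply evaluation_def mult.commute)
  qed
  ultimately show ?thesis using \<phi>(3,4) by (intro that[of l]) (auto simp: R_def)
qed

text \<open>
  Suppose that \<open>f0 \<in> V\<close> is not a limit of combinations of exponential polynomials in \<open>V\<close>, and let \<open>x\<close> be a
  functional that vanishes on these but not at \<open>f0\<close>. Then \<open>x\<close> is not in the annihilator \<open>K0\<close> of \<open>V\<close>. If
  \<open>K\<close> contains \<open>K0\<close>, avoids \<open>x\<close> and has finite codimension, a linear form \<open>\<phi>\<close> on
  \<open>W\<close> that vanishes on \<open>K\<close> but not at \<open>x\<close> is evaluation at a function \<open>f\<close>. This \<open>f\<close> is in \<open>V\<close>, its
  translates are annihilated by \<open>K\<close>, and \<open>x f\<close> is not \<open>0\<close>, which contradicts the choice of \<open>x\<close>.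
\<close>

theorem spectral_synthesis_vector:
  "spectral_synthesis ((*s) :: complex \<Rightarrow> complex ^ 'n \<Rightarrow> complex ^ 'n) G"
  unfolding spectral_synthesis_def
proof (intro allI impI equalityI synthesis_superset)
  fix V :: "('a \<Rightarrow> complex ^ 'n) set" assume V: "variety (*s) G V"
  let ?EP = "{f \<in> V. exponential_polynomial (*s) G f}"
  note sV = variety_subspace[OF V]
  have VG: "V \<subseteq> funs_on G" and cV: "closed V"
    and tV: "\<And>g f. g \<in> carrier G \<Longrightarrow> f \<in> V \<Longrightarrow> translate G g f \<in> V"
    using V by (auto simp: variety_def)
  have spanV: "vfun.span ?EP \<subseteq> V" by (rule vfun.span_minimal[OF _ sV]) auto
  show "V \<subseteq> closure (vfun.span ?EP)"
  proof (rule subsetI, rule ccontr)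
    fix f0 assume f0: "f0 \<in> V" "f0 \<notin> closure (vfun.span ?EP)"
    have "vfun.span ?EP \<subseteq> funs_on G" using spanV VG by (rule order_trans)
    moreover have "f0 \<in> funs_on G" using f0(1) VG by (rule rev_subsetD)
    ultimately obtain x where x: "x \<in> gm.W" "\<And>u. u \<in> vfun.span ?EP \<Longrightarrow> x u = 0" "x f0 \<noteq> 0"
      using closure_separation[OF vfun.subspace_span _ _ f0(2)] by blast
    define K0 where "K0 = {l \<in> gm.W. \<forall>u\<in>V. l u = 0}"
    have K0: "gm.stable (carrier G) K0"
    proof (rule gm.stableI)
      show "gm.subspace K0"
        unfolding K0_def
        by (rule gm.subspaceI)
          (auto intro: gm.subspace_0[OF gm.subspace_generated] gm.subspace_add[OF gm.subspace_generated]
            gm.subspace_scale[OF gm.subspace_generated])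
      fix g l assume g: "g \<in> carrier G" and "l \<in> K0"
      then show "dual_translate G g l \<in> K0"
        using gm.stable_T[OF gm.stable_generated g] tV[OF g] unfolding K0_def
        by (auto simp: dual_translate_def)
    qed
    have "K0 \<subseteq> gm.W" "x \<notin> K0" using f0 x by (auto simp: K0_def)
    then obtain K Q where K: "gm.stable (carrier G) K" "K0 \<subseteq> K" "K \<subseteq> gm.W" "x \<notin> K"
      and Q: "finite Q" "Q \<subseteq> gm.W" "gm.W \<subseteq> gm.span (Q \<union> K)"
      using gm.finite_codimension_submodule[OF K0 _ x(1)] by blast
    obtain \<phi> where \<phi>: "\<And>v w. \<phi> (v + w) = \<phi> v + \<phi> w" "\<And>c v. \<phi> (functional_scale c v) = c * \<phi> v"
      "\<And>v. v \<in> K \<Longrightarrow> \<phi> v = 0" "\<phi> x = 1"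
      using gm.separating_functional[OF gm.stable_subspace[OF K(1)] K(4)] by metis
    have \<phi>0: "\<phi> 0 = 0" using \<phi>(1)[of 0 0] by simp
    define f where "f = restr (carrier G) (\<lambda>g. \<chi> i. \<phi> (evaluation g i))"
    have f\<phi>: "l f = \<phi> l" if "l \<in> gm.W" for l
    proof -
      have "l \<in> gm.span {evaluation g i | g i. g \<in> carrier G}" using that W_eq by simp
      then show ?thesis
      proof (induction rule: gm.span_induct_alt)
        case base
        show ?case unfolding \<phi>0 by simp
      next
        case (step c a l)
        then obtain g i where a: "a = evaluation g i" "g \<in> carrier G" by blast
        then have "f g $ i = \<phi> a" by (simp add: f_def restr_def)
        then have "a f = \<phi> a" unfolding a(1) evaluation_def .
        moreover have "\<phi> (functional_scale c a + l) = c * \<phi> a + \<phi> l" by (simp only: \<phi>(1,2))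
        moreover have "(functional_scale c a + l) f = c * a f + l f" by simp
        ultimately show ?case using step.IH by (simp only:)
      qed
    qed
    have fG: "f \<in> funs_on G" by (simp add: f_def funs_on_def restr_def)
    have fV: "f \<in> V"
    proof (rule ccontr)
      assume "f \<notin> V"
      then have "f \<notin> closure V" using cV by simp
      then obtain l where l: "l \<in> gm.W" "\<And>u. u \<in> V \<Longrightarrow> l u = 0" "l f \<noteq> 0"
        using closure_separation[OF sV VG fG] by blast
      then have "l \<in> K" using K(2) by (auto simp: K0_def)
      then have "l f = 0" using f\<phi>[OF l(1)] \<phi>(3) by metis
      with l(3) show False ..
    qed
    define A where "A = {u \<in> funs_on G. \<forall>l\<in>K. l u = 0}"
    have lin: "l (u + v) = l u + l v" "l (pointwise_scale (*s) c u) = c * l u"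
      if "l \<in> gm.W" for l u v c using functional_linear[OF that] by auto
    have l0: "l 0 = 0" if "l \<in> gm.W" for l using lin(1)[OF that, of 0 0] by simp
    have AK: "l u = 0" if "u \<in> A" "l \<in> K" for l u using that unfolding A_def by blast
    have sA: "vfun.subspace A"
    proof (rule vfun.subspaceI)
      have "l 0 = 0" if "l \<in> K" for l by (rule l0[OF subsetD[OF K(3) that]])
      then show "0 \<in> A" by (simp add: A_def funs_on_def)
    next
      fix u v assume uv: "u \<in> A" "v \<in> A"
      have "l (u + v) = 0" if "l \<in> K" for l
        using lin(1)[OF subsetD[OF K(3) that], of u v] AK[OF uv(1) that] AK[OF uv(2) that] by simp
      then show "u + v \<in> A" using uv by (simp add: A_def funs_on_def)
    next
      fix c u assume u: "u \<in> A"
      have "l (pointwise_scale (*s) c u) = 0" if "l \<in> K" for l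
        using lin(2)[OF subsetD[OF K(3) that], of c u] AK[OF u that] by simp
      then show "pointwise_scale (*s) c u \<in> A"
        using u by (simp add: A_def funs_on_def pointwise_scale_def)
    qed
    have "\<exists>D. finite D \<and> A \<subseteq> vfun.span D"
    proof (rule vfun.finitely_many_functionals_finite_dim[OF Q(1) sA])
      fix u assume u: "u \<in> A" "\<And>q. q \<in> Q \<Longrightarrow> q u = 0"
      have zero: "l u = 0" if "l \<in> gm.W" for l
      proof -
        have "l \<in> gm.span (Q \<union> K)" using that Q(3) by blast
        then show ?thesis
        proof (induction rule: gm.span_induct_alt)
          case (step c a l)
          then have "a u = 0" using u(2) AK[OF u(1)] by blast
          then show ?case using step.IH by simp
        qed simp
      qed
      have "evaluation g i u = 0" if "g \<in> carrier G" for g i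
        using that by (intro zero) (auto simp: W_eq intro!: gm.span_base)
      then have "u g = 0" if "g \<in> carrier G" for g
        using that by (simp add: evaluation_def vec_eq_iff)
      then show "u = 0" using u(1) by (auto simp: A_def funs_on_def fun_eq_iff)
    qed (use lin Q(2) in blast)+
    moreover have "translate_span (*s) G f \<subseteq> A"
      unfolding translate_span_def
    proof (rule vfun.span_minimal[OF _ sA], safe)
      fix g assume g: "g \<in> carrier G"
      have "l (translate G g f) = 0" if l: "l \<in> K" for l
      proof -
        have lK: "dual_translate G g l \<in> K" by (rule gm.stable_T[OF K(1) g l])
        then have "dual_translate G g l f = 0" 
          using f\<phi>[OF subsetD[OF K(3) lK]] \<phi>(3)[OF lK] by (simp only:)
        then show ?thesis by (simp add: dual_translate_def)
      qed
      then show "translate G g f \<in> A" by (simp add: A_def translate_funs_on)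
    qed
    ultimately have "exponential_polynomial (*s) G f"
      unfolding exponential_polynomial_def finite_dim_def using fG by blast
    then have "f \<in> vfun.span ?EP" using fV by (intro vfun.span_base) simp
    then have "x f = 0" by (rule x(2))
    then show False using f\<phi>[OF x(1)] \<phi>(4) by (simp only: one_neq_zero)
  qed
qed

end

theorem spectral_synthesis_finite_rank:
  fixes G :: "('a, 'm) monoid_scheme"
  assumes "comm_group G" "torsion_free_rank G <o natLeq"
  shows "spectral_synthesis ((*s) :: complex \<Rightarrow> complex ^ 'n \<Rightarrow> complex ^ 'n) G"
proof -
  define B where "B = (SOME B. maximal_independent_system G B)"
  have "maximal_independent_system G B"
    unfolding B_def by (rule someI_ex[OF ex_maximal_independent_system])
  moreover have "finite B"
    using assms(2) unfolding torsion_free_rank_def B_def[symmetric] by (simp add: finite_iff_ordLess_natLeq)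
  ultimately interpret functionals G B "TYPE('n)"
    using assms(1) by (intro functionals.intro functionals_axioms.intro)
  show ?thesis by (rule spectral_synthesis_vector)
qed

section \<open>Idealization: from scalar to vector valued functions\<close>

interpretation cfun: vector_space
  "pointwise_scale ((*) :: complex \<Rightarrow> complex \<Rightarrow> complex) ::
     complex \<Rightarrow> ('a \<Rightarrow> complex) \<Rightarrow> 'a \<Rightarrow> complex"
  unfolding pointwise_scale_def
  by (rule vector_space_pointwise[OF vector_space_over_itself.vector_space_axioms])

text \<open>
  \<open>H\<close> is a copy of \<open>G \<times> \<int>^n\<close>. A copy is needed because \<open>H\<close> has to live on a prescribed type.
\<close>

locale lattice_extension = G: comm_group G + H: comm_group H
  for G :: "('a, 'm) monoid_scheme" and H :: "('h, 'k) monoid_scheme" +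
  fixes \<psi> :: "'a \<Rightarrow> ('n::finite \<Rightarrow> int) \<Rightarrow> 'h"
  assumes \<psi>_closed: "g \<in> carrier G \<Longrightarrow> \<psi> g z \<in> carrier H"
    and \<psi>_surj: "h \<in> carrier H \<Longrightarrow> \<exists>g\<in>carrier G. \<exists>z. h = \<psi> g z"
    and \<psi>_inj: "g \<in> carrier G \<Longrightarrow> g' \<in> carrier G \<Longrightarrow> \<psi> g z = \<psi> g' z' \<Longrightarrow> g = g' \<and> z = z'"
    and \<psi>_mult: "g \<in> carrier G \<Longrightarrow> g' \<in> carrier G \<Longrightarrow>
      \<psi> (g \<otimes>\<^bsub>G\<^esub> g') (\<lambda>i. z i + z' i) = \<psi> g z \<otimes>\<^bsub>H\<^esub> \<psi> g' z'"
begin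

definition unit_vec :: "'n \<Rightarrow> 'n \<Rightarrow> int" where
  "unit_vec i = (\<lambda>j. if j = i then 1 else 0)"

abbreviation zero_vec :: "'n \<Rightarrow> int" where
  "zero_vec \<equiv> (\<lambda>_. 0)"

lemma \<psi>_mult_zero:
  assumes "g \<in> carrier G" "g' \<in> carrier G"
  shows "\<psi> g z \<otimes>\<^bsub>H\<^esub> \<psi> g' zero_vec = \<psi> (g \<otimes>\<^bsub>G\<^esub> g') z"
  using \<psi>_mult[OF assms, of z zero_vec] by simp

lemma \<psi>_split: "g \<in> carrier G \<Longrightarrow> \<psi> g z = \<psi> g zero_vec \<otimes>\<^bsub>H\<^esub> \<psi> \<one>\<^bsub>G\<^esub> z"
  using \<psi>_mult[of g "\<one>\<^bsub>G\<^esub>" zero_vec z] by simp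

text \<open>
  For \<open>\<alpha> = 1\<close> this is the vector of increments of \<open>F\<close> in the directions of the lattice, which recovers \<open>f\<close> from
  \<open>f0 g + (\<Sum>i\<in>UNIV. z i * f g $ i)\<close>. Other weights \<open>\<alpha>\<close> arise when \<open>F\<close> is the product of a local polynomial and an
  exponential \<open>m\<close>: the values of \<open>m\<close> at the unit vectors of the lattice then become weights of the polynomial factor. The set
  \<open>S\<close> may be a subsemigroup, because local polynomials are defined by restriction to such sets.
\<close>

definition slope_on :: "'a set \<Rightarrow> ('n \<Rightarrow> complex) \<Rightarrow> ('h \<Rightarrow> complex) \<Rightarrow> 'a \<Rightarrow> complex ^ 'n" where
  "slope_on S \<alpha> F = restr S (\<lambda>g. \<chi> i. \<alpha> i * F (\<psi> g (unit_vec i)) - F (\<psi> g zero_vec))"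

abbreviation "slope \<equiv> slope_on (carrier G) (\<lambda>_. 1)"

lemma slope_on_add: "slope_on S \<alpha> (F + F') = slope_on S \<alpha> F + slope_on S \<alpha> F'"
  by (auto simp: slope_on_def restr_def fun_eq_iff vec_eq_iff algebra_simps)

lemma slope_on_scale:
  "slope_on S \<alpha> (pointwise_scale (*) c F) = pointwise_scale (*s) c (slope_on S \<alpha> F)"
  by (auto simp: slope_on_def restr_def pointwise_scale_def fun_eq_iff vec_eq_iff algebra_simps)

lemma slope_on_zero: "slope_on S \<alpha> (\<lambda>_. 0) = (\<lambda>_. 0)"
  by (auto simp: slope_on_def restr_def fun_eq_iff vec_eq_iff)

lemma slope_on_span:
  assumes "F \<in> cfun.span D"
  shows "slope_on S \<alpha> F \<in> vfun.span (slope_on S \<alpha> ` D)"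
  using assms
proof (induction rule: cfun.span_induct_alt)
  case base
  have "slope_on S \<alpha> 0 = 0" using slope_on_zero[of S \<alpha>] by (simp add: zero_fun_def)
  then show ?case by (metis vfun.span_zero)
next
  case (step c F F')
  then have "pointwise_scale (*s) c (slope_on S \<alpha> F) + slope_on S \<alpha> F'
      \<in> vfun.span (slope_on S \<alpha> ` D)"
    by (intro vfun.span_add vfun.span_scale) (auto intro: vfun.span_base)
  then show ?case by (simp only: slope_on_add slope_on_scale)
qed

lemma continuous_on_slope: "continuous_on UNIV slope"
  unfolding slope_on_def restr_def
proof (rule continuous_on_coordinatewise_then_product)
  fix g
  show "continuous_on UNIV (\<lambda>F :: 'h \<Rightarrow> complex. if g \<in> carrier G
      then \<chi> i. 1 * F (\<psi> g (unit_vec i)) - F (\<psi> g zero_vec) else 0)"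
  proof (cases "g \<in> carrier G")
    case True
    have eval: "continuous_on UNIV (\<lambda>F :: 'h \<Rightarrow> complex. F x)" for x
      by (rule continuous_on_product_coordinates)
    show ?thesis using True
      by (simp, intro continuous_on_vec_lambda continuous_on_diff eval)
  qed simp
qed

context
  fixes S :: "'a set" and S' :: "'h set" and \<alpha> :: "'n \<Rightarrow> complex"
  assumes S: "S \<subseteq> carrier G" and S_mult: "\<And>s s'. s \<in> S \<Longrightarrow> s' \<in> S \<Longrightarrow> s \<otimes>\<^bsub>G\<^esub> s' \<in> S"
    and S'_zero: "\<And>s. s \<in> S \<Longrightarrow> \<psi> s zero_vec \<in> S'"
    and S'_unit: "\<And>s i. s \<in> S \<Longrightarrow> \<psi> s (unit_vec i) \<in> S'"
begin

lemma slope_on_translate: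
  assumes "h \<in> S"
  shows "slope_on S \<alpha> (translate (H\<lparr>carrier := S'\<rparr>) (\<psi> h zero_vec) F)
    = translate (G\<lparr>carrier := S\<rparr>) h (slope_on S \<alpha> F)"
proof (rule ext)
  fix g
  show "slope_on S \<alpha> (translate (H\<lparr>carrier := S'\<rparr>) (\<psi> h zero_vec) F) g
    = translate (G\<lparr>carrier := S\<rparr>) h (slope_on S \<alpha> F) g"
  proof (cases "g \<in> S")
    case True
    then have "g \<in> carrier G" "h \<in> carrier G" using S assms by auto
    then show ?thesis using True assms
      by (simp add: slope_on_def translate_def restr_def S_mult S'_zero S'_unit \<psi>_mult_zero)
  qed (simp add: slope_on_def translate_def restr_def)
qed

lemma slope_on_difference:
  assumes "h \<in> S"
  shows "slope_on S \<alpha> (difference (H\<lparr>carrier := S'\<rparr>) (\<psi> h zero_vec) F)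
    = difference (G\<lparr>carrier := S\<rparr>) h (slope_on S \<alpha> F)"
proof (rule ext)
  fix g
  show "slope_on S \<alpha> (difference (H\<lparr>carrier := S'\<rparr>) (\<psi> h zero_vec) F) g
    = difference (G\<lparr>carrier := S\<rparr>) h (slope_on S \<alpha> F) g"
  proof (cases "g \<in> S")
    case True
    then have "g \<in> carrier G" "h \<in> carrier G" using S assms by auto
    then show ?thesis using True assms
      by (simp add: slope_on_def difference_def restr_def S_mult S'_zero S'_unit \<psi>_mult_zero
          vec_eq_iff algebra_simps)
  qed (simp add: slope_on_def difference_def restr_def)
qed

lemma slope_on_differences:
  assumes "set hs \<subseteq> S"
  shows "slope_on S \<alpha> (foldr (difference (H\<lparr>carrier := S'\<rparr>)) (map (\<lambda>h. \<psi> h zero_vec) hs) F)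
    = foldr (difference (G\<lparr>carrier := S\<rparr>)) hs (slope_on S \<alpha> F)"
  using assms by (induction hs) (simp_all add: slope_on_difference)

text \<open>
  Slopes commute with translations and differences by elements of \<open>S\<close>, and they are linear; so they preserve
  the vanishing of differences and the finite dimension of the span of translates.
\<close>

lemma slope_on_polynomial:
  assumes "polynomial_on (*) (H\<lparr>carrier := S'\<rparr>) P"
  shows "polynomial_on (*s) (G\<lparr>carrier := S\<rparr>) (slope_on S \<alpha> P)"
  unfolding polynomial_on_def
proof
  obtain n where n: "\<And>hs. set hs \<subseteq> S' \<Longrightarrow> length hs = Suc n \<Longrightarrow>
      foldr (difference (H\<lparr>carrier := S'\<rparr>)) hs P = (\<lambda>_. 0)"
    using assms by (auto simp: polynomial_on_def generalized_polynomial_def)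
  have "foldr (difference (G\<lparr>carrier := S\<rparr>)) hs (slope_on S \<alpha> P) = (\<lambda>_. 0)"
    if "set hs \<subseteq> S" "length hs = Suc n" for hs
  proof -
    have "foldr (difference (H\<lparr>carrier := S'\<rparr>)) (map (\<lambda>h. \<psi> h zero_vec) hs) P = (\<lambda>_. 0)"
      by (rule n) (use that S'_zero in auto)
    then show ?thesis using slope_on_differences[OF that(1), of P] by (simp add: slope_on_zero)
  qed
  then show "generalized_polynomial (G\<lparr>carrier := S\<rparr>) (slope_on S \<alpha> P)"
    unfolding generalized_polynomial_def by (auto simp: funs_on_def slope_on_def restr_def)
  obtain D where D: "finite D" "translate_span (*) (H\<lparr>carrier := S'\<rparr>) P \<subseteq> cfun.span D"
    using assms by (auto simp: polynomial_on_def finite_dim_def)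
  have "translate (G\<lparr>carrier := S\<rparr>) h (slope_on S \<alpha> P) \<in> vfun.span (slope_on S \<alpha> ` D)"
    if "h \<in> S" for h
  proof -
    have "translate (H\<lparr>carrier := S'\<rparr>) (\<psi> h zero_vec) P \<in> cfun.span D"
      using D(2) S'_zero[OF that] unfolding translate_span_def
      by (auto intro: cfun.span_base)
    from slope_on_span[OF this, of S \<alpha>] show ?thesis by (simp add: slope_on_translate[OF that])
  qed
  then have "translate_span (*s) (G\<lparr>carrier := S\<rparr>) (slope_on S \<alpha> P)
      \<subseteq> vfun.span (slope_on S \<alpha> ` D)"
    unfolding translate_span_def by (intro vfun.span_minimal) auto
  then show "finite_dim (*s) (translate_span (*s) (G\<lparr>carrier := S\<rparr>) (slope_on S \<alpha> P))"
    unfolding finite_dim_def using D(1) by (intro exI[of _ "slope_on S \<alpha> ` D"]) simp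
qed

end

text \<open>
  On the subsemigroup generated by a finite set \<open>F\<close>, the slope depends only on the values of \<open>p\<close> on the subsemigroup
  of \<open>H\<close> that is generated by \<open>F\<close> and the unit vectors of the lattice.
\<close>

lemma slope_local_polynomial:
  assumes p: "local_polynomial (*) H p"
  shows "local_polynomial (*s) G (slope_on (carrier G) \<alpha> p)"
  unfolding local_polynomial_def Let_def
proof (intro conjI allI impI)
  show "slope_on (carrier G) \<alpha> p \<in> funs_on G" by (simp add: slope_on_def funs_on_def restr_def)
next
  fix F assume F: "finite F \<and> F \<subseteq> carrier G"
  define S where "S = subsemigroup_generated G F"
  define F' where "F' = (\<lambda>g. \<psi> g zero_vec) ` F \<union> range (\<lambda>i. \<psi> \<one>\<^bsub>G\<^esub> (unit_vec i))"
  define S' where "S' = subsemigroup_generated H F'"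
  have S: "s \<in> carrier G" if "s \<in> S" for s
    using that unfolding S_def by induction (use F in auto)
  have S_mult: "s \<in> S \<Longrightarrow> s' \<in> S \<Longrightarrow> s \<otimes>\<^bsub>G\<^esub> s' \<in> S" for s s'
    unfolding S_def by (rule subsemigroup_generated.mult)
  have S'_zero: "\<psi> s zero_vec \<in> S'" if "s \<in> S" for s
    using that unfolding S_def
  proof induction
    case (base s)
    then show ?case by (auto simp: S'_def F'_def intro: subsemigroup_generated.base)
  next
    case (mult s s')
    then have "\<psi> (s \<otimes>\<^bsub>G\<^esub> s') zero_vec = \<psi> s zero_vec \<otimes>\<^bsub>H\<^esub> \<psi> s' zero_vec"
      using S by (intro \<psi>_mult_zero[symmetric]) (auto simp: S_def)
    with mult.IH show ?case unfolding S'_def by (simp only: subsemigroup_generated.mult)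
  qed
  have S'_unit: "\<psi> s (unit_vec i) \<in> S'" if "s \<in> S" for s i
  proof -
    have "\<psi> \<one>\<^bsub>G\<^esub> (unit_vec i) \<in> S'"
      by (auto simp: S'_def F'_def intro: subsemigroup_generated.base)
    then show ?thesis
      using S'_zero[OF that] \<psi>_split[OF S[OF that], of "unit_vec i"]
      unfolding S'_def by (simp only: subsemigroup_generated.mult)
  qed
  have "finite F' \<and> F' \<subseteq> carrier H" using F by (auto simp: F'_def intro: \<psi>_closed)
  then have "polynomial_on (*) (H\<lparr>carrier := S'\<rparr>) (restr S' p)"
    using p by (auto simp: local_polynomial_def Let_def S'_def)
  then have "polynomial_on (*s) (G\<lparr>carrier := S\<rparr>) (slope_on S \<alpha> (restr S' p))"
    by (intro slope_on_polynomial) (use S S_mult S'_zero S'_unit in auto)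
  moreover have "slope_on S \<alpha> (restr S' p) = restr S (slope_on (carrier G) \<alpha> p)"
    using S by (auto simp: slope_on_def restr_def fun_eq_iff S'_zero S'_unit)
  ultimately show "polynomial_on (*s) (G\<lparr>carrier := subsemigroup_generated G F\<rparr>)
      (restr (subsemigroup_generated G F) (slope_on (carrier G) \<alpha> p))"
    unfolding S_def by simp
qed

lemma exponential_restriction:
  assumes "exponential H m"
  shows "exponential G (restr (carrier G) (\<lambda>g. m (\<psi> g zero_vec)))"
proof -
  have m: "m (x \<otimes>\<^bsub>H\<^esub> y) = m x * m y" if "x \<in> carrier H" "y \<in> carrier H" for x y
    using assms that by (simp add: exponential_def)
  obtain x where x: "m x \<noteq> 0" using assms unfolding exponential_def by (metis ext)
  then have "x \<in> carrier H" using assms by (auto simp: exponential_def funs_on_def)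
  then obtain g z where g: "g \<in> carrier G" "x = \<psi> g z" using \<psi>_surj by blast
  then have "m (\<psi> g zero_vec) \<noteq> 0" using x \<psi>_split[of g z] m by (simp add: \<psi>_closed)
  then have "restr (carrier G) (\<lambda>g. m (\<psi> g zero_vec)) g \<noteq> 0" using g by (simp add: restr_def)
  then have "restr (carrier G) (\<lambda>g. m (\<psi> g zero_vec)) \<noteq> (\<lambda>_. 0)" by metis
  then show ?thesis
    by (auto simp: exponential_def funs_on_def restr_def \<psi>_closed m \<psi>_mult_zero[symmetric])
qed

text \<open>
  An exponential \<open>m\<close> on \<open>H\<close> satisfies \<open>m (\<psi> x e) = m (\<psi> x 0) * m (\<psi> 1 e)\<close>. Hence the slope of \<open>m * p\<close> is
  the restriction of \<open>m\<close> to \<open>G\<close> times a weighted slope of \<open>p\<close>.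
\<close>

lemma slope_local_exponential_polynomial:
  assumes "local_exponential_polynomial (*) H F"
  shows "local_exponential_polynomial (*s) G (slope F)"
proof -
  obtain N :: nat and m p where mp: "\<And>j. j < N \<Longrightarrow> exponential H (m j)"
    "\<And>j. j < N \<Longrightarrow> local_polynomial (*) H (p j)" and F: "F = (\<lambda>x. \<Sum>j<N. m j x * p j x)"
    using assms by (auto simp: local_exponential_polynomial_def)
  define \<mu> where "\<mu> j = restr (carrier G) (\<lambda>g. m j (\<psi> g zero_vec))" for j
  define q where "q j = slope_on (carrier G) (\<lambda>i. m j (\<psi> \<one>\<^bsub>G\<^esub> (unit_vec i))) (p j)" for j
  have "slope F = (\<lambda>x. \<Sum>j<N. \<mu> j x *s q j x)"
  proof (rule ext)
    fix x
    show "slope F x = (\<Sum>j<N. \<mu> j x *s q j x)"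
    proof (cases "x \<in> carrier G")
      case True
      have "m j (\<psi> x (unit_vec i)) = m j (\<psi> x zero_vec) * m j (\<psi> \<one>\<^bsub>G\<^esub> (unit_vec i))"
        if "j < N" for j i
        using mp(1)[OF that] \<psi>_split[OF True, of "unit_vec i"] True
        by (simp add: exponential_def \<psi>_closed)
      then show ?thesis using True
        by (simp add: vec_eq_iff slope_on_def restr_def \<mu>_def q_def F sum_subtractf[symmetric]
            algebra_simps sum_component)
    qed (simp add: slope_on_def restr_def \<mu>_def q_def)
  qed
  then show ?thesis
    unfolding local_exponential_polynomial_def
    using exponential_restriction[OF mp(1)] slope_local_polynomial[OF mp(2)]
    by (intro exI[of _ N] exI[of _ \<mu>] exI[of _ q]) (auto simp: \<mu>_def q_def)
qed

text \<open>
  The condition that \<open>F\<close> has the form \<open>f0 g + (\<Sum>i\<in>UNIV. z i * f g $ i)\<close>, expressed by linear equations between the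
  values of \<open>F\<close>. In this form it is visibly closed.
\<close>

definition affine_in_lattice :: "('h \<Rightarrow> complex) \<Rightarrow> bool" where
  "affine_in_lattice F \<longleftrightarrow> (\<forall>g\<in>carrier G. \<forall>z.
     F (\<psi> g z) = F (\<psi> g zero_vec) + (\<Sum>i\<in>UNIV. of_int (z i) * slope F g $ i))"

lemma affine_in_latticeD:
  "affine_in_lattice F \<Longrightarrow> g \<in> carrier G \<Longrightarrow>
    F (\<psi> g z) = F (\<psi> g zero_vec) + (\<Sum>i\<in>UNIV. of_int (z i) * slope F g $ i)"
  unfolding affine_in_lattice_def by blast

definition affine_variety :: "('a \<Rightarrow> complex ^ 'n) set \<Rightarrow> ('h \<Rightarrow> complex) set" where
  "affine_variety V = {F \<in> funs_on H. affine_in_lattice F \<and> slope F \<in> V}"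

text \<open>
  A translation by a lattice vector changes only the term \<open>f0\<close>, on which there is no condition. This is why the
  affine functions with slope in \<open>V\<close> form a variety.
\<close>

lemma translate_affine:
  assumes F: "affine_in_lattice F" and g: "g0 \<in> carrier G"
  shows "affine_in_lattice (translate H (\<psi> g0 z0) F)"
    and "slope (translate H (\<psi> g0 z0) F) = translate G g0 (slope F)"
proof -
  let ?T = "translate H (\<psi> g0 z0) F"
  have T: "?T (\<psi> g z) = F (\<psi> (g \<otimes>\<^bsub>G\<^esub> g0) zero_vec)
      + (\<Sum>i\<in>UNIV. of_int (z i + z0 i) * slope F (g \<otimes>\<^bsub>G\<^esub> g0) $ i)" if "g \<in> carrier G" for g z
  proof -
    have "?T (\<psi> g z) = F (\<psi> g z \<otimes>\<^bsub>H\<^esub> \<psi> g0 z0)"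
      using that by (simp add: translate_def restr_def \<psi>_closed)
    also have "\<dots> = F (\<psi> (g \<otimes>\<^bsub>G\<^esub> g0) (\<lambda>i. z i + z0 i))" using that g by (simp add: \<psi>_mult)
    also have "\<dots> = F (\<psi> (g \<otimes>\<^bsub>G\<^esub> g0) zero_vec)
      + (\<Sum>i\<in>UNIV. of_int (z i + z0 i) * slope F (g \<otimes>\<^bsub>G\<^esub> g0) $ i)"
      using F that g unfolding affine_in_lattice_def by blast
    finally show ?thesis .
  qed
  have unit: "(\<Sum>j\<in>UNIV. of_int (unit_vec i j) * a j) = a i" for i and a :: "'n \<Rightarrow> complex"
    by (simp add: unit_vec_def if_distrib if_distribR cong: if_cong)
  have diff: "?T (\<psi> g (unit_vec i)) - ?T (\<psi> g zero_vec) = slope F (g \<otimes>\<^bsub>G\<^esub> g0) $ i"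
    if "g \<in> carrier G" for g i
    using that unit[of i] by (simp add: T distrib_right sum.distrib)
  show slope: "slope ?T = translate G g0 (slope F)"
  proof (rule ext)
    fix g
    show "slope ?T g = translate G g0 (slope F) g"
    proof (cases "g \<in> carrier G")
      case True
      then have "slope ?T g = (\<chi> i. ?T (\<psi> g (unit_vec i)) - ?T (\<psi> g zero_vec))"
        by (simp add: slope_on_def restr_def)
      also have "\<dots> = slope F (g \<otimes>\<^bsub>G\<^esub> g0)" using diff[OF True] by (simp add: vec_eq_iff)
      also have "\<dots> = translate G g0 (slope F) g" using True by (simp add: translate_def restr_def)
      finally show ?thesis .
    qed (simp add: slope_on_def translate_def restr_def)
  qed
  show "affine_in_lattice ?T"
    unfolding affine_in_lattice_def slope
  proof (intro ballI allI)
    fix g z assume gG: "g \<in> carrier G"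
    have "translate G g0 (slope F) g = slope F (g \<otimes>\<^bsub>G\<^esub> g0)"
      using gG by (simp add: translate_def restr_def)
    then show "?T (\<psi> g z) = ?T (\<psi> g zero_vec)
        + (\<Sum>i\<in>UNIV. of_int (z i) * translate G g0 (slope F) g $ i)"
      by (simp only: T[OF gG]) (simp add: distrib_right sum.distrib)
  qed
qed

lemma variety_affine:
  assumes V: "variety (*s) G V"
  shows "variety (*) H (affine_variety V)"
proof -
  have sV: "vfun.subspace V" and cV: "closed V"
    and tV: "\<And>g f. g \<in> carrier G \<Longrightarrow> f \<in> V \<Longrightarrow> translate G g f \<in> V"
    using V by (auto simp: variety_def)
  have slope0: "slope 0 = 0" using slope_on_zero by (simp add: zero_fun_def)
  have "cfun.subspace (affine_variety V)"
  proof (rule cfun.subspaceI)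
    show "0 \<in> affine_variety V"
      using vfun.subspace_0[OF sV] slope0
      by (auto simp: affine_variety_def affine_in_lattice_def funs_on_def)
  next
    fix F F' assume F: "F \<in> affine_variety V" "F' \<in> affine_variety V"
    have "affine_in_lattice (F + F')"
      unfolding affine_in_lattice_def slope_on_add
    proof (intro ballI allI)
      fix g z assume g: "g \<in> carrier G"
      have "affine_in_lattice F" "affine_in_lattice F'" using F by (simp_all add: affine_variety_def)
      then have "F (\<psi> g z) + F' (\<psi> g z)
          = (F (\<psi> g zero_vec) + (\<Sum>i\<in>UNIV. of_int (z i) * slope F g $ i))
          + (F' (\<psi> g zero_vec) + (\<Sum>i\<in>UNIV. of_int (z i) * slope F' g $ i))"
        by (intro arg_cong2[of _ _ _ _ "(+)"] affine_in_latticeD g)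
      then show "(F + F') (\<psi> g z) = (F + F') (\<psi> g zero_vec)
          + (\<Sum>i\<in>UNIV. of_int (z i) * (slope F + slope F') g $ i)"
        by (simp add: distrib_left sum.distrib)
    qed
    moreover have "slope (F + F') \<in> V"
      unfolding slope_on_add using F vfun.subspace_add[OF sV] by (simp add: affine_variety_def)
    ultimately show "F + F' \<in> affine_variety V"
      using F by (simp add: affine_variety_def funs_on_def)
  next
    fix c F assume F: "F \<in> affine_variety V"
    have "slope (pointwise_scale (*) c F) \<in> V"
      unfolding slope_on_scale using F vfun.subspace_scale[OF sV] by (simp add: affine_variety_def)
    moreover have "affine_in_lattice (pointwise_scale (*) c F)"
      unfolding affine_in_lattice_def slope_on_scale
    proof (intro ballI allI)
      fix g z assume g: "g \<in> carrier G"
      have "affine_in_lattice F" using F by (simp add: affine_variety_def)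
      then have "c * F (\<psi> g z) = c * (F (\<psi> g zero_vec) + (\<Sum>i\<in>UNIV. of_int (z i) * slope F g $ i))"
        by (intro arg_cong[of _ _ "(*) c"] affine_in_latticeD g)
      then show "pointwise_scale (*) c F (\<psi> g z) = pointwise_scale (*) c F (\<psi> g zero_vec)
          + (\<Sum>i\<in>UNIV. of_int (z i) * pointwise_scale (*s) c (slope F) g $ i)"
        by (simp add: pointwise_scale_def distrib_left sum_distrib_left mult.left_commute)
    qed
    ultimately show "pointwise_scale (*) c F \<in> affine_variety V"
      using F by (simp add: affine_variety_def funs_on_def pointwise_scale_def)
  qed
  moreover have "closed (affine_variety V)"
  proof -
    have eval: "continuous_on UNIV (\<lambda>F :: 'h \<Rightarrow> complex. F x)" for x
      by (rule continuous_on_product_coordinates)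
    have slope_eval: "continuous_on UNIV (\<lambda>F. slope F g $ i)" for g i
      by (rule continuous_on_component[OF
            continuous_on_product_then_coordinatewise[OF continuous_on_slope]])
    have "affine_variety V = {F. \<forall>x. x \<notin> carrier H \<longrightarrow> F x = 0} \<inter>
        {F. \<forall>g z. g \<in> carrier G \<longrightarrow>
          F (\<psi> g z) = F (\<psi> g zero_vec) + (\<Sum>i\<in>UNIV. of_int (z i) * slope F g $ i)} \<inter> slope -` V"
      by (auto simp: affine_variety_def affine_in_lattice_def funs_on_def)
    also have "closed \<dots>"
      by (intro closed_Int closed_Collect_all closed_Collect_imp open_Collect_const closed_Collect_eq
          closed_vimage[OF cV continuous_on_slope] continuous_on_add continuous_on_sum
          continuous_on_mult_left continuous_on_const eval slope_eval)
    finally show ?thesis .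
  qed
  moreover have "translate H h F \<in> affine_variety V" if h: "h \<in> carrier H" and F: "F \<in> affine_variety V" for h F
  proof -
    obtain g z where g: "g \<in> carrier G" "h = \<psi> g z" using \<psi>_surj[OF h] by blast
    have "translate G g (slope F) \<in> V" using F by (intro tV g) (simp add: affine_variety_def)
    then show ?thesis
      using F translate_affine[OF _ g(1), of F z] translate_funs_on[of H h F]
      by (simp add: affine_variety_def g(2))
  qed
  ultimately show ?thesis unfolding variety_def by (auto simp: affine_variety_def)
qed

lemma slope_surjective:
  assumes "f \<in> funs_on G"
  shows "\<exists>F \<in> funs_on H. affine_in_lattice F \<and> slope F = f"
proof -
  define pr where "pr h = (SOME p. fst p \<in> carrier G \<and> h = \<psi> (fst p) (snd p))" for h
  have pr: "pr (\<psi> g z) = (g, z)" if "g \<in> carrier G" for g z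
    unfolding pr_def by (rule some_equality) (use that \<psi>_inj in force)+
  define F where "F = restr (carrier H) (\<lambda>h. \<Sum>i\<in>UNIV. of_int (snd (pr h) i) * f (fst (pr h)) $ i)"
  have F: "F (\<psi> g z) = (\<Sum>i\<in>UNIV. of_int (z i) * f g $ i)" if "g \<in> carrier G" for g z
    using that by (simp add: F_def restr_def \<psi>_closed pr)
  have unit: "(\<Sum>j\<in>UNIV. of_int (unit_vec i j) * a j) = a i" for i and a :: "'n \<Rightarrow> complex"
    by (simp add: unit_vec_def if_distrib if_distribR cong: if_cong)
  have "slope F = f"
    using assms by (auto simp: slope_on_def restr_def fun_eq_iff vec_eq_iff F unit funs_on_def)
  moreover have "affine_in_lattice F" unfolding affine_in_lattice_def \<open>slope F = f\<close> by (simp add: F)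
  moreover have "F \<in> funs_on H" by (simp add: F_def funs_on_def restr_def)
  ultimately show ?thesis by blast
qed

text \<open>
  The slope is continuous, linear and maps the variety of affine functions onto \<open>V\<close>, and local exponential
  polynomials to local exponential polynomials; hence it transports the approximation from \<open>H\<close> to \<open>G\<close>.
\<close>

theorem local_spectral_synthesis_descends:
  assumes "local_spectral_synthesis ((*) :: complex \<Rightarrow> complex \<Rightarrow> complex) H"
  shows "local_spectral_synthesis ((*s) :: complex \<Rightarrow> complex ^ 'n \<Rightarrow> complex ^ 'n) G"
  unfolding local_spectral_synthesis_def
proof (intro allI impI equalityI synthesis_superset)
  fix V :: "('a \<Rightarrow> complex ^ 'n) set" assume V: "variety (*s) G V"
  let ?P = "{F \<in> affine_variety V. local_exponential_polynomial (*) H F}"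
    and ?Q = "{f \<in> V. local_exponential_polynomial (*s) G f}"
  have W: "affine_variety V = closure (cfun.span ?P)"
    using assms variety_affine[OF V] unfolding local_spectral_synthesis_def by blast
  have "slope ` ?P \<subseteq> ?Q" using slope_local_exponential_polynomial by (auto simp: affine_variety_def)
  then have "slope ` cfun.span ?P \<subseteq> vfun.span ?Q"
    using slope_on_span[of _ ?P "carrier G" "\<lambda>_. 1"] vfun.span_mono by blast
  then have "slope ` cfun.span ?P \<subseteq> closure (vfun.span ?Q)" using closure_subset by (rule order_trans)
  then have sub: "slope ` closure (cfun.span ?P) \<subseteq> closure (vfun.span ?Q)"
    by (intro image_closure_subset continuous_on_subset[OF continuous_on_slope]) auto
  show "V \<subseteq> closure (vfun.span ?Q)"
  proof
    fix f assume f: "f \<in> V"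
    then have "f \<in> funs_on G" using V by (auto simp: variety_def)
    then obtain F where "F \<in> funs_on H" "affine_in_lattice F" "slope F = f"
      using slope_surjective by blast
    then have "F \<in> closure (cfun.span ?P)" "f = slope F"
      using f W[symmetric] by (simp_all add: affine_variety_def)
    then show "f \<in> closure (vfun.span ?Q)" using subsetD[OF sub imageI] by simp
  qed
qed

end

section \<open>The torsion free rank of the extension\<close>

lemma card_of_Times_ordLeq_infinite:
  assumes "infinite A" "|X| \<le>o |A|" "|Y| \<le>o |A|"
  shows "|X \<times> Y| \<le>o |A|"
  using card_of_Sigma_ordLeq_infinite[OF assms(1,2), of "\<lambda>_. Y"] assms(3) by simp

lemma card_lists_ordLeq:
  assumes A: "infinite A" and X: "|X| \<le>o |A|"
  shows "|lists X| \<le>o |A|"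
proof -
  have "|{xs \<in> lists X. length xs = n}| \<le>o |A|" for n
  proof (induction n)
    case 0
    have "{xs \<in> lists X. length xs = 0} = {[]}" by auto
    then show ?case using A by (metis card_of_singl_ordLeq finite.emptyI)
  next
    case (Suc n)
    let ?Y = "{xs \<in> lists X. length xs = n}"
    have "{xs \<in> lists X. length xs = Suc n} \<subseteq> (\<lambda>(x, xs). x # xs) ` (X \<times> ?Y)"
    proof
      fix ys assume "ys \<in> {xs \<in> lists X. length xs = Suc n}"
      then obtain x xs where "ys = x # xs" "x \<in> X" "xs \<in> ?Y" by (cases ys) auto
      then show "ys \<in> (\<lambda>(x, xs). x # xs) ` (X \<times> ?Y)" by force
    qed
    then have "|{xs \<in> lists X. length xs = Suc n}| \<le>o |(\<lambda>(x, xs). x # xs) ` (X \<times> ?Y)|"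
      by (rule card_of_mono1)
    also have "|(\<lambda>(x, xs). x # xs) ` (X \<times> ?Y)| \<le>o |X \<times> ?Y|" by (rule card_of_image)
    also have "|X \<times> ?Y| \<le>o |A|" by (rule card_of_Times_ordLeq_infinite[OF A X Suc])
    finally show ?case .
  qed
  moreover have "|UNIV :: nat set| \<le>o |A|" using A infinite_iff_card_of_nat by blast
  moreover have "lists X = (\<Union>n. {xs \<in> lists X. length xs = n})" by auto
  ultimately show ?thesis
    using card_of_UNION_ordLeq_infinite[OF A, of UNIV "\<lambda>n. {xs \<in> lists X. length xs = n}"] by simp
qed

lemma countable_ordLeq_infinite:
  assumes "infinite A" "countable X"
  shows "|X| \<le>o |A|"
proof -
  have "|X| \<le>o |UNIV :: nat set|"
    using assms(2) card_of_ordLeqI[of "to_nat_on X" X UNIV] by (auto intro: inj_on_to_nat_on)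
  then show ?thesis using assms(1) infinite_iff_card_of_nat ordLeq_transitive by blast
qed

context comm_group begin

text \<open>
  Relations are encoded as lists, since the set of lists over an infinite set has the same cardinality as the set.
\<close>

definition list_value :: "('a \<times> int) list \<Rightarrow> 'a" where
  "list_value xs = foldr (\<lambda>(b, c) y. b [^] c \<otimes> y) xs \<one>"

lemma finprod_as_list:
  assumes "finite F" "F \<subseteq> carrier G"
  shows "\<exists>xs \<in> lists (F \<times> UNIV). (\<Otimes>b\<in>F. b [^] (c b :: int)) = list_value xs"
  using assms
proof (induction F)
  case empty
  show ?case by (rule bexI[of _ "[]"]) (auto simp: list_value_def)
next
  case (insert b F)
  then obtain xs where xs: "xs \<in> lists (F \<times> UNIV)" "(\<Otimes>b\<in>F. b [^] c b) = list_value xs" by auto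
  have "(\<Otimes>b\<in>insert b F. b [^] c b) = b [^] c b \<otimes> (\<Otimes>b\<in>F. b [^] c b)"
    by (rule finprod_insert) (use insert in auto)
  then have "(\<Otimes>b\<in>insert b F. b [^] c b) = list_value ((b, c b) # xs)"
    by (simp add: xs(2) list_value_def)
  then show ?case using xs(1) by (intro bexI[of _ "(b, c b) # xs"]) auto
qed

lemma independent_equal_powers:
  assumes B: "independent_system G B" "b \<in> B" "b' \<in> B" and d: "(d::nat) > 0" "b [^] d = b' [^] d"
  shows "b = b'"
proof (rule ccontr)
  assume ne: "b \<noteq> b'"
  have C: "b \<in> carrier G" "b' \<in> carrier G" using B by (auto simp: independent_system_def)
  define c where "c x = (if x = b then int d else - int d)" for x
  have "(\<Otimes>x\<in>{b, b'}. x [^] c x) = b [^] int d \<otimes> b' [^] (- int d)"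
    using ne C by (simp add: c_def)
  also have "\<dots> = \<one>" using C d by (simp add: int_pow_neg_int int_pow_int)
  finally have one: "(\<Otimes>x\<in>{b, b'}. x [^] c x) = \<one>" .
  have "c b = 0" by (rule independent_systemD[OF B(1) _ _ one]) (use B in auto)
  then show False using d by (simp add: c_def)
qed

end

context lattice_extension begin

lemma \<psi>_one: "\<psi> \<one>\<^bsub>G\<^esub> zero_vec = \<one>\<^bsub>H\<^esub>"
proof -
  have c: "\<psi> \<one>\<^bsub>G\<^esub> zero_vec \<in> carrier H" by (simp add: \<psi>_closed)
  have "\<psi> \<one>\<^bsub>G\<^esub> zero_vec \<otimes>\<^bsub>H\<^esub> \<psi> \<one>\<^bsub>G\<^esub> zero_vec = \<psi> \<one>\<^bsub>G\<^esub> zero_vec"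
    using \<psi>_mult_zero[of "\<one>\<^bsub>G\<^esub>" "\<one>\<^bsub>G\<^esub>" zero_vec] by simp
  then show ?thesis using c H.r_cancel_one by blast
qed

lemma \<psi>_pow: "g \<in> carrier G \<Longrightarrow> \<psi> g z [^]\<^bsub>H\<^esub> (d::nat) = \<psi> (g [^]\<^bsub>G\<^esub> d) (\<lambda>i. int d * z i)"
  by (induction d) (simp_all add: \<psi>_one \<psi>_mult[symmetric] algebra_simps)

text \<open>
  To \<open>b\<close> in \<open>B'\<close> assign an exponent \<open>d\<close>, an expression of the \<open>G\<close>-component of \<open>b^d\<close> by \<open>B\<close>, and the lattice
  component of \<open>b\<close>. These data determine \<open>b^d\<close>, and distinct elements of an independent system have distinct
  powers. So \<open>B'\<close> embeds into the set of the data.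
\<close>

lemma independent_system_card:
  assumes B: "maximal_independent_system G B" and B': "independent_system H B'"
  shows "|B'| \<le>o |B <+> (UNIV :: nat set)|"
proof -
  let ?A = "B <+> (UNIV :: nat set)"
  have A: "infinite ?A" by (simp add: finite_Plus_iff)
  have BC: "B \<subseteq> carrier G" using B by (auto simp: maximal_independent_system_def independent_system_def)
  let ?T = "lists (B \<times> (UNIV :: int set)) \<times> (UNIV :: (nat \<times> ('n \<Rightarrow> int)) set)"
  have "\<exists>t\<in>?T. fst (snd t) > 0 \<and> b [^]\<^bsub>H\<^esub> fst (snd t)
      = \<psi> (G.list_value (fst t)) (\<lambda>i. int (fst (snd t)) * snd (snd t) i)" if "b \<in> B'" for b
  proof -
    have "b \<in> carrier H" using that B' by (auto simp: independent_system_def)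
    then obtain g z where g: "g \<in> carrier G" "b = \<psi> g z" using \<psi>_surj by blast
    obtain d :: nat and F and c :: "'a \<Rightarrow> int" where d: "d > 0" "finite F" "F \<subseteq> B"
      "g [^]\<^bsub>G\<^esub> d = (\<Otimes>\<^bsub>G\<^esub>b\<in>F. b [^]\<^bsub>G\<^esub> c b)"
      using G.dependence_on_maximal_system[OF B g(1)] by metis
    have "F \<subseteq> carrier G" using d(3) BC by (rule order_trans)
    then obtain xs where xs: "xs \<in> lists (F \<times> UNIV)" "g [^]\<^bsub>G\<^esub> d = G.list_value xs"
      using G.finprod_as_list[OF d(2), of c] d(4) by auto
    have "xs \<in> lists (B \<times> UNIV)" using xs(1) d(3) by (auto simp: lists_eq_set)
    moreover have "b [^]\<^bsub>H\<^esub> d = \<psi> (G.list_value xs) (\<lambda>i. int d * z i)"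
      using \<psi>_pow[OF g(1)] g(2) xs(2) by simp
    ultimately show ?thesis using d(1) by (intro bexI[of _ "(xs, d, z)"]) auto
  qed
  then obtain t where t: "\<And>b. b \<in> B' \<Longrightarrow> t b \<in> ?T" "\<And>b. b \<in> B' \<Longrightarrow> fst (snd (t b)) > 0"
    "\<And>b. b \<in> B' \<Longrightarrow> b [^]\<^bsub>H\<^esub> fst (snd (t b))
      = \<psi> (G.list_value (fst (t b))) (\<lambda>i. int (fst (snd (t b))) * snd (snd (t b)) i)"
    by metis
  have "inj_on t B'"
  proof (rule inj_onI)
    fix b b' assume b: "b \<in> B'" "b' \<in> B'" "t b = t b'"
    show "b = b'"
      by (rule H.independent_equal_powers[OF B' b(1,2) t(2)[OF b(1)]])
        (use t(3)[OF b(1)] t(3)[OF b(2)] b(3) in simp)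
  qed
  then have "|B'| \<le>o |?T|" using t(1) by (rule card_of_ordLeqI)
  also have "|?T| \<le>o |?A|"
  proof (rule card_of_Times_ordLeq_infinite[OF A])
    have "|B \<times> (UNIV :: int set)| \<le>o |?A|"
      by (rule card_of_Times_ordLeq_infinite[OF A card_of_Plus1 countable_ordLeq_infinite[OF A]]) simp
    then show "|lists (B \<times> (UNIV :: int set))| \<le>o |?A|" by (rule card_lists_ordLeq[OF A])
    show "|UNIV :: (nat \<times> ('n \<Rightarrow> int)) set| \<le>o |?A|" by (rule countable_ordLeq_infinite[OF A]) simp
  qed
  finally show ?thesis .
qed

lemma torsion_free_rank_extension:
  assumes \<kappa>: "Card_order \<kappa>" "natLeq <o \<kappa>" and rank: "torsion_free_rank G <o \<kappa>"
  shows "torsion_free_rank H <o \<kappa>"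
proof -
  define B where "B = (SOME B. maximal_independent_system G B)"
  define B' where "B' = (SOME B. maximal_independent_system H B)"
  have B: "maximal_independent_system G B"
    unfolding B_def by (rule someI_ex[OF ex_maximal_independent_system])
  have "maximal_independent_system H B'"
    unfolding B'_def by (rule someI_ex[OF ex_maximal_independent_system])
  then have "|B'| \<le>o |B <+> (UNIV :: nat set)|"
    by (intro independent_system_card[OF B]) (simp add: maximal_independent_system_def)
  also have "|B <+> (UNIV :: nat set)| <o \<kappa>"
  proof (rule card_of_Plus_ordLess_infinite_Field)
    show "infinite (Field \<kappa>)"
      using \<kappa> by (metis cinfinite_def cinfinite_mono natLeq_cinfinite ordLess_imp_ordLeq)
    show "|B| <o \<kappa>" using rank by (simp add: torsion_free_rank_def B_def)
    show "|UNIV :: nat set| <o \<kappa>" using card_of_nat \<kappa>(2) by (rule ordIso_ordLess_trans)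
  qed (rule \<kappa>)
  finally show ?thesis by (simp add: torsion_free_rank_def B'_def)
qed

end

text \<open>
  For infinite \<open>'a\<close> the summand \<open>'a\<close> has room for the product with a countable set; for finite \<open>'a\<close> the product is
  countable and the other summand is used.
\<close>

lemma ex_injection_lattice:
  "\<exists>f :: 'a \<times> ('n::finite \<Rightarrow> int) \<Rightarrow> 'a + nat set. inj f"
proof (cases "finite (UNIV :: 'a set)")
  case True
  then have "countable (UNIV :: ('a \<times> ('n \<Rightarrow> int)) set)"
    by (simp add: countable_finite flip: UNIV_Times_UNIV)
  then obtain f :: "'a \<times> ('n \<Rightarrow> int) \<Rightarrow> nat" where "inj f" by (auto simp: countable_def)
  then have "inj (\<lambda>x. Inr {f x} :: 'a + nat set)" by (auto simp: inj_def)
  then show ?thesis by blast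
next
  case False
  then have "|(UNIV :: 'a set) \<times> (UNIV :: ('n \<Rightarrow> int) set)| \<le>o |UNIV :: 'a set|"
    by (intro card_of_Times_ordLeq_infinite[OF False card_of_mono1[OF subset_refl]
          countable_ordLeq_infinite[OF False countableI_type]])
  then obtain f :: "'a \<times> ('n \<Rightarrow> int) \<Rightarrow> 'a" where "inj_on f (UNIV \<times> UNIV)"
    by (auto simp flip: card_of_ordLeq)
  then have "inj (\<lambda>x. Inl (f x) :: 'a + nat set)" by (auto simp: inj_def)
  then show ?thesis by blast
qed

lemma ex_lattice_extension:
  fixes G :: "('a, 'm) monoid_scheme"
  assumes "comm_group G"
  shows "\<exists>(H :: ('a + nat set) monoid) (\<psi> :: 'a \<Rightarrow> ('n::finite \<Rightarrow> int) \<Rightarrow> _). lattice_extension G H \<psi>"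
proof -
  interpret comm_group G by fact
  obtain f :: "'a \<times> ('n \<Rightarrow> int) \<Rightarrow> 'a + nat set" where f: "inj f" using ex_injection_lattice by blast
  have inv_f: "inv_into UNIV f (f p) = p" for p using f by simp
  define \<psi> where "\<psi> g z = f (g, z)" for g z
  define H :: "('a + nat set) monoid" where
    "H = \<lparr>carrier = f ` (carrier G \<times> UNIV),
          monoid.mult = (\<lambda>x y. let p = inv_into UNIV f x; q = inv_into UNIV f y
            in f (fst p \<otimes>\<^bsub>G\<^esub> fst q, \<lambda>i. snd p i + snd q i)),
          one = f (\<one>\<^bsub>G\<^esub>, \<lambda>_. 0)\<rparr>"
  have mult: "f p \<otimes>\<^bsub>H\<^esub> f q = f (fst p \<otimes>\<^bsub>G\<^esub> fst q, \<lambda>i. snd p i + snd q i)" for p q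
    by (simp add: H_def inv_f)
  have carr: "carrier H = f ` (carrier G \<times> UNIV)" and one: "\<one>\<^bsub>H\<^esub> = f (\<one>\<^bsub>G\<^esub>, \<lambda>_. 0)"
    by (simp_all add: H_def)
  have H: "comm_group H"
  proof (rule comm_groupI)
    fix x assume "x \<in> carrier H"
    then obtain g z where x: "x = f (g, z)" "g \<in> carrier G" by (auto simp: carr)
    show "\<exists>y\<in>carrier H. y \<otimes>\<^bsub>H\<^esub> x = \<one>\<^bsub>H\<^esub>"
      using x by (intro bexI[of _ "f (inv\<^bsub>G\<^esub> g, \<lambda>i. - z i)"]) (auto simp: mult one carr)
  qed (auto simp: carr one mult m_ac add_ac)
  have "lattice_extension G H \<psi>"
    unfolding lattice_extension_def lattice_extension_axioms_def \<psi>_def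
    using assms H f by (auto simp: carr mult dest: injD)
  then show ?thesis by blast
qed

text \<open>
  Part (i) is \<open>spectral_synthesis_finite_rank\<close>. For part (ii) the property that defines \<open>\<kappa>\<close> is applied to a
  copy of \<open>G \<times> \<int>^n\<close>.
\<close>

theorem theorem18:
  fixes G :: "'a monoid"
  assumes "comm_group G"
  shows
    "(torsion_free_rank G <o natLeq \<longrightarrow>
        spectral_synthesis ((*s) :: complex \<Rightarrow> complex ^ 'n \<Rightarrow> complex ^ 'n) G) \<and>
     (\<forall>\<kappa> :: 'c rel. local_synthesis_cardinal TYPE('a + nat set) \<kappa> \<longrightarrow>
        torsion_free_rank G <o \<kappa> \<longrightarrow>
        local_spectral_synthesis ((*s) :: complex \<Rightarrow> complex ^ 'n \<Rightarrow> complex ^ 'n) G)"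
proof (intro conjI impI allI)
  assume "torsion_free_rank G <o natLeq"
  then show "spectral_synthesis ((*s) :: complex \<Rightarrow> complex ^ 'n \<Rightarrow> complex ^ 'n) G"
    by (rule spectral_synthesis_finite_rank[OF assms])
next
  fix \<kappa> :: "'c rel"
  assume \<kappa>: "local_synthesis_cardinal TYPE('a + nat set) \<kappa>" and rank: "torsion_free_rank G <o \<kappa>"
  obtain H :: "('a + nat set) monoid" and \<psi> :: "'a \<Rightarrow> ('n \<Rightarrow> int) \<Rightarrow> 'a + nat set"
    where "lattice_extension G H \<psi>"
    using ex_lattice_extension[OF assms] by blast
  then interpret lattice_extension G H \<psi> .
  have "Card_order \<kappa>" "natLeq <o \<kappa>" using \<kappa> by (simp_all add: local_synthesis_cardinal_def)
  then have "torsion_free_rank H <o \<kappa>" using rank by (rule torsion_free_rank_extension)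
  then have "local_spectral_synthesis ((*) :: complex \<Rightarrow> complex \<Rightarrow> complex) H"
    using \<kappa> H.comm_group_axioms by (simp add: local_synthesis_cardinal_def)
  then show "local_spectral_synthesis ((*s) :: complex \<Rightarrow> complex ^ 'n \<Rightarrow> complex ^ 'n) G"
    by (rule local_spectral_synthesis_descends)
qed

end
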